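(* Let $G$ be a countable discrete group and $c$ a 2-cocycle on $G$. Suppose $S$ is maximal among abelian subgroups of $G$ on which $c$ is symmetric, and that $S$ is normal and immediately centralizing. Put $A=C^*_r(G,c)$ and $B=C^*_r(S,c)$, so that $(A,B)$ is a Cartan pair, let $\alpha$ be the action of $G/S$ on $\widehat B$ given by $\alpha_{[g]}=\alpha_{\delta_g}$, and let $\mathcal{K}=(G/S)\,{}_\alpha\!\ltimes\widehat B$ be the transformation groupoid. If $\alpha$ is topologically free, then the map $$\varphi:\mathcal{K}\to\mathcal{G}_{(A,B)},\qquad\varphi([g],x)=[\alpha_g(x),\delta_g,x],$$ is an isomorphism of topological groupoids from $\mathcal{K}$ onto the Weyl groupoid $\mathcal{G}_{(A,B)}$.
   Context: 2-cocycles. A 2-cocycle on a group $G$ is $c:G\times G\to\mathbb{T}$ with $c(g,e)=c(e,g)=1$ and $c(g,hk)c(h,k)=c(gh,k)c(g,h)$; it is symmetric on $S$ if $c(s,t)=c(t,s)$ for all $s,t\in S$. $C^*_r(G,c)$ is the completion of $C_c(G)$, with $\delta_g\delta_h=c(g,h)\delta_{gh}$ and $\delta_g^*=\overline{c(g,g^{-1})}\delta_{g^{-1}}$, in the operator norm of its left regular representation on $\ell^2(G)$, $\delta_g\,e_h=c(g,h)e_{gh}$. $C^*_r(S,c)$ is viewed as the closure of $C_c(S)$ in $C^*_r(G,c)$. Immediately centralizing. $\nu\in G$ is $k$-centralizing for $S$ if for every $t\in S$ there is $j\in\{1,\dots,k\}$ with $\nu t^j=t^j\nu$; $S$ is immediately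 centralizing if for every $k\ge1$ each $k$-centralizing element is $1$-centralizing. Cartan pairs. A $C^*$-subalgebra $B\subseteq A$ is Cartan if it is maximal abelian, there is a faithful conditional expectation $A\to B$, the normalizer $N(B)=\{n\in A:nbn^*,n^*bn\in B\ \forall b\in B\}$ generates $A$, and $B$ contains an approximate identity for $A$. (Under the hypotheses above, $(C^*_r(G,c),C^*_r(S,c))$ is a Cartan pair.) Weyl groupoid. Let $(A,B)$ be a separable Cartan pair; identify $B\cong C_0(\widehat B)$ by Gelfand duality. For $n\in N(B)$ let $\mathrm{dom}(n)=\{x\in\widehat B:n^*n(x)>0\}$. There is a unique homeomorphism $\alpha_n:\mathrm{dom}(n)\to\mathrm{dom}(n^* )$ with $n^*bn=(b\circ\alpha_n)\cdot n^*n$ for all $b\in B$. The Weyl groupoid $\mathcal{G}_{(A,B)}$ is the set of classes $[\alpha_n(x),n,x]$ of triples with $n\in N(B)$, $x\in\mathrm{dom}(n)$, where $(\alpha_n(x),n,x)\sim(\alpha_m(y),m,y)$ iff $x=y$ and $\alpha_n=\alpha_m$ on a neighborhood of $x$; multiplication is $[\alpha_n(\alpha_m(x)),n,\alpha_m(x)]\cdot[\alpha_m(x),m,x]=[\alpha_{nm}(x),nm,x]$; basic open sets are $\{[\alpha_n(x),n,x]:\alpha_n(x)\in V,\ x\in U\}$ with $U,V\subseteq\widehat B$ open and $n\in N(B)$. In the group case, each $\delta_g$ ($g\in G$) lies in $N(B)$ and is unitary, so $\alpha_g:=\alpha_{\delta_g}$ is a homeomorphism of $\widehat B$; it depends only on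 the coset $[g]\in G/S$, and $[g]\mapsto\alpha_{[g]}:=\alpha_g$ is an action of $G/S$ on $\widehat B$. The action is topologically free if for every finite $F\subseteq(G/S)\setminus\{e\}$ the set $\{x\in\widehat B:\alpha_q(x)\ne x\ \forall q\in F\}$ is dense in $\widehat B$. The transformation groupoid $\mathcal{K}=(G/S)\,{}_\alpha\!\ltimes\widehat B$ is $(G/S)\times\widehat B$ with the product topology ($G/S$ discrete), $s([g],x)=x$, $r([g],x)=\alpha_g(x)$, and $([g],\alpha_h(y))([h],y)=([gh],y)$. *)

theory Defs
  imports "HOL-Analysis.Analysis" "HOL-Algebra.Coset"
begin

section \<open>The Hilbert space of square-summable functions\<close>

definition sq_summable :: "('a \<Rightarrow> complex) \<Rightarrow> bool" where
  "sq_summable f \<longleftrightarrow> (\<lambda>x. (cmod (f x))\<^sup>2) summable_on UNIV"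

typedef 'a ell2 = "{f :: 'a \<Rightarrow> complex. sq_summable f}"
  morphisms coord Abs_ell2
  by (rule exI[of _ "\<lambda>_. 0"]) (simp add: sq_summable_def)

lemma sq_summable_coord: "sq_summable (coord f)"
  using coord by blast

lemma coord_Abs: "sq_summable f \<Longrightarrow> coord (Abs_ell2 f) = f"
  by (simp add: Abs_ell2_inverse)

lemma ell2_eqI: "(\<And>x. coord f x = coord g x) \<Longrightarrow> f = g"
  by (metis coord_inject ext)

lemma sq_summable_bdd:
  assumes "\<And>F. finite F \<Longrightarrow> (\<Sum>x\<in>F. (cmod (f x))\<^sup>2) \<le> C"
  shows "sq_summable f"
  unfolding sq_summable_def
  by (rule nonneg_bdd_above_summable_on) (use assms in \<open>auto intro!: bdd_aboveI[of _ C]\<close>)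

lemma sq_summable_add:
  assumes "sq_summable f" "sq_summable g"
  shows "sq_summable (\<lambda>x. f x + g x)"
proof -
  have "(\<lambda>x. 2 * (cmod (f x))\<^sup>2 + 2 * (cmod (g x))\<^sup>2) summable_on UNIV"
    using assms unfolding sq_summable_def by (intro summable_on_add summable_on_cmult_right)
  moreover have "(cmod (f x + g x))\<^sup>2 \<le> 2 * (cmod (f x))\<^sup>2 + 2 * (cmod (g x))\<^sup>2" for x
  proof -
    have "(cmod (f x + g x))\<^sup>2 \<le> (cmod (f x) + cmod (g x))\<^sup>2"
      by (intro power_mono norm_triangle_ineq) auto
    also have "\<dots> \<le> 2 * (cmod (f x))\<^sup>2 + 2 * (cmod (g x))\<^sup>2"
      using sum_squares_ge_zero[of "cmod (f x) - cmod (g x)" 0]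
      by (simp add: power2_eq_square algebra_simps)
    finally show ?thesis .
  qed
  ultimately show ?thesis
    unfolding sq_summable_def by (rule summable_on_comparison_test) auto
qed

lemma sq_summable_cmult:
  assumes "sq_summable f"
  shows "sq_summable (\<lambda>x. z * f x)"
  using assms unfolding sq_summable_def
  by (simp add: norm_mult power_mult_distrib summable_on_cmult_right)

lemma summable_cnj_mult:
  assumes "sq_summable f" "sq_summable g"
  shows "(\<lambda>x. cnj (f x) * g x) summable_on UNIV"
proof -
  have "(\<lambda>x. (cmod (f x))\<^sup>2 + (cmod (g x))\<^sup>2) summable_on UNIV"
    using assms unfolding sq_summable_def by (intro summable_on_add)
  then have "(\<lambda>x. norm (cnj (f x) * g x)) summable_on UNIV"
  proof (rule summable_on_comparison_test)
    fix x
    show "norm (cnj (f x) * g x) \<le> (cmod (f x))\<^sup>2 + (cmod (g x))\<^sup>2"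
    proof -
      have "0 \<le> (cmod (f x) - cmod (g x))\<^sup>2" "0 \<le> cmod (f x) * cmod (g x)" by simp_all
      then have "cmod (f x) * cmod (g x) \<le> (cmod (f x))\<^sup>2 + (cmod (g x))\<^sup>2"
        unfolding power2_diff by linarith
      then show ?thesis by (simp add: norm_mult)
    qed
  qed auto
  then show ?thesis by (rule abs_summable_summable)
qed

definition cinner :: "'a ell2 \<Rightarrow> 'a ell2 \<Rightarrow> complex" where
  "cinner f g = (\<Sum>\<^sub>\<infinity>x. cnj (coord f x) * coord g x)"

text \<open>The underlying real Hilbert space has the real part of \<^const>\<open>cinner\<close> as inner product,
  and therefore the usual norm.\<close>

instantiation ell2 :: (type) real_inner
begin

definition "0 = Abs_ell2 (\<lambda>_. 0)"
definition "f + g = Abs_ell2 (\<lambda>x. coord f x + coord g x)" for f g :: "'a ell2"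
definition "- f = Abs_ell2 (\<lambda>x. - coord f x)" for f :: "'a ell2"
definition "f - g = Abs_ell2 (\<lambda>x. coord f x - coord g x)" for f g :: "'a ell2"
definition "r *\<^sub>R f = Abs_ell2 (\<lambda>x. of_real r * coord f x)" for f :: "'a ell2"
definition "f \<bullet> g = Re (cinner f g)" for f g :: "'a ell2"
definition "norm f = sqrt (f \<bullet> f)" for f :: "'a ell2"
definition "dist f g = norm (f - g)" for f g :: "'a ell2"
definition "sgn f = inverse (norm f) *\<^sub>R f" for f :: "'a ell2"
definition "(uniformity :: ('a ell2 \<times> 'a ell2) filter) = (INF e\<in>{0<..}. principal {(x, y). dist x y < e})"
definition "open U \<longleftrightarrow> (\<forall>x\<in>U. eventually (\<lambda>(x', y). x' = x \<longrightarrow> y \<in> U) uniformity)"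
  for U :: "'a ell2 set"

lemma coord_zero: "coord 0 = (\<lambda>_. 0)"
  unfolding zero_ell2_def by (rule coord_Abs) (simp add: sq_summable_def)

lemma coord_add: "coord (f + g) = (\<lambda>x. coord f x + coord g x)"
  unfolding plus_ell2_def by (intro coord_Abs sq_summable_add sq_summable_coord)

lemma coord_uminus: "coord (- f) = (\<lambda>x. - coord f x)"
  unfolding uminus_ell2_def
  using sq_summable_cmult[OF sq_summable_coord[of f], of "-1"] by (intro coord_Abs) simp

lemma coord_diff: "coord (f - g) = (\<lambda>x. coord f x - coord g x)"
  unfolding minus_ell2_def
  using sq_summable_add[OF sq_summable_coord[of f] sq_summable_coord[of "- g"]]
  by (intro coord_Abs) (simp add: coord_uminus)

lemma coord_scaleR: "coord (r *\<^sub>R f) = (\<lambda>x. of_real r * coord f x)"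
  unfolding scaleR_ell2_def by (intro coord_Abs sq_summable_cmult sq_summable_coord)

lemma cinner_self: "cinner f f = of_real (\<Sum>\<^sub>\<infinity>x. (cmod (coord f x))\<^sup>2)"
proof -
  have *: "cnj (coord f x) * coord f x = of_real ((cmod (coord f x))\<^sup>2)" for x
    by (metis complex_norm_square mult.commute)
  show ?thesis
    unfolding cinner_def *
    using sq_summable_coord[of f] unfolding sq_summable_def
    by (intro infsumI has_sum_of_real has_sum_infsum)
qed

instance
proof
  fix f g h :: "'a ell2" and r s :: real
  show "f + g + h = f + (g + h)" "f + g = g + f" "0 + f = f" "- f + f = 0" "f - g = f + - g"
    "r *\<^sub>R (f + g) = r *\<^sub>R f + r *\<^sub>R g" "(r + s) *\<^sub>R f = r *\<^sub>R f + s *\<^sub>R f"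
    "r *\<^sub>R s *\<^sub>R f = (r * s) *\<^sub>R f" "1 *\<^sub>R f = f"
    by (rule ell2_eqI, simp add: coord_zero coord_add coord_uminus coord_diff coord_scaleR algebra_simps)+
  show "sgn f = inverse (norm f) *\<^sub>R f" "dist f g = norm (f - g)" "norm f = sqrt (f \<bullet> f)"
    by (simp_all add: sgn_ell2_def dist_ell2_def norm_ell2_def)
  show "(uniformity :: ('a ell2 \<times> 'a ell2) filter) = (INF e\<in>{0<..}. principal {(x, y). dist x y < e})"
    by (rule uniformity_ell2_def)
  show "open U \<longleftrightarrow> (\<forall>x\<in>U. eventually (\<lambda>(x', y). x' = x \<longrightarrow> y \<in> U) uniformity)" for U :: "'a ell2 set"
    by (rule open_ell2_def)
  have cnj: "cinner f g = cnj (cinner g f)"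
  proof -
    have "cinner f g = (\<Sum>\<^sub>\<infinity>x. cnj (cnj (coord g x) * coord f x))"
      unfolding cinner_def by (intro infsum_cong) (simp only: complex_cnj_mult complex_cnj_cnj mult.commute)
    then show ?thesis unfolding cinner_def by (simp only: infsum_cnj)
  qed
  show "f \<bullet> g = g \<bullet> f"
    unfolding inner_ell2_def by (subst cnj) simp
  show "(f + g) \<bullet> h = f \<bullet> h + g \<bullet> h"
    unfolding inner_ell2_def cinner_def coord_add
    by (simp add: distrib_right infsum_add summable_cnj_mult sq_summable_coord)
  show "(r *\<^sub>R f) \<bullet> g = r * (f \<bullet> g)"
    unfolding inner_ell2_def cinner_def coord_scaleR
    by (simp add: mult.assoc infsum_cmult_right')
  have self: "f \<bullet> f = (\<Sum>\<^sub>\<infinity>x. (cmod (coord f x))\<^sup>2)"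
    unfolding inner_ell2_def cinner_self by simp
  show "0 \<le> f \<bullet> f"
    unfolding self by (rule infsum_nonneg) auto
  show "f \<bullet> f = 0 \<longleftrightarrow> f = 0"
  proof
    assume "f \<bullet> f = 0"
    then have "(cmod (coord f x))\<^sup>2 = 0" for x
      using sq_summable_coord[of f] unfolding self sq_summable_def
      by (intro nonneg_infsum_le_0D[where A = UNIV]) auto
    then show "f = 0" by (intro ell2_eqI) (simp add: coord_zero)
  next
    assume "f = 0"
    then show "f \<bullet> f = 0" unfolding self by (simp add: coord_zero)
  qed
qed

end

lemma norm_ell2_sq: "(norm f)\<^sup>2 = (\<Sum>\<^sub>\<infinity>x. (cmod (coord f x))\<^sup>2)" for f :: "'a ell2"
  by (simp add: power2_norm_eq_inner inner_ell2_def cinner_self)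

lemma sum_coord_le: "finite F \<Longrightarrow> (\<Sum>x\<in>F. (cmod (coord f x))\<^sup>2) \<le> (norm f)\<^sup>2"
  using sq_summable_coord[of f] unfolding norm_ell2_sq sq_summable_def
  by (intro finite_sum_le_infsum) auto

lemma coord_le_norm: "cmod (coord f x) \<le> norm f"
  using sum_coord_le[of "{x}" f] by (auto intro: power2_le_imp_le[OF _ norm_ge_zero])

lemma norm_ell2_leI:
  assumes "\<And>F. finite F \<Longrightarrow> (\<Sum>x\<in>F. (cmod (coord f x))\<^sup>2) \<le> C\<^sup>2" "0 \<le> C"
  shows "norm f \<le> C"
proof -
  have "(norm f)\<^sup>2 \<le> C\<^sup>2"
    unfolding norm_ell2_sq
    by (rule infsum_le_finite_sums[OF sq_summable_coord[unfolded sq_summable_def] assms(1)])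
  then show ?thesis using assms(2) by (rule power2_le_imp_le)
qed

instance ell2 :: (type) banach
proof
  fix X :: "nat \<Rightarrow> 'a ell2"
  assume X: "Cauchy X"
  have "Cauchy (\<lambda>n. coord (X n) x)" for x
  proof (rule metric_CauchyI)
    fix e :: real assume e: "e > 0"
    obtain N where "\<forall>m\<ge>N. \<forall>n\<ge>N. norm (X m - X n) < e"
      using CauchyD[OF X e] by (rule exE)
    then have N: "norm (X m - X n) < e" if "m \<ge> N" "n \<ge> N" for m n
      using that by (simp only:)
    have "dist (coord (X m) x) (coord (X n) x) < e" if "m \<ge> N" "n \<ge> N" for m n
      using N[OF that] coord_le_norm[of "X m - X n" x] unfolding coord_diff dist_norm
      by (rule order.strict_trans1[rotated])
    then show "\<exists>N. \<forall>m\<ge>N. \<forall>n\<ge>N. dist (coord (X m) x) (coord (X n) x) < e"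
      by blast
  qed
  then have L: "(\<lambda>n. coord (X n) x) \<longlonglongrightarrow> lim (\<lambda>n. coord (X n) x)" for x
    by (simp only: Cauchy_convergent convergent_LIMSEQ_iff[symmetric])
  define L where "L x = lim (\<lambda>n. coord (X n) x)" for x
  note L = L[folded L_def]
  have key: "(\<Sum>x\<in>F. (cmod (L x - coord (X n) x))\<^sup>2) \<le> e\<^sup>2"
    if N: "\<And>m n. m \<ge> N \<Longrightarrow> n \<ge> N \<Longrightarrow> norm (X m - X n) < e" and n: "n \<ge> N" and F: "finite F"
    for N n e F
  proof (rule LIMSEQ_le_const2)
    show "(\<lambda>m. \<Sum>x\<in>F. (cmod (coord (X m) x - coord (X n) x))\<^sup>2)
        \<longlonglongrightarrow> (\<Sum>x\<in>F. (cmod (L x - coord (X n) x))\<^sup>2)"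
      by (intro tendsto_intros L)
    show "\<exists>N. \<forall>m\<ge>N. (\<Sum>x\<in>F. (cmod (coord (X m) x - coord (X n) x))\<^sup>2) \<le> e\<^sup>2"
    proof (intro exI allI impI)
      fix m assume "m \<ge> N"
      have "(\<Sum>x\<in>F. (cmod (coord (X m) x - coord (X n) x))\<^sup>2) \<le> (norm (X m - X n))\<^sup>2"
        using sum_coord_le[OF F, of "X m - X n"] unfolding coord_diff .
      also have "\<dots> \<le> e\<^sup>2"
        using N[OF \<open>m \<ge> N\<close> n] by (intro power_mono) auto
      finally show "(\<Sum>x\<in>F. (cmod (coord (X m) x - coord (X n) x))\<^sup>2) \<le> e\<^sup>2" .
    qed
  qed
  obtain N1 where "\<forall>m\<ge>N1. \<forall>n\<ge>N1. norm (X m - X n) < 1"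
    using CauchyD[OF X zero_less_one] by (rule exE)
  then have N1: "norm (X m - X n) < 1" if "m \<ge> N1" "n \<ge> N1" for m n
    using that by (simp only:)
  have "sq_summable (\<lambda>x. L x - coord (X N1) x)"
    by (rule sq_summable_bdd[where C = "1\<^sup>2"]) (rule key[OF N1 order.refl])
  from sq_summable_add[OF this sq_summable_coord[of "X N1"]]
  have "sq_summable L" by simp
  then have cL: "coord (Abs_ell2 L) = L" by (rule coord_Abs)
  have "X \<longlonglongrightarrow> Abs_ell2 L"
  proof (rule LIMSEQ_I)
    fix e :: real assume "e > 0"
    then have e2: "e / 2 > 0" by simp
    obtain N where "\<forall>m\<ge>N. \<forall>n\<ge>N. norm (X m - X n) < e / 2"
      using CauchyD[OF X e2] by (rule exE)
    then have N: "norm (X m - X n) < e / 2" if "m \<ge> N" "n \<ge> N" for m n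
      using that by (simp only:)
    have "norm (X n - Abs_ell2 L) < e" if n: "n \<ge> N" for n
    proof -
      have "norm (Abs_ell2 L - X n) \<le> e / 2"
      proof (rule norm_ell2_leI)
        show "(\<Sum>x\<in>F. (cmod (coord (Abs_ell2 L - X n) x))\<^sup>2) \<le> (e / 2)\<^sup>2" if "finite F" for F
          unfolding coord_diff cL by (rule key[OF N n that])
      qed (use e2 in simp)
      also have "\<dots> < e" using \<open>e > 0\<close> by simp
      finally show ?thesis by (simp only: norm_minus_commute)
    qed
    then show "\<exists>N. \<forall>n\<ge>N. norm (X n - Abs_ell2 L) < e" by (intro exI[of _ N] allI impI)
  qed
  then show "convergent X" by (rule convergentI)
qed

definition unit_vec :: "'a \<Rightarrow> 'a ell2" where
  "unit_vec h = Abs_ell2 (\<lambda>x. if x = h then 1 else 0)"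

definition cmult :: "complex \<Rightarrow> 'a ell2 \<Rightarrow> 'a ell2" where
  "cmult z f = Abs_ell2 (\<lambda>x. z * coord f x)"

lemma coord_cmult: "coord (cmult z f) = (\<lambda>x. z * coord f x)"
  unfolding cmult_def by (intro coord_Abs sq_summable_cmult sq_summable_coord)

lemma coord_unit_vec: "coord (unit_vec h) = (\<lambda>x. if x = h then 1 else 0)"
  unfolding unit_vec_def
proof (rule coord_Abs, rule sq_summable_bdd[where C = 1])
  fix F :: "'a set" assume "finite F"
  have "(\<Sum>x\<in>F. (cmod (if x = h then 1 else 0))\<^sup>2) = (\<Sum>x\<in>F. if x = h then 1 else (0::real))"
    by (rule sum.cong) simp_all
  also have "\<dots> = (if h \<in> F then 1 else 0)"
    using \<open>finite F\<close> by (rule sum.delta)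
  also have "\<dots> \<le> 1" by simp
  finally show "(\<Sum>x\<in>F. (cmod (if x = h then 1 else 0))\<^sup>2) \<le> 1" .
qed

lemma bounded_linear_cmult: "bounded_linear (cmult z)"
proof (rule bounded_linear_intro[where K = "cmod z"])
  show "cmult z (f + g) = cmult z f + cmult z g" for f g :: "'a ell2"
    by (rule ell2_eqI) (simp add: coord_cmult coord_add algebra_simps)
  show "cmult z (r *\<^sub>R f) = r *\<^sub>R cmult z f" for r and f :: "'a ell2"
    by (rule ell2_eqI) (simp add: coord_cmult coord_scaleR)
  show "norm (cmult z f) \<le> norm f * cmod z" for f :: "'a ell2"
  proof (rule norm_ell2_leI)
    fix F :: "'a set" assume "finite F"
    have "(\<Sum>x\<in>F. (cmod (coord (cmult z f) x))\<^sup>2) = (\<Sum>x\<in>F. (cmod (coord f x))\<^sup>2) * (cmod z)\<^sup>2"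
      unfolding sum_distrib_right
      by (intro sum.cong) (simp_all add: coord_cmult norm_mult power_mult_distrib)
    also have "\<dots> \<le> (norm f)\<^sup>2 * (cmod z)\<^sup>2"
      using \<open>finite F\<close> by (intro mult_right_mono sum_coord_le) auto
    finally show "(\<Sum>x\<in>F. (cmod (coord (cmult z f) x))\<^sup>2) \<le> (norm f * cmod z)\<^sup>2"
      by (simp only: power_mult_distrib)
  qed simp
qed


section \<open>Operators\<close>

text \<open>An element of this type is only real linear; the operators that occur below, namely the
  elements of the twisted group algebras, are complex linear. The product is \<open>o\<^sub>L\<close> and
  the norm is the operator norm.\<close>

type_synonym 'a operator = "'a ell2 \<Rightarrow>\<^sub>L 'a ell2"

definition scaleC :: "complex \<Rightarrow> 'a operator \<Rightarrow> 'a operator" where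
  "scaleC z T = Blinfun (cmult z) o\<^sub>L T"

lemma scaleC_apply: "blinfun_apply (scaleC z T) f = cmult z (blinfun_apply T f)"
  by (simp add: scaleC_def bounded_linear_Blinfun_apply bounded_linear_cmult)

definition star :: "'a operator \<Rightarrow> 'a operator" where
  "star T = (THE R. \<forall>f g. cinner (blinfun_apply R f) g = cinner f (blinfun_apply T g))"


section \<open>Twisted group algebras\<close>

definition two_cocycle :: "('a, 'm) monoid_scheme \<Rightarrow> ('a \<Rightarrow> 'a \<Rightarrow> complex) \<Rightarrow> bool" where
  "two_cocycle G c \<longleftrightarrow>
     (\<forall>g\<in>carrier G. \<forall>h\<in>carrier G. cmod (c g h) = 1) \<and>
     (\<forall>g\<in>carrier G. c g \<one>\<^bsub>G\<^esub> = 1 \<and> c \<one>\<^bsub>G\<^esub> g = 1) \<and>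
     (\<forall>g\<in>carrier G. \<forall>h\<in>carrier G. \<forall>k\<in>carrier G.
        c g (h \<otimes>\<^bsub>G\<^esub> k) * c h k = c (g \<otimes>\<^bsub>G\<^esub> h) k * c g h)"

text \<open>The left regular representation; the formula is justified by \<open>delta_unit_vec\<close> and
  \<open>delta_unit_vec_outside\<close> below. As \<open>carrier G\<close> may be a proper subset of the type
  \<open>'a\<close>, the Hilbert space of \<open>G\<close> is the closed span of the \<open>unit_vec h\<close> with
  \<open>h \<in> carrier G\<close>, and an operator on it is extended by \<open>0\<close> to the orthogonal complement.
  In particular, \<open>delta G c \<one>\<close> is the projection onto that span; it is the unit of the
  algebras below.\<close>

definition delta :: "('a, 'm) monoid_scheme \<Rightarrow> ('a \<Rightarrow> 'a \<Rightarrow> complex) \<Rightarrow> 'a \<Rightarrow> 'a operator" where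
  "delta G c g = Blinfun (\<lambda>f. Abs_ell2 (\<lambda>k. if k \<in> carrier G
     then c g (inv\<^bsub>G\<^esub> g \<otimes>\<^bsub>G\<^esub> k) * coord f (inv\<^bsub>G\<^esub> g \<otimes>\<^bsub>G\<^esub> k) else 0))"

context
  fixes G :: "('a, 'm) monoid_scheme" (structure) and c :: "'a \<Rightarrow> 'a \<Rightarrow> complex"
  assumes G: "group G" and c: "two_cocycle G c"
begin

interpretation group G by (rule G)

lemma sum_translate_le:
  assumes g: "g \<in> carrier G" and F: "finite F"
  shows "(\<Sum>k\<in>F. (cmod (if k \<in> carrier G
      then c g (inv g \<otimes> k) * coord f (inv g \<otimes> k) else 0))\<^sup>2) \<le> (norm f)\<^sup>2"
proof -
  have "(\<Sum>k\<in>F. (cmod (if k \<in> carrier G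
      then c g (inv g \<otimes> k) * coord f (inv g \<otimes> k) else 0))\<^sup>2)
    = (\<Sum>k\<in>F \<inter> carrier G. (cmod (coord f (inv g \<otimes> k)))\<^sup>2)"
    using F g c
    by (intro sum.mono_neutral_cong_right) (auto simp: norm_mult two_cocycle_def)
  also have "\<dots> = (\<Sum>k\<in>(\<lambda>k. inv g \<otimes> k) ` (F \<inter> carrier G). (cmod (coord f k))\<^sup>2)"
    using g by (subst sum.reindex) (auto simp: inj_on_def)
  also have "\<dots> \<le> (norm f)\<^sup>2"
    using F by (intro sum_coord_le) auto
  finally show ?thesis .
qed

lemma coord_delta:
  assumes g: "g \<in> carrier G"
  shows "coord (blinfun_apply (delta G c g) f) = (\<lambda>k. if k \<in> carrier G
      then c g (inv g \<otimes> k) * coord f (inv g \<otimes> k) else 0)"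
proof -
  define D where "D f = Abs_ell2 (\<lambda>k. if k \<in> carrier G
     then c g (inv g \<otimes> k) * coord f (inv g \<otimes> k) else 0)" for f
  have coord_D: "coord (D f) = (\<lambda>k. if k \<in> carrier G
      then c g (inv g \<otimes> k) * coord f (inv g \<otimes> k) else 0)" for f
    unfolding D_def
    by (intro coord_Abs sq_summable_bdd[where C = "(norm f)\<^sup>2"] sum_translate_le[OF g])
  have "bounded_linear D"
  proof (rule bounded_linear_intro[where K = 1])
    show "D (f + h) = D f + D h" for f h
      by (rule ell2_eqI) (simp add: coord_D coord_add algebra_simps)
    show "D (r *\<^sub>R f) = r *\<^sub>R D f" for r f
      by (rule ell2_eqI) (simp add: coord_D coord_scaleR)
    show "norm (D f) \<le> norm f * 1" for f
      using sum_translate_le[OF g, of _ f] by (intro norm_ell2_leI) (auto simp: coord_D)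
  qed
  then have "blinfun_apply (delta G c g) = D"
    unfolding delta_def D_def[abs_def] by (rule bounded_linear_Blinfun_apply)
  then show ?thesis by (simp add: coord_D)
qed

lemma delta_unit_vec:
  assumes g: "g \<in> carrier G" and h: "h \<in> carrier G"
  shows "blinfun_apply (delta G c g) (unit_vec h) = cmult (c g h) (unit_vec (g \<otimes> h))"
proof (rule ell2_eqI)
  fix k
  have "inv g \<otimes> k = h \<longleftrightarrow> k = g \<otimes> h" if "k \<in> carrier G"
    using g h that by (metis inv_solve_left)
  then show "coord (blinfun_apply (delta G c g) (unit_vec h)) k
      = coord (cmult (c g h) (unit_vec (g \<otimes> h))) k"
    using g h by (auto simp: coord_delta coord_cmult coord_unit_vec)
qed

lemma delta_unit_vec_outside:
  assumes g: "g \<in> carrier G" and h: "h \<notin> carrier G"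
  shows "blinfun_apply (delta G c g) (unit_vec h) = 0"
proof (rule ell2_eqI)
  fix k
  have "inv g \<otimes> k \<noteq> h" if "k \<in> carrier G"
    using g h that by (metis inv_closed m_closed)
  then show "coord (blinfun_apply (delta G c g) (unit_vec h)) k = coord 0 k"
    using g by (simp add: coord_delta coord_unit_vec coord_zero)
qed

end

text \<open>For \<open>X = carrier G\<close> this is \<open>C\<^sup>*\<^sub>r(G,c)\<close>, for a subgroup \<open>X = S\<close> it is \<open>C\<^sup>*\<^sub>r(S,c)\<close>,
  viewed inside \<open>C\<^sup>*\<^sub>r(G,c)\<close>.\<close>

definition reduced_alg ::
    "('a, 'm) monoid_scheme \<Rightarrow> ('a \<Rightarrow> 'a \<Rightarrow> complex) \<Rightarrow> 'a set \<Rightarrow> 'a operator set" where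
  "reduced_alg G c X =
     closure {\<Sum>g\<in>F. scaleC (a g) (delta G c g) | F a. finite F \<and> F \<subseteq> X}"


section \<open>Hypotheses on the subgroup\<close>

definition abelian_symmetric ::
    "('a, 'm) monoid_scheme \<Rightarrow> ('a \<Rightarrow> 'a \<Rightarrow> complex) \<Rightarrow> 'a set \<Rightarrow> bool" where
  "abelian_symmetric G c S \<longleftrightarrow> subgroup S G \<and>
     (\<forall>s\<in>S. \<forall>t\<in>S. s \<otimes>\<^bsub>G\<^esub> t = t \<otimes>\<^bsub>G\<^esub> s) \<and> (\<forall>s\<in>S. \<forall>t\<in>S. c s t = c t s)"

definition maximal_abelian_symmetric ::
    "('a, 'm) monoid_scheme \<Rightarrow> ('a \<Rightarrow> 'a \<Rightarrow> complex) \<Rightarrow> 'a set \<Rightarrow> bool" where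
  "maximal_abelian_symmetric G c S \<longleftrightarrow> abelian_symmetric G c S \<and>
     (\<forall>T. abelian_symmetric G c T \<and> S \<subseteq> T \<longrightarrow> T = S)"

definition k_centralizing :: "('a, 'm) monoid_scheme \<Rightarrow> 'a set \<Rightarrow> nat \<Rightarrow> 'a \<Rightarrow> bool" where
  "k_centralizing G S k \<nu> \<longleftrightarrow> \<nu> \<in> carrier G \<and>
     (\<forall>t\<in>S. \<exists>j\<in>{1..k}. \<nu> \<otimes>\<^bsub>G\<^esub> (t [^]\<^bsub>G\<^esub> j) = (t [^]\<^bsub>G\<^esub> j) \<otimes>\<^bsub>G\<^esub> \<nu>)"

definition immediately_centralizing :: "('a, 'm) monoid_scheme \<Rightarrow> 'a set \<Rightarrow> bool" where
  "immediately_centralizing G S \<longleftrightarrow>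
     (\<forall>k\<ge>1. \<forall>\<nu>. k_centralizing G S k \<nu> \<longrightarrow> k_centralizing G S 1 \<nu>)"


section \<open>Topological groupoids\<close>

text \<open>A groupoid is given by its arrows, the set of composable pairs, the product and the
  inversion; its units are the products \<open>ginv a \<cdot> a\<close>.\<close>

record 'g groupoid =
  arrows :: "'g topology"
  composable :: "('g \<times> 'g) set"
  gcomp :: "'g \<Rightarrow> 'g \<Rightarrow> 'g"
  ginv :: "'g \<Rightarrow> 'g"

locale topological_groupoid =
  fixes \<G> :: "'g groupoid"
  assumes composable_arrows:
      "composable \<G> \<subseteq> topspace (arrows \<G>) \<times> topspace (arrows \<G>)"
    and comp_arrow: "(a, b) \<in> composable \<G> \<Longrightarrow> gcomp \<G> a b \<in> topspace (arrows \<G>)"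
    and ginv_arrow: "a \<in> topspace (arrows \<G>) \<Longrightarrow> ginv \<G> a \<in> topspace (arrows \<G>)"
    and ginv_ginv: "a \<in> topspace (arrows \<G>) \<Longrightarrow> ginv \<G> (ginv \<G> a) = a"
    and comp_assoc: "(a, b) \<in> composable \<G> \<Longrightarrow> (b, d) \<in> composable \<G> \<Longrightarrow>
      (gcomp \<G> a b, d) \<in> composable \<G> \<and> (a, gcomp \<G> b d) \<in> composable \<G> \<and>
      gcomp \<G> (gcomp \<G> a b) d = gcomp \<G> a (gcomp \<G> b d)"
    and ginv_left: "a \<in> topspace (arrows \<G>) \<Longrightarrow> (ginv \<G> a, a) \<in> composable \<G>"
    and ginv_cancel_left: "(a, b) \<in> composable \<G> \<Longrightarrow> gcomp \<G> (ginv \<G> a) (gcomp \<G> a b) = b"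
    and ginv_right: "a \<in> topspace (arrows \<G>) \<Longrightarrow> (a, ginv \<G> a) \<in> composable \<G>"
    and ginv_cancel_right: "(b, a) \<in> composable \<G> \<Longrightarrow> gcomp \<G> (gcomp \<G> b a) (ginv \<G> a) = b"
    and continuous_comp: "continuous_map
      (subtopology (prod_topology (arrows \<G>) (arrows \<G>)) (composable \<G>)) (arrows \<G>)
      (\<lambda>(a, b). gcomp \<G> a b)"
    and continuous_ginv: "continuous_map (arrows \<G>) (arrows \<G>) (ginv \<G>)"

definition topological_groupoid_iso ::
    "'g groupoid \<Rightarrow> 'h groupoid \<Rightarrow> ('g \<Rightarrow> 'h) \<Rightarrow> bool" where
  "topological_groupoid_iso \<G> \<H> \<phi> \<longleftrightarrow>
     topological_groupoid \<G> \<and> topological_groupoid \<H> \<and>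
     homeomorphic_map (arrows \<G>) (arrows \<H>) \<phi> \<and>
     (\<forall>a\<in>topspace (arrows \<G>). \<forall>b\<in>topspace (arrows \<G>).
        (\<phi> a, \<phi> b) \<in> composable \<H> \<longleftrightarrow> (a, b) \<in> composable \<G>) \<and>
     (\<forall>(a, b)\<in>composable \<G>. \<phi> (gcomp \<G> a b) = gcomp \<H> (\<phi> a) (\<phi> b))"


section \<open>The Weyl groupoid\<close>

text \<open>The points of the Gelfand spectrum are the nonzero characters, as extensional functions on
  the commutative algebra \<open>B\<close>, so that \<open>b(x)\<close> is written \<open>x b\<close>; the topology is the one of
  pointwise convergence.\<close>

definition characters :: "'a operator set \<Rightarrow> ('a operator \<Rightarrow> complex) set" where
  "characters B = {x \<in> extensional B.
     (\<forall>a\<in>B. \<forall>b\<in>B. x (a + b) = x a + x b) \<and>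
     (\<forall>z. \<forall>b\<in>B. x (scaleC z b) = z * x b) \<and>
     (\<forall>a\<in>B. \<forall>b\<in>B. x (a o\<^sub>L b) = x a * x b) \<and>
     (\<exists>b\<in>B. x b \<noteq> 0)}"

definition spectrum :: "'a operator set \<Rightarrow> ('a operator \<Rightarrow> complex) topology" where
  "spectrum B = subtopology (product_topology (\<lambda>_. euclidean) B) (characters B)"

definition normalizer :: "'a operator set \<Rightarrow> 'a operator set \<Rightarrow> 'a operator set" where
  "normalizer A B = {n \<in> A. \<forall>b\<in>B. n o\<^sub>L b o\<^sub>L star n \<in> B \<and> star n o\<^sub>L b o\<^sub>L n \<in> B}"

text \<open>The order on the complex numbers is such that \<open>0 < z\<close> means that \<open>z\<close> is real and
  positive.\<close>

definition weyl_dom :: "'a operator set \<Rightarrow> 'a operator \<Rightarrow> ('a operator \<Rightarrow> complex) set" where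
  "weyl_dom B n = {x \<in> topspace (spectrum B). 0 < x (star n o\<^sub>L n)}"

text \<open>The identity \<open>n\<^sup>*bn = (b \<circ> \<alpha>) \<cdot> n\<^sup>*n\<close> is required on the domain of \<open>\<alpha>\<close>;
  \<open>b \<circ> \<alpha>\<close> is not defined elsewhere.\<close>

definition weyl_map ::
    "'a operator set \<Rightarrow> 'a operator \<Rightarrow> ('a operator \<Rightarrow> complex) \<Rightarrow> 'a operator \<Rightarrow> complex" where
  "weyl_map B n = (THE \<alpha>. \<alpha> \<in> extensional (weyl_dom B n) \<and>
     homeomorphic_map (subtopology (spectrum B) (weyl_dom B n))
       (subtopology (spectrum B) (weyl_dom B (star n))) \<alpha> \<and>
     (\<forall>b\<in>B. \<forall>x\<in>weyl_dom B n. x (star n o\<^sub>L b o\<^sub>L n) = \<alpha> x b * x (star n o\<^sub>L n)))"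

type_synonym 'a weyl_triple =
  "('a operator \<Rightarrow> complex) \<times> 'a operator \<times> ('a operator \<Rightarrow> complex)"

definition weyl_triples :: "'a operator set \<Rightarrow> 'a operator set \<Rightarrow> 'a weyl_triple set" where
  "weyl_triples A B = {(weyl_map B n x, n, x) | n x. n \<in> normalizer A B \<and> x \<in> weyl_dom B n}"

definition weyl_rel ::
    "'a operator set \<Rightarrow> 'a operator set \<Rightarrow> ('a weyl_triple \<times> 'a weyl_triple) set" where
  "weyl_rel A B = {((y, n, x), (y', m, x')).
     (y, n, x) \<in> weyl_triples A B \<and> (y', m, x') \<in> weyl_triples A B \<and> x = x' \<and>
     (\<exists>U. openin (spectrum B) U \<and> x \<in> U \<and> U \<subseteq> weyl_dom B n \<inter> weyl_dom B m \<and>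
        (\<forall>u\<in>U. weyl_map B n u = weyl_map B m u))}"

definition weyl_class :: "'a operator set \<Rightarrow> 'a operator set \<Rightarrow> 'a operator \<Rightarrow>
    ('a operator \<Rightarrow> complex) \<Rightarrow> 'a weyl_triple set" where
  "weyl_class A B n x = weyl_rel A B `` {(weyl_map B n x, n, x)}"

definition weyl_topology ::
    "'a operator set \<Rightarrow> 'a operator set \<Rightarrow> 'a weyl_triple set topology" where
  "weyl_topology A B = topology_generated_by
     {{weyl_class A B n x | x. x \<in> weyl_dom B n \<and> weyl_map B n x \<in> V \<and> x \<in> U} | n U V.
        n \<in> normalizer A B \<and> openin (spectrum B) U \<and> openin (spectrum B) V}"

definition weyl_groupoid ::
    "'a operator set \<Rightarrow> 'a operator set \<Rightarrow> 'a weyl_triple set groupoid" where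
  "weyl_groupoid A B = \<lparr>
     arrows = weyl_topology A B,
     composable = {(P, Q). P \<in> weyl_triples A B // weyl_rel A B \<and>
       Q \<in> weyl_triples A B // weyl_rel A B \<and>
       (\<exists>z n y m x. (z, n, y) \<in> P \<and> (y, m, x) \<in> Q)},
     gcomp = (\<lambda>P Q. \<Union>(z, n, y)\<in>P. \<Union>(y', m, x)\<in>Q. weyl_class A B (n o\<^sub>L m) x),
     ginv = (\<lambda>P. \<Union>(y, n, x)\<in>P. weyl_class A B (star n) y)\<rparr>"


section \<open>The transformation groupoid\<close>

definition topologically_free ::
    "('q, 'm) monoid_scheme \<Rightarrow> 'x topology \<Rightarrow> ('q \<Rightarrow> 'x \<Rightarrow> 'x) \<Rightarrow> bool" where
  "topologically_free Q X \<alpha> \<longleftrightarrow> (\<forall>F. finite F \<and> F \<subseteq> carrier Q - {\<one>\<^bsub>Q\<^esub>} \<longrightarrow>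
     Abstract_Topology.closure_of X {x \<in> topspace X. \<forall>q\<in>F. \<alpha> q x \<noteq> x} = topspace X)"

definition transformation_groupoid ::
    "('q, 'm) monoid_scheme \<Rightarrow> 'x topology \<Rightarrow> ('q \<Rightarrow> 'x \<Rightarrow> 'x) \<Rightarrow> ('q \<times> 'x) groupoid" where
  "transformation_groupoid Q X \<alpha> = \<lparr>
     arrows = prod_topology (discrete_topology (carrier Q)) X,
     composable = {((p, y), (q, x)). p \<in> carrier Q \<and> q \<in> carrier Q \<and>
       y \<in> topspace X \<and> x \<in> topspace X \<and> y = \<alpha> q x},
     gcomp = (\<lambda>(p, y) (q, x). (p \<otimes>\<^bsub>Q\<^esub> q, x)),
     ginv = (\<lambda>(q, x). (inv\<^bsub>Q\<^esub> q, \<alpha> q x))\<rparr>"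

text \<open>The homeomorphism attached to a coset is the common value of the \<open>\<alpha>\<^bsub>\<delta>\<^sub>g\<^esub>\<close> with \<open>g\<close> in
  that coset.\<close>

definition coset_action :: "('a, 'm) monoid_scheme \<Rightarrow> ('a \<Rightarrow> 'a \<Rightarrow> complex) \<Rightarrow> 'a set \<Rightarrow>
    'a set \<Rightarrow> ('a operator \<Rightarrow> complex) \<Rightarrow> 'a operator \<Rightarrow> complex" where
  "coset_action G c S q =
     (THE \<alpha>. \<forall>g\<in>q. \<alpha> = weyl_map (reduced_alg G c S) (delta G c g))"

end

theory Submission
  imports Defs
begin

text \<open>For \<open>n\<close> in the normalizer, \<open>\<alpha>\<^sub>n(x) = x(n\<^sup>* _ n) / x(n\<^sup>* n)\<close> is a character since
  \<open>n n\<^sup>*\<close> lies in the commutative algebra \<open>B\<close>; so the Weyl groupoid can be handled without Gelfand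
  duality, once characters are known to be contractive and nonnegative on \<open>n\<^sup>* n\<close>.

  Surjectivity of \<open>\<phi>\<close> uses the conditional expectation \<open>E\<close> of \<open>A\<close> onto \<open>B\<close>. If \<open>x(n\<^sup>* n) \<noteq> 0\<close>, then
  \<open>a = E(n\<^sup>* \<delta>\<^sub>g)\<close> satisfies \<open>x(a) \<noteq> 0\<close> for some \<open>g\<close>, because the \<open>\<delta>\<^sub>g\<close> span a dense
  subspace. Applying \<open>E\<close> to \<open>(n\<^sup>* b n) (n\<^sup>* \<delta>\<^sub>g) = (n\<^sup>* n) (n\<^sup>* \<delta>\<^sub>g) (\<delta>\<^sub>g\<^sup>* b \<delta>\<^sub>g)\<close> yields
  \<open>(n\<^sup>* b n) a = (n\<^sup>* n) a (\<delta>\<^sub>g\<^sup>* b \<delta>\<^sub>g)\<close>, that is, \<open>\<alpha>\<^sub>n = \<alpha>\<^sub>g\<close> wherever \<open>a\<close> does not vanish. Injectivity is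
  topological freeness: two \<open>\<delta>\<^sub>g\<close>, \<open>\<delta>\<^sub>h\<close> with the same germ make the coset of \<open>h\<^sup>-\<^sup>1 g\<close> act
  trivially on a nonempty open set. Continuity and openness are read off the subbasis, and the
  groupoid axioms for the Weyl groupoid are transported along \<open>\<phi>\<close>.\<close>

section \<open>Complex scalars\<close>

text \<open>A normalizer \<open>n\<close> lies outside \<open>B\<close>, so a character
  \<open>x\<close> has no meaningful value at \<open>n\<close>, and
  \<open>x (star n o\<^sub>L n)\<close> cannot be read as a squared modulus. Nor are characters
  assumed bounded or compatible with \<open>star\<close>: boundedness and positivity must come from
  the algebraic rules alone. A second obstacle is that the operator type is only real linear.
  Complex linearity is recovered from the existence of adjoints, and adjoints therefore have to be
  carried from generators to norm limits. The identity behind surjectivity rests on two exchanges: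
  \<open>b\<close> commutes with \<open>n o\<^sub>L star n\<close>, which is in \<open>B\<close>,
  and passes to the right of the unitary \<open>delta G c g\<close> as its conjugate by that
  unitary. The expectation is compression to the diagonal blocks given by the right cosets of
  \<open>S\<close>; this is defined for every operator and contractive by orthogonality.\<close>

lemma cinner_commute: "cinner f g = cnj (cinner g f)"
proof -
  have "cinner f g = (\<Sum>\<^sub>\<infinity>x. cnj (cnj (coord g x) * coord f x))"
    unfolding cinner_def by (intro infsum_cong) (simp only: complex_cnj_mult complex_cnj_cnj mult.commute)
  then show ?thesis unfolding cinner_def by (simp only: infsum_cnj)
qed

lemma cinner_cmult_right: "cinner f (cmult z g) = z * cinner f g"
  unfolding cinner_def coord_cmult by (simp add: mult.left_commute infsum_cmult_right')

lemma cinner_cmult_left: "cinner (cmult z f) g = cnj z * cinner f g"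
  by (metis cinner_commute cinner_cmult_right complex_cnj_mult)

text \<open>The imaginary part is the real part after multiplying by -i. Additivity and boundedness
  of \<open>cinner\<close> are thereby inherited from the real inner product.\<close>

lemma cinner_eq_Complex: "cinner f g = Complex (f \<bullet> g) (f \<bullet> cmult (- \<i>) g)"
  by (simp add: complex_eq_iff inner_ell2_def cinner_cmult_right)

lemma cmult_add_right: "cmult z (f + g) = cmult z f + cmult z g"
  by (simp add: linear_add bounded_linear.linear bounded_linear_cmult)

lemma cmult_cmult: "cmult z (cmult w f) = cmult (z * w) f"
  by (rule ell2_eqI) (simp add: coord_cmult)

lemma cmult_1 [simp]: "cmult 1 f = f"
  by (rule ell2_eqI) (simp add: coord_cmult)

lemma cmult_add_left: "cmult (z + w) f = cmult z f + cmult w f"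
  by (rule ell2_eqI) (simp add: coord_cmult coord_add algebra_simps)

lemma cmult_of_real: "cmult (of_real r) f = r *\<^sub>R f"
  by (rule ell2_eqI) (simp add: coord_cmult coord_scaleR)

lemma cinner_add_right: "cinner f (g + h) = cinner f g + cinner f h"
  by (simp add: complex_eq_iff cinner_eq_Complex cmult_add_right inner_add_right)

lemma cinner_add_left: "cinner (f + g) h = cinner f h + cinner g h"
  by (simp add: complex_eq_iff cinner_eq_Complex inner_add_left)

lemma bounded_linear_cinner_right: "bounded_linear (cinner f)"
  unfolding cinner_eq_Complex[abs_def] Complex_eq
  by (intro bounded_linear_add bounded_linear_const_mult
    bounded_linear_compose[OF bounded_linear_of_real] bounded_linear_inner_right
    bounded_linear_compose[OF bounded_linear_inner_right] bounded_linear_cmult)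

lemma bounded_linear_cinner_left: "bounded_linear (\<lambda>f. cinner f g)"
  unfolding cinner_eq_Complex[abs_def] Complex_eq
  by (intro bounded_linear_add bounded_linear_const_mult
    bounded_linear_compose[OF bounded_linear_of_real] bounded_linear_inner_left)

lemma ell2_eq_cinnerI:
  assumes "\<And>h. cinner f h = cinner g h"
  shows "f = g"
proof -
  have "f \<bullet> h = g \<bullet> h" for h using assms[of h] by (simp add: inner_ell2_def)
  then show ?thesis by (metis inner_commute vector_eq_ldot)
qed

lemma norm_cmult: "norm (cmult z f) = cmod z * norm f"
proof -
  have "(norm (cmult z f))\<^sup>2 = Re (cnj z * (z * cinner f f))"
    unfolding power2_norm_eq_inner inner_ell2_def by (simp only: cinner_cmult_left cinner_cmult_right mult_ac)
  also have "\<dots> = Re (of_real ((cmod z)\<^sup>2) * of_real ((norm f)\<^sup>2))"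
    unfolding cinner_self norm_ell2_sq[symmetric] complex_norm_square
    by (simp only: mult_ac)
  also have "\<dots> = (cmod z * norm f)\<^sup>2"
    by (simp add: power_mult_distrib flip: of_real_mult of_real_power)
  finally show ?thesis by simp
qed

lemma norm_scaleC_le: "norm (scaleC z T) \<le> cmod z * norm T"
  by (rule norm_blinfun_bound)
    (auto simp: scaleC_apply norm_cmult mult.assoc intro!: mult_left_mono norm_blinfun)

lemma scaleC_add_left: "scaleC (z + w) T = scaleC z T + scaleC w T"
  by (rule blinfun_eqI) (simp add: scaleC_apply blinfun.bilinear_simps cmult_add_left)

lemma scaleC_scaleC: "scaleC z (scaleC w T) = scaleC (z * w) T"
  by (rule blinfun_eqI) (simp add: scaleC_apply cmult_cmult)

lemma scaleC_1 [simp]: "scaleC 1 T = T"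
  by (rule blinfun_eqI) (simp add: scaleC_apply)

lemma scaleC_of_real: "scaleC (of_real r) T = r *\<^sub>R T"
  by (rule blinfun_eqI) (simp add: scaleC_apply cmult_of_real blinfun.bilinear_simps)

lemma scaleR_scaleC: "r *\<^sub>R scaleC z T = scaleC (of_real r * z) T"
  by (metis scaleC_of_real scaleC_scaleC)

lemma scaleC_compose_left: "scaleC z T o\<^sub>L R = scaleC z (T o\<^sub>L R)"
  by (rule blinfun_eqI) (simp add: scaleC_apply)

lemma bounded_linear_scaleC: "bounded_linear (scaleC z)"
  unfolding scaleC_def[abs_def]
  by (rule bounded_bilinear.bounded_linear_right[OF bounded_bilinear_blinfun_compose])

lemma bounded_linear_compose_left: "bounded_linear (\<lambda>R. T o\<^sub>L R)"
  by (rule bounded_bilinear.bounded_linear_right[OF bounded_bilinear_blinfun_compose])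

lemma bounded_linear_compose_right: "bounded_linear (\<lambda>T. T o\<^sub>L R)"
  by (rule bounded_bilinear.bounded_linear_left[OF bounded_bilinear_blinfun_compose])

lemmas compose_add_left = bounded_linear.linear[OF bounded_linear_compose_left, THEN linear_add]
lemmas compose_add_right = bounded_linear.linear[OF bounded_linear_compose_right, THEN linear_add]

lemma blinfun_compose_assoc: "(T o\<^sub>L R) o\<^sub>L Q = T o\<^sub>L (R o\<^sub>L Q)"
  by (rule blinfun_eqI) simp

section \<open>Adjoints\<close>

text \<open>Relational form of \<open>star\<close>: the description defining \<open>star\<close>
  says nothing until an adjoint has been exhibited, so algebra and limits are handled on the
  relation.\<close>

definition is_adjoint :: "'a operator \<Rightarrow> 'a operator \<Rightarrow> bool" where
  "is_adjoint R T \<longleftrightarrow> (\<forall>f g. cinner (blinfun_apply R f) g = cinner f (blinfun_apply T g))"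

lemma star_eqI:
  assumes "is_adjoint R T"
  shows "star T = R"
  unfolding star_def
proof (rule the_equality)
  show "\<forall>f g. cinner (blinfun_apply R f) g = cinner f (blinfun_apply T g)"
    using assms by (simp add: is_adjoint_def)
  show "Q = R" if "\<forall>f g. cinner (blinfun_apply Q f) g = cinner f (blinfun_apply T g)" for Q
    by (intro blinfun_eqI ell2_eq_cinnerI) (use that assms in \<open>simp add: is_adjoint_def\<close>)
qed

lemma is_adjoint_sym: "is_adjoint R T \<Longrightarrow> is_adjoint T R"
  unfolding is_adjoint_def by (metis cinner_commute)

lemma is_adjoint_add: "is_adjoint R T \<Longrightarrow> is_adjoint R' T' \<Longrightarrow> is_adjoint (R + R') (T + T')"
  by (simp add: is_adjoint_def blinfun.bilinear_simps cinner_add_left cinner_add_right)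

lemma is_adjoint_scaleC: "is_adjoint R T \<Longrightarrow> is_adjoint (scaleC (cnj z) R) (scaleC z T)"
  by (simp add: is_adjoint_def scaleC_apply cinner_cmult_left cinner_cmult_right)

lemma is_adjoint_scaleR: "is_adjoint R T \<Longrightarrow> is_adjoint (r *\<^sub>R R) (r *\<^sub>R T)"
  using is_adjoint_scaleC[of R T "of_real r"] by (simp add: scaleC_of_real)

lemma is_adjoint_compose: "is_adjoint R T \<Longrightarrow> is_adjoint R' T' \<Longrightarrow> is_adjoint (R' o\<^sub>L R) (T o\<^sub>L T')"
  by (simp add: is_adjoint_def)

lemma is_adjoint_0: "is_adjoint 0 0"
  using is_adjoint_scaleC[of _ _ 0] by (simp add: is_adjoint_def cinner_def coord_zero)

text \<open>Any operator with an adjoint is complex linear, because \<open>cinner\<close> is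
  sesquilinear and separates vectors. This supplies the linearity that the operator type does not
  record.\<close>

lemma is_adjoint_apply_cmult:
  assumes "is_adjoint R T"
  shows "blinfun_apply T (cmult z f) = cmult z (blinfun_apply T f)"
  by (rule ell2_eq_cinnerI)
    (use is_adjoint_sym[OF assms] in \<open>simp add: is_adjoint_def cinner_cmult_left\<close>)

lemma compose_scaleC:
  assumes "is_adjoint R T"
  shows "T o\<^sub>L scaleC z Q = scaleC z (T o\<^sub>L Q)"
  by (rule blinfun_eqI) (simp add: scaleC_apply is_adjoint_apply_cmult[OF assms])

text \<open>Cauchy-Schwarz applied to the inner product of \<open>f\<close> with
  \<open>T (R f)\<close>, which equals the squared norm of \<open>R f\<close>. Applied to
  differences, it makes passage to adjoints continuous.\<close>

lemma is_adjoint_norm_le: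
  assumes "is_adjoint R T"
  shows "norm R \<le> norm T"
proof (rule norm_blinfun_bound)
  fix f
  let ?Rf = "blinfun_apply R f"
  have "(norm ?Rf)\<^sup>2 = f \<bullet> blinfun_apply T ?Rf"
    using assms by (simp add: power2_norm_eq_inner inner_ell2_def is_adjoint_def)
  also have "\<dots> \<le> norm f * (norm T * norm ?Rf)"
    by (intro order.trans[OF norm_cauchy_schwarz] mult_left_mono norm_blinfun) auto
  finally have "norm ?Rf * norm ?Rf \<le> (norm T * norm f) * norm ?Rf"
    by (simp add: power2_eq_square mult_ac)
  then show "norm ?Rf \<le> norm T * norm f"
    by (cases "norm ?Rf = 0") (auto simp: mult_le_cancel_right)
qed simp

text \<open>Adjoints of a convergent sequence form a Cauchy sequence by
  \<open>is_adjoint_norm_le\<close>, and completeness provides the adjoint of the limit. So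
  existence of adjoints needs checking on generators only.\<close>

lemma closed_is_adjoint:
  assumes "closed W"
  shows "closed {T. \<exists>R\<in>W. is_adjoint R T}"
  unfolding closed_sequential_limits
proof (intro allI impI, elim conjE)
  fix X :: "nat \<Rightarrow> 'a operator" and T
  assume "\<forall>n. X n \<in> {T. \<exists>R\<in>W. is_adjoint R T}" and lim: "X \<longlonglongrightarrow> T"
  then have "\<forall>n. \<exists>R. R \<in> W \<and> is_adjoint R (X n)" by blast
  then obtain Y where Y: "\<And>n. Y n \<in> W" "\<And>n. is_adjoint (Y n) (X n)" by metis
  have "norm (Y m - Y n) \<le> norm (X m - X n)" for m n
    using is_adjoint_norm_le[OF is_adjoint_add[OF Y(2)[of m] is_adjoint_scaleR[OF Y(2)[of n], of "- 1"]]]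
    by simp
  moreover have "Cauchy X" using lim by (rule LIMSEQ_imp_Cauchy)
  ultimately have "Cauchy Y"
    unfolding Cauchy_def dist_norm by (meson order.strict_trans1)
  then obtain R where R: "Y \<longlonglongrightarrow> R" by (auto simp: Cauchy_convergent_iff convergent_def)
  have "R \<in> W" using assms Y(1) R closed_sequentially by blast
  moreover have "is_adjoint R T"
    unfolding is_adjoint_def
  proof (intro allI)
    fix f g
    have "(\<lambda>n. cinner (blinfun_apply (Y n) f) g) \<longlonglongrightarrow> cinner (blinfun_apply R f) g"
      by (intro bounded_linear.tendsto[OF bounded_linear_cinner_left] blinfun.tendsto R tendsto_const)
    moreover have "(\<lambda>n. cinner f (blinfun_apply (X n) g)) \<longlonglongrightarrow> cinner f (blinfun_apply T g)"
      by (intro bounded_linear.tendsto[OF bounded_linear_cinner_right] blinfun.tendsto lim tendsto_const)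
    ultimately show "cinner (blinfun_apply R f) g = cinner f (blinfun_apply T g)"
      using Y(2) by (simp add: is_adjoint_def LIMSEQ_unique)
  qed
  ultimately show "T \<in> {T. \<exists>R\<in>W. is_adjoint R T}" by blast
qed

lemma subspace_is_adjoint:
  assumes W: "subspace W"
  shows "subspace {T. \<exists>R\<in>W. is_adjoint R T}"
  unfolding subspace_def
proof (intro conjI allI ballI)
  show "0 \<in> {T. \<exists>R\<in>W. is_adjoint R T}"
    using is_adjoint_0 subspace_0[OF W] by blast
  fix T assume "T \<in> {T. \<exists>R\<in>W. is_adjoint R T}"
  then obtain R where R: "R \<in> W" "is_adjoint R T" by blast
  show "r *\<^sub>R T \<in> {T. \<exists>R\<in>W. is_adjoint R T}" for r
    using is_adjoint_scaleR[OF R(2)] subspace_scale[OF W R(1)] by blast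
  fix T' assume "T' \<in> {T. \<exists>R\<in>W. is_adjoint R T}"
  then obtain R' where R': "R' \<in> W" "is_adjoint R' T'" by blast
  show "T + T' \<in> {T. \<exists>R\<in>W. is_adjoint R T}"
    using is_adjoint_add[OF R(2) R'(2)] subspace_add[OF W R(1) R'(1)] by blast
qed

lemma adjoint_self_inner:
  assumes "is_adjoint R T"
  shows "cinner f (blinfun_apply (R o\<^sub>L T) f) = of_real ((norm (blinfun_apply T f))\<^sup>2)"
proof -
  have "cinner f (blinfun_apply (R o\<^sub>L T) f) = cinner (blinfun_apply T f) (blinfun_apply T f)"
    using is_adjoint_sym[OF assms] by (simp add: is_adjoint_def)
  then show ?thesis
    by (simp only: cinner_self norm_ell2_sq)
qed

text \<open>Contractivity of a character turns these two bounds into the statement that its value at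
  \<open>R T\<close> is real and nonnegative.\<close>

lemma norm_adjoint_self_imaginary_shift:
  assumes "is_adjoint R T"
  shows "norm ((R o\<^sub>L T) + scaleC (\<i> * of_real t) id_blinfun) \<le> sqrt ((norm (R o\<^sub>L T))\<^sup>2 + t\<^sup>2)"
proof (rule norm_blinfun_bound)
  fix f
  let ?h = "blinfun_apply (R o\<^sub>L T) f"
  \<comment> \<open>The inner product of \<open>f\<close> with \<open>R (T f)\<close> is real, so
    the two summands are orthogonal for the real inner product and their squared norms add.\<close>
  have "?h \<bullet> cmult (\<i> * of_real t) f = 0"
    unfolding inner_ell2_def
    by (subst cinner_commute)
      (simp add: cinner_cmult_left adjoint_self_inner[OF assms] del: blinfun_apply_blinfun_compose)
  moreover have "cmult (\<i> * of_real t) f \<bullet> cmult (\<i> * of_real t) f = t\<^sup>2 * (norm f)\<^sup>2"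
    unfolding inner_ell2_def cinner_cmult_left cinner_cmult_right
    unfolding cinner_self norm_ell2_sq[symmetric]
    by (simp add: power2_eq_square)
  ultimately have "(norm (blinfun_apply ((R o\<^sub>L T) + scaleC (\<i> * of_real t) id_blinfun) f))\<^sup>2
      = (norm ?h)\<^sup>2 + t\<^sup>2 * (norm f)\<^sup>2"
    by (simp add: blinfun.bilinear_simps scaleC_apply power2_norm_eq_inner inner_add_left inner_add_right inner_commute
      del: blinfun_apply_blinfun_compose)
  also have "\<dots> \<le> (norm (R o\<^sub>L T) * norm f)\<^sup>2 + t\<^sup>2 * (norm f)\<^sup>2"
    by (intro add_right_mono power_mono norm_blinfun) auto
  also have "\<dots> = (sqrt ((norm (R o\<^sub>L T))\<^sup>2 + t\<^sup>2) * norm f)\<^sup>2"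
    by (simp add: power_mult_distrib algebra_simps)
  finally show "norm (blinfun_apply ((R o\<^sub>L T) + scaleC (\<i> * of_real t) id_blinfun) f)
      \<le> sqrt ((norm (R o\<^sub>L T))\<^sup>2 + t\<^sup>2) * norm f"
    by (rule power2_le_imp_le) auto
qed simp

lemma norm_adjoint_self_real_shift:
  assumes "is_adjoint R T"
  shows "norm ((norm T)\<^sup>2 *\<^sub>R id_blinfun - (R o\<^sub>L T)) \<le> (norm T)\<^sup>2"
proof (rule norm_blinfun_bound)
  fix f
  let ?r = "(norm T)\<^sup>2"
  let ?h = "blinfun_apply (R o\<^sub>L T) f" and ?n = "(norm (blinfun_apply T f))\<^sup>2"
  have norm_sq: "(norm (r *\<^sub>R u - v))\<^sup>2 = r * r * (norm u)\<^sup>2 - 2 * (r * (u \<bullet> v)) + (norm v)\<^sup>2"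
    for r and u v :: "'a ell2"
    by (simp add: power2_norm_eq_inner inner_diff_left inner_diff_right inner_commute algebra_simps)
  have fh: "f \<bullet> ?h = ?n"
    unfolding inner_ell2_def adjoint_self_inner[OF assms] by simp
  \<comment> \<open>This bounds the squared norm of \<open>?h\<close> by \<open>?r * ?n\<close>,
    half of the cross term that is subtracted when the square is expanded.\<close>
  have "norm ?h \<le> norm R * norm (blinfun_apply T f)" by (simp add: norm_blinfun)
  also have "\<dots> \<le> norm T * norm (blinfun_apply T f)"
    by (intro mult_right_mono is_adjoint_norm_le[OF assms]) auto
  finally have "(norm ?h)\<^sup>2 \<le> (norm T * norm (blinfun_apply T f))\<^sup>2"
    by (intro power_mono) auto
  then have h: "(norm ?h)\<^sup>2 \<le> ?r * ?n" by (simp add: power_mult_distrib)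
  have "(norm (blinfun_apply (?r *\<^sub>R id_blinfun - (R o\<^sub>L T)) f))\<^sup>2
      = (norm (?r *\<^sub>R f - ?h))\<^sup>2"
    by (simp add: blinfun.bilinear_simps)
  also have "\<dots> = ?r * ?r * (norm f)\<^sup>2 - 2 * (?r * (f \<bullet> ?h)) + (norm ?h)\<^sup>2"
    by (rule norm_sq)
  also have "\<dots> \<le> ?r * ?r * (norm f)\<^sup>2 - 2 * (?r * ?n) + ?r * ?n"
    using h fh by simp
  also have "\<dots> \<le> ?r * ?r * (norm f)\<^sup>2" by simp
  also have "\<dots> = (?r * norm f)\<^sup>2" by (simp add: power2_eq_square mult_ac)
  finally show "norm (blinfun_apply (?r *\<^sub>R id_blinfun - (R o\<^sub>L T)) f) \<le> ?r * norm f"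
    by (rule power2_le_imp_le) auto
qed simp

section \<open>Characters of a unital commutative star algebra\<close>

text \<open>Closure under adjoints is stated as existence, since membership of \<open>star T\<close>
  alone would not show that \<open>star T\<close> is an adjoint of \<open>T\<close>.\<close>

locale star_algebra =
  fixes A :: "'a operator set"
  assumes closed_algebra: "closed A"
    and subspace_algebra: "subspace A"
    and scaleC_mem: "T \<in> A \<Longrightarrow> scaleC z T \<in> A"
    and compose_mem: "T \<in> A \<Longrightarrow> R \<in> A \<Longrightarrow> T o\<^sub>L R \<in> A"
    and adjoint_mem: "T \<in> A \<Longrightarrow> \<exists>R\<in>A. is_adjoint R T"
begin

lemma is_adjoint_star: "T \<in> A \<Longrightarrow> is_adjoint (star T) T"
  using adjoint_mem star_eqI by blast

lemma star_mem: "T \<in> A \<Longrightarrow> star T \<in> A"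
  using adjoint_mem star_eqI by blast

lemma star_star: "T \<in> A \<Longrightarrow> star (star T) = T"
  by (simp add: is_adjoint_star is_adjoint_sym star_eqI)

lemma star_compose: "T \<in> A \<Longrightarrow> R \<in> A \<Longrightarrow> star (T o\<^sub>L R) = star R o\<^sub>L star T"
  by (simp add: is_adjoint_star is_adjoint_compose star_eqI)

lemma compose_scaleC_right: "T \<in> A \<Longrightarrow> T o\<^sub>L scaleC z R = scaleC z (T o\<^sub>L R)"
  using compose_scaleC is_adjoint_star by blast

end

text \<open>The unit is a parameter rather than \<open>id_blinfun\<close>: for the group algebras it
  is the projection \<open>delta G c \<one>\<close>, which is proper if the carrier is a proper
  subset of the type.\<close>

locale unital_commutative_pair = A: star_algebra A + B: star_algebra B
  for A B :: "'a operator set" +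
  fixes e :: "'a operator"
  assumes sub: "B \<subseteq> A"
    and commute: "a \<in> B \<Longrightarrow> b \<in> B \<Longrightarrow> a o\<^sub>L b = b o\<^sub>L a"
    and unit_mem: "e \<in> B"
    and unit_left: "T \<in> A \<Longrightarrow> e o\<^sub>L T = T"
    and unit_right: "T \<in> A \<Longrightarrow> T o\<^sub>L e = T"
begin

lemma algebra_mem: "b \<in> B \<Longrightarrow> b \<in> A"
  using sub by blast

text \<open>If \<open>R\<close> is an adjoint of \<open>e\<close>, then
  \<open>R = R o\<^sub>L e\<close> is its own adjoint; uniqueness of adjoints identifies
  \<open>R\<close> with \<open>e\<close>.\<close>

lemma is_adjoint_unit: "is_adjoint e e"
proof -
  obtain R where R: "R \<in> B" "is_adjoint R e" using B.adjoint_mem unit_mem by blast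
  have "is_adjoint (R o\<^sub>L e) (R o\<^sub>L e)"
    by (rule is_adjoint_compose[OF is_adjoint_sym[OF R(2)] R(2)])
  then have "is_adjoint R R" using R(1) unit_right algebra_mem by simp
  with R(2) show ?thesis
    using is_adjoint_sym star_eqI by metis
qed

lemma norm_unit_le: "norm e \<le> 1"
proof (rule norm_blinfun_bound)
  fix f
  let ?ef = "blinfun_apply e f"
  have "(norm ?ef)\<^sup>2 = f \<bullet> ?ef"
    using adjoint_self_inner[OF is_adjoint_unit, of f]
    by (simp add: unit_left[OF algebra_mem[OF unit_mem]] inner_ell2_def del: blinfun_apply_blinfun_compose)
  also have "\<dots> \<le> norm f * norm ?ef" by (rule norm_cauchy_schwarz)
  finally have "norm ?ef * norm ?ef \<le> norm f * norm ?ef" by (simp add: power2_eq_square)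
  then show "norm ?ef \<le> 1 * norm f"
    by (cases "norm ?ef = 0") (auto simp: mult_le_cancel_right)
qed simp

abbreviation (input) points :: "('a operator \<Rightarrow> complex) set" where
  "points \<equiv> characters B"

lemma
  assumes "x \<in> points"
  shows char_extensional: "x \<in> extensional B"
    and char_add: "a \<in> B \<Longrightarrow> b \<in> B \<Longrightarrow> x (a + b) = x a + x b"
    and char_scaleC: "b \<in> B \<Longrightarrow> x (scaleC z b) = z * x b"
    and char_compose: "a \<in> B \<Longrightarrow> b \<in> B \<Longrightarrow> x (a o\<^sub>L b) = x a * x b"
    and char_nontrivial: "\<exists>b\<in>B. x b \<noteq> 0"
  using assms by (auto simp: characters_def)

lemma char_unit: "x \<in> points \<Longrightarrow> x e = 1"
  using char_nontrivial[of x] char_compose[of x _ e] unit_mem unit_right algebra_mem by fastforce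

lemma char_scaleR: "x \<in> points \<Longrightarrow> b \<in> B \<Longrightarrow> x (r *\<^sub>R b) = of_real r * x b"
  using char_scaleC[of x b "of_real r"] by (simp add: scaleC_of_real)

lemma char_diff:
  assumes "x \<in> points" "a \<in> B" "b \<in> B"
  shows "x (a - b) = x a - x b"
  using char_add[OF assms(1,2), of "(- 1) *\<^sub>R b"] char_scaleR[OF assms(1,3), of "- 1"] assms
  by (simp add: subspace_neg[OF B.subspace_algebra])

text \<open>If \<open>x b = 1\<close> with \<open>b\<close> of norm less than one, the sum \<open>s\<close> of the powers of \<open>b\<close>
  would satisfy \<open>s = b + b s\<close>, hence \<open>x s = 1 + x s\<close>.\<close>

lemma char_ne_1:
  assumes x: "x \<in> points" and b: "b \<in> B" and lt: "norm b < 1"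
  shows "x b \<noteq> 1"
proof
  assume 1: "x b = 1"
  \<comment> \<open>\<open>p n\<close> is the power of \<open>b\<close> with exponent n + 1. The
    series starts at \<open>b\<close> itself and its partial sums stay in \<open>B\<close>.\<close>
  define p where "p n = ((\<lambda>R. b o\<^sub>L R) ^^ n) b" for n
  have p_Suc: "p (Suc n) = b o\<^sub>L p n" for n by (simp add: p_def)
  have pB: "p n \<in> B" for n
    by (induction n) (use b B.compose_mem in \<open>auto simp: p_Suc\<close>, simp add: p_def)
  have "norm (p n) \<le> norm b ^ n * norm b" for n
  proof (induction n)
    case (Suc n)
    have "norm (p (Suc n)) \<le> norm b * norm (p n)" unfolding p_Suc by (rule norm_blinfun_compose)
    also have "\<dots> \<le> norm b * (norm b ^ n * norm b)" using Suc by (intro mult_left_mono) auto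
    finally show ?case by simp
  qed (simp add: p_def)
  moreover have "summable (\<lambda>n. norm b ^ n * norm b)"
    using lt by (intro summable_mult2 summable_geometric) simp
  ultimately have sum: "summable p" by (metis summable_comparison_test')
  define s where "s = suminf p"
  have "p sums s" using sum by (simp add: s_def summable_sums)
  then have lim: "(\<lambda>n. sum p {..<n}) \<longlonglongrightarrow> s" by (simp add: sums_def)
  have "sum p {..<n} \<in> B" for n
    using pB by (intro subspace_sum[OF B.subspace_algebra]) auto
  then have sB: "s \<in> B" by (rule closed_sequentially[OF B.closed_algebra _ lim])
  have "(\<lambda>n. p (Suc n)) sums (b o\<^sub>L s)"
    unfolding p_Suc using bounded_linear.sums[OF bounded_linear_compose_left \<open>p sums s\<close>] .
  then have "p sums ((b o\<^sub>L s) + p 0)" by (rule sums_Suc)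
  from sums_unique2[OF \<open>p sums s\<close> this] have "x s = x ((b o\<^sub>L s) + p 0)"
    by (rule arg_cong)
  also have "\<dots> = x (b o\<^sub>L s) + x b"
    using char_add[OF x B.compose_mem[OF b sB] b] by (simp add: p_def)
  finally show False using char_compose[OF x b sB] 1 by simp
qed

text \<open>If the bound failed, dividing \<open>b\<close> by \<open>x b\<close> would give an
  element of norm below one on which \<open>x\<close> takes the value 1.\<close>

lemma char_norm_le:
  assumes x: "x \<in> points" and b: "b \<in> B"
  shows "cmod (x b) \<le> norm b"
proof (rule ccontr)
  assume *: "\<not> cmod (x b) \<le> norm b"
  then have nz: "x b \<noteq> 0" using norm_ge_zero[of b] by auto
  have "norm (scaleC (inverse (x b)) b) \<le> norm b / cmod (x b)"
    using norm_scaleC_le[of "inverse (x b)" b] by (simp add: norm_inverse inverse_eq_divide norm_divide)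
  also have "\<dots> < 1" using * nz by (simp add: divide_simps)
  finally have "x (scaleC (inverse (x b)) b) \<noteq> 1"
    by (intro char_ne_1 x B.scaleC_mem b)
  then show False using char_scaleC[OF x b] nz by simp
qed

text \<open>Only the product is in \<open>B\<close>, so \<open>x\<close> cannot be split over its
  factors. Contractivity at the imaginary shifts of the product by multiples of \<open>e\<close>
  kills the imaginary part; at the squared norm of \<open>T\<close> times \<open>e\<close> minus the
  product it gives a nonnegative real part.\<close>

lemma char_star_compose_nonneg:
  assumes x: "x \<in> points" and T: "T \<in> A" and h: "star T o\<^sub>L T \<in> B"
  shows "0 \<le> x (star T o\<^sub>L T)"
proof -
  let ?h = "star T o\<^sub>L T"
  note adj = A.is_adjoint_star[OF T]
  note hA = algebra_mem[OF h]
  \<comment> \<open>The operator bounds were proved for shifts by \<open>id_blinfun\<close>, which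
    need not be in \<open>B\<close>. Multiplying by \<open>e\<close> turns them into shifts by
    \<open>e\<close> without increasing the norm.\<close>
  have shift: "norm (R o\<^sub>L e) \<le> norm R" for R
    using norm_blinfun_compose[of R e] mult_left_mono[OF norm_unit_le norm_ge_zero[of R]] by simp
  have "2 * Im (x ?h) * t \<le> (norm ?h)\<^sup>2" for t
  proof -
    let ?k = "?h + scaleC (\<i> * of_real t) e"
    have "id_blinfun o\<^sub>L e = e" by (rule blinfun_eqI) simp
    then have k: "?k = (?h + scaleC (\<i> * of_real t) id_blinfun) o\<^sub>L e"
      by (simp add: compose_add_right scaleC_compose_left unit_right[OF hA])
    have "x ?k = x ?h + \<i> * of_real t"
      by (simp add: char_add[OF x h] char_scaleC[OF x unit_mem] char_unit[OF x] B.scaleC_mem unit_mem)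
    moreover have "cmod (x ?k) \<le> norm ?k"
      by (intro char_norm_le[OF x] subspace_add[OF B.subspace_algebra] h B.scaleC_mem unit_mem)
    moreover have "norm ?k \<le> sqrt ((norm ?h)\<^sup>2 + t\<^sup>2)"
      unfolding k using norm_adjoint_self_imaginary_shift[OF adj, of t] shift order.trans by blast
    ultimately have "(cmod (x ?h + \<i> * of_real t))\<^sup>2 \<le> (sqrt ((norm ?h)\<^sup>2 + t\<^sup>2))\<^sup>2"
      by (intro power_mono) auto
    then have "(Re (x ?h))\<^sup>2 + (Im (x ?h) + t)\<^sup>2 \<le> (norm ?h)\<^sup>2 + t\<^sup>2"
      by (simp add: cmod_power2)
    then show ?thesis
      using zero_le_power2[of "Re (x ?h)"] zero_le_power2[of "Im (x ?h)"]
      unfolding power2_sum by linarith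
  qed
  \<comment> \<open>For this \<open>t\<close> the left side equals the right side plus 1, a
    contradiction unless the imaginary part vanishes.\<close>
  from this[of "((norm ?h)\<^sup>2 + 1) / (2 * Im (x ?h))"] have "Im (x ?h) = 0"
    by (cases "Im (x ?h) = 0") simp_all
  moreover have "0 \<le> Re (x ?h)"
  proof -
    let ?r = "(norm T)\<^sup>2"
    let ?k = "?r *\<^sub>R e - ?h"
    have "id_blinfun o\<^sub>L e = e" by (rule blinfun_eqI) simp
    then have k: "?k = (?r *\<^sub>R id_blinfun - ?h) o\<^sub>L e"
      by (simp add: bounded_bilinear.diff_left[OF bounded_bilinear_blinfun_compose]
        bounded_bilinear.scaleR_left[OF bounded_bilinear_blinfun_compose] unit_right[OF hA])
    have "x ?k = of_real ?r - x ?h"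
      by (simp add: char_diff[OF x] char_scaleR[OF x unit_mem] char_unit[OF x] h unit_mem
        subspace_scale[OF B.subspace_algebra])
    moreover have "cmod (x ?k) \<le> norm ?k"
      by (intro char_norm_le[OF x] subspace_diff[OF B.subspace_algebra] h
        subspace_scale[OF B.subspace_algebra] unit_mem)
    moreover have "norm ?k \<le> ?r"
      unfolding k using norm_adjoint_self_real_shift[OF adj] shift order.trans by blast
    ultimately have "cmod (of_real ?r - x ?h) \<le> ?r" by simp
    then show ?thesis using complex_Re_le_cmod[of "of_real ?r - x ?h"] by simp
  qed
  ultimately show ?thesis by (simp add: less_eq_complex_def)
qed

section \<open>The topology of the spectrum\<close>

lemma topspace_spectrum: "topspace (spectrum B) = points"
  using char_extensional by (auto simp: spectrum_def PiE_def Pi_def)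

lemma continuous_map_char: "b \<in> B \<Longrightarrow> continuous_map (spectrum B) euclidean (\<lambda>x. x b)"
  unfolding spectrum_def
  by (intro continuous_map_from_subtopology continuous_map_product_projection) auto

lemma openin_char_ne_0: "b \<in> B \<Longrightarrow> openin (spectrum B) {x \<in> points. x b \<noteq> 0}"
  using openin_continuous_map_preimage[OF continuous_map_char, of b "- {0}"]
  by (simp add: topspace_spectrum open_Compl)

lemma continuous_map_into_spectrum:
  assumes "\<And>b. b \<in> B \<Longrightarrow> continuous_map X euclidean (\<lambda>x. \<alpha> x b)"
    and "\<And>x. x \<in> topspace X \<Longrightarrow> \<alpha> x \<in> points"
  shows "continuous_map X (spectrum B) \<alpha>"
  unfolding spectrum_def continuous_map_in_subtopology continuous_map_componentwise
  using assms char_extensional by (auto simp: Pi_iff)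

section \<open>The partial homeomorphism of a normalizer\<close>

abbreviation (input) N :: "'a operator set" where
  "N \<equiv> normalizer A B"

lemma normalizer_in: "n \<in> N \<Longrightarrow> n \<in> A"
  by (simp add: normalizer_def)

lemma normalizer_conj: "n \<in> N \<Longrightarrow> b \<in> B \<Longrightarrow> star n o\<^sub>L b o\<^sub>L n \<in> B"
  and normalizer_conj': "n \<in> N \<Longrightarrow> b \<in> B \<Longrightarrow> n o\<^sub>L b o\<^sub>L star n \<in> B"
  by (simp_all add: normalizer_def)

lemma normalizer_star: "n \<in> N \<Longrightarrow> star n \<in> N"
  by (auto simp: normalizer_def A.star_mem A.star_star)

lemma normalizer_compose:
  assumes n: "n \<in> N" and m: "m \<in> N"
  shows "n o\<^sub>L m \<in> N"
proof -
  have "star (n o\<^sub>L m) = star m o\<^sub>L star n"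
    by (intro A.star_compose normalizer_in n m)
  moreover have "star m o\<^sub>L (star n o\<^sub>L b o\<^sub>L n) o\<^sub>L m \<in> B"
    "n o\<^sub>L (m o\<^sub>L b o\<^sub>L star m) o\<^sub>L star n \<in> B" if "b \<in> B" for b
    by (rule normalizer_conj[OF m normalizer_conj[OF n that]])
      (rule normalizer_conj'[OF n normalizer_conj'[OF m that]])
  ultimately show ?thesis
    using A.compose_mem[OF normalizer_in[OF n] normalizer_in[OF m]]
    by (simp add: normalizer_def blinfun_compose_assoc)
qed

lemma normalizer_star_self: "n \<in> N \<Longrightarrow> star n o\<^sub>L n \<in> B"
  and normalizer_self_star: "n \<in> N \<Longrightarrow> n o\<^sub>L star n \<in> B"
  using normalizer_conj[of n e] normalizer_conj'[of n e] unit_mem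
  by (simp_all add: unit_right A.star_mem normalizer_in)

text \<open>Positivity of characters replaces the order condition by nonvanishing, which is visibly
  open and respects products.\<close>

lemma weyl_dom_iff:
  assumes n: "n \<in> N"
  shows "x \<in> weyl_dom B n \<longleftrightarrow> x \<in> points \<and> x (star n o\<^sub>L n) \<noteq> 0"
proof -
  have "0 \<le> x (star n o\<^sub>L n)" if "x \<in> points"
    by (rule char_star_compose_nonneg[OF that normalizer_in[OF n] normalizer_star_self[OF n]])
  then show ?thesis
    by (auto simp: weyl_dom_def topspace_spectrum order.order_iff_strict)
qed

lemma weyl_dom_points: "x \<in> weyl_dom B n \<Longrightarrow> x \<in> points"
  by (simp add: weyl_dom_def topspace_spectrum)

lemma openin_weyl_dom:
  assumes n: "n \<in> N"
  shows "openin (spectrum B) (weyl_dom B n)"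
proof -
  have "weyl_dom B n = {x \<in> points. x (star n o\<^sub>L n) \<noteq> 0}"
    using weyl_dom_iff[OF n] by auto
  then show ?thesis using openin_char_ne_0[OF normalizer_star_self[OF n]] by simp
qed

text \<open>The formula forced by the defining equation of the partial homeomorphism. It is studied
  first because \<open>weyl_map\<close> is a definite description; \<open>weyl_map_eq\<close> then
  identifies the two.\<close>

definition weyl_point :: "'a operator \<Rightarrow> ('a operator \<Rightarrow> complex) \<Rightarrow> 'a operator \<Rightarrow> complex" where
  "weyl_point n x = (\<lambda>b\<in>B. x (star n o\<^sub>L b o\<^sub>L n) / x (star n o\<^sub>L n))"

context
  fixes n x
  assumes n: "n \<in> N" and x: "x \<in> weyl_dom B n"
begin

lemma weyl_point_apply: "b \<in> B \<Longrightarrow> weyl_point n x b = x (star n o\<^sub>L b o\<^sub>L n) / x (star n o\<^sub>L n)"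
  by (simp add: weyl_point_def)

lemma weyl_point_char: "weyl_point n x \<in> points"
proof -
  have xp: "x \<in> points" and nz: "x (star n o\<^sub>L n) \<noteq> 0"
    using x n by (simp_all add: weyl_dom_iff)
  note conj = normalizer_conj[OF n]
  have mult: "x (star n o\<^sub>L (a o\<^sub>L b) o\<^sub>L n) * x (star n o\<^sub>L n)
      = x (star n o\<^sub>L a o\<^sub>L n) * x (star n o\<^sub>L b o\<^sub>L n)" if "a \<in> B" "b \<in> B" for a b
  proof -
    have "(star n o\<^sub>L a o\<^sub>L n) o\<^sub>L (star n o\<^sub>L b o\<^sub>L n) = star n o\<^sub>L a o\<^sub>L ((n o\<^sub>L star n) o\<^sub>L b) o\<^sub>L n"
      by (simp add: blinfun_compose_assoc)
    also have "\<dots> = (star n o\<^sub>L (a o\<^sub>L b) o\<^sub>L n) o\<^sub>L (star n o\<^sub>L n)"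
      unfolding commute[OF normalizer_self_star[OF n] that(2)] by (simp add: blinfun_compose_assoc)
    finally show ?thesis
      using that n by (metis char_compose[OF xp] conj B.compose_mem normalizer_star_self)
  qed
  show ?thesis
    unfolding characters_def
  proof (intro CollectI conjI ballI allI)
    fix a b assume ab: "a \<in> B" "b \<in> B"
    show "weyl_point n x (a + b) = weyl_point n x a + weyl_point n x b"
      using ab by (simp add: weyl_point_apply subspace_add[OF B.subspace_algebra] compose_add_left
        compose_add_right char_add[OF xp] conj add_divide_distrib)
    show "weyl_point n x (a o\<^sub>L b) = weyl_point n x a * weyl_point n x b"
      using ab mult[OF ab] nz by (simp add: weyl_point_apply B.compose_mem divide_simps)
  next
    fix z b assume b: "b \<in> B"
    show "weyl_point n x (scaleC z b) = z * weyl_point n x b"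
      using b by (simp add: weyl_point_apply B.scaleC_mem scaleC_compose_left char_scaleC[OF xp] conj
        A.compose_scaleC_right[OF A.star_mem[OF normalizer_in[OF n]]])
  next
    show "weyl_point n x \<in> extensional B" by (simp add: weyl_point_def)
    have "weyl_point n x e \<noteq> 0"
      using nz by (simp add: weyl_point_apply unit_mem unit_right A.star_mem normalizer_in n)
    then show "\<exists>b\<in>B. weyl_point n x b \<noteq> 0" using unit_mem by blast
  qed
qed

lemma weyl_point_dom: "weyl_point n x \<in> weyl_dom B (star n)"
proof -
  have "star n o\<^sub>L (n o\<^sub>L star n) o\<^sub>L n = (star n o\<^sub>L n) o\<^sub>L (star n o\<^sub>L n)"
    by (simp add: blinfun_compose_assoc)
  then have "weyl_point n x (n o\<^sub>L star n) = x (star n o\<^sub>L n)"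
    using x n by (simp add: weyl_point_apply normalizer_self_star weyl_dom_iff char_compose normalizer_star_self)
  then show ?thesis
    using weyl_point_char x n
    by (simp add: weyl_dom_iff[OF normalizer_star] A.star_star normalizer_in) (simp add: weyl_dom_iff)
qed

text \<open>Conjugating \<open>b\<close> by \<open>n\<close> and back gives \<open>b\<close> between
  two copies of \<open>star n o\<^sub>L n\<close>. All three factors are in \<open>B\<close>, so
  \<open>x\<close> splits and the nonzero values cancel.\<close>

lemma weyl_point_star: "weyl_point (star n) (weyl_point n x) = x"
proof
  fix b
  have xp: "x \<in> points" and nz: "x (star n o\<^sub>L n) \<noteq> 0"
    using x n by (simp_all add: weyl_dom_iff)
  have B: "star n o\<^sub>L n \<in> B" by (rule normalizer_star_self[OF n])
  have ss: "star (star n) = n" by (simp add: A.star_star normalizer_in n)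
  show "weyl_point (star n) (weyl_point n x) b = x b"
  proof (cases "b \<in> B")
    case True
    have "star n o\<^sub>L (n o\<^sub>L b o\<^sub>L star n) o\<^sub>L n = (star n o\<^sub>L n) o\<^sub>L b o\<^sub>L (star n o\<^sub>L n)"
      "star n o\<^sub>L (n o\<^sub>L star n) o\<^sub>L n = (star n o\<^sub>L n) o\<^sub>L (star n o\<^sub>L n)"
      by (simp_all add: blinfun_compose_assoc)
    then have "x (star n o\<^sub>L (n o\<^sub>L b o\<^sub>L star n) o\<^sub>L n) = x (star n o\<^sub>L n) * x b * x (star n o\<^sub>L n)"
      "x (star n o\<^sub>L (n o\<^sub>L star n) o\<^sub>L n) = x (star n o\<^sub>L n) * x (star n o\<^sub>L n)"
      using True by (simp_all add: char_compose[OF xp] B B.compose_mem)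
    then show ?thesis
      using True nz
      by (simp add: weyl_point_def ss normalizer_conj'[OF n] normalizer_self_star[OF n])
  next
    case False
    then show ?thesis
      using char_extensional[OF xp] by (simp add: weyl_point_def extensional_def)
  qed
qed

end

lemma continuous_map_weyl_point:
  assumes n: "n \<in> N"
  shows "continuous_map (subtopology (spectrum B) (weyl_dom B n))
    (subtopology (spectrum B) (weyl_dom B (star n))) (weyl_point n)"
  unfolding continuous_map_in_subtopology
proof
  show "weyl_point n \<in> topspace (subtopology (spectrum B) (weyl_dom B n)) \<rightarrow> weyl_dom B (star n)"
    using weyl_point_dom[OF n] by auto
  show "continuous_map (subtopology (spectrum B) (weyl_dom B n)) (spectrum B) (weyl_point n)"
  proof (rule continuous_map_into_spectrum)
    fix b assume b: "b \<in> B"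
    let ?X = "subtopology (spectrum B) (weyl_dom B n)"
    \<comment> \<open>Division is continuous only where the denominator is nonzero, so numerator and
      denominator are mapped into that subspace before dividing.\<close>
    have pair: "continuous_map ?X (subtopology euclidean {p. snd p \<noteq> 0})
        (\<lambda>x. (x (star n o\<^sub>L b o\<^sub>L n), x (star n o\<^sub>L n)))"
      unfolding continuous_map_in_subtopology prod_topology_euclidean[symmetric]
      using n b by (auto intro!: continuous_map_pairedI continuous_map_from_subtopology
        continuous_map_char normalizer_conj normalizer_star_self simp: weyl_dom_iff
        simp del: prod_topology_euclidean)
    have div: "continuous_map (subtopology euclidean {p. snd p \<noteq> 0}) euclidean
        (\<lambda>p :: complex \<times> complex. fst p / snd p)"
      by (auto intro!: continuous_intros)
    show "continuous_map ?X euclidean (\<lambda>x. weyl_point n x b)"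
      using continuous_map_compose[OF pair div] b by (simp add: weyl_point_def o_def)
  next
    show "weyl_point n x \<in> points" if "x \<in> topspace (subtopology (spectrum B) (weyl_dom B n))" for x
      using weyl_point_char[OF n] that by auto
  qed
qed

lemma homeomorphic_map_weyl_point:
  assumes n: "n \<in> N"
  shows "homeomorphic_map (subtopology (spectrum B) (weyl_dom B n))
    (subtopology (spectrum B) (weyl_dom B (star n))) (restrict (weyl_point n) (weyl_dom B n))"
proof -
  have ss: "star (star n) = n" by (simp add: A.star_star normalizer_in n)
  let ?X = "subtopology (spectrum B) (weyl_dom B n)"
    and ?Y = "subtopology (spectrum B) (weyl_dom B (star n))"
  have "homeomorphic_maps ?X ?Y (weyl_point n) (weyl_point (star n))"
    using continuous_map_weyl_point[OF n] continuous_map_weyl_point[OF normalizer_star[OF n]]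
      weyl_point_star[OF n] weyl_point_star[OF normalizer_star[OF n]]
    by (simp add: homeomorphic_maps_def ss)
  then have "homeomorphic_map ?X ?Y (weyl_point n)" by (simp add: homeomorphic_maps_map)
  then show ?thesis
    by (rule homeomorphic_map_eq) simp
qed

lemma weyl_map_eq:
  assumes n: "n \<in> N"
  shows "weyl_map B n = restrict (weyl_point n) (weyl_dom B n)"
  unfolding weyl_map_def
proof (rule the_equality)
  show "restrict (weyl_point n) (weyl_dom B n) \<in> extensional (weyl_dom B n) \<and>
     homeomorphic_map (subtopology (spectrum B) (weyl_dom B n))
       (subtopology (spectrum B) (weyl_dom B (star n))) (restrict (weyl_point n) (weyl_dom B n)) \<and>
     (\<forall>b\<in>B. \<forall>x\<in>weyl_dom B n. x (star n o\<^sub>L b o\<^sub>L n)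
       = restrict (weyl_point n) (weyl_dom B n) x b * x (star n o\<^sub>L n))"
    using homeomorphic_map_weyl_point[OF n] weyl_dom_iff[OF n] by (simp add: weyl_point_def)
next
  fix \<alpha>
  assume \<alpha>: "\<alpha> \<in> extensional (weyl_dom B n) \<and>
     homeomorphic_map (subtopology (spectrum B) (weyl_dom B n))
       (subtopology (spectrum B) (weyl_dom B (star n))) \<alpha> \<and>
     (\<forall>b\<in>B. \<forall>x\<in>weyl_dom B n. x (star n o\<^sub>L b o\<^sub>L n) = \<alpha> x b * x (star n o\<^sub>L n))"
  show "\<alpha> = restrict (weyl_point n) (weyl_dom B n)"
  proof (rule extensionalityI)
    fix x assume x: "x \<in> weyl_dom B n"
    \<comment> \<open>The equation controls \<open>\<alpha> x\<close> on \<open>B\<close> only. The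
      range of the homeomorphism shows that it is a character, hence extensional on
      \<open>B\<close>, and so is determined completely.\<close>
    have "\<alpha> ` topspace (subtopology (spectrum B) (weyl_dom B n))
        = topspace (subtopology (spectrum B) (weyl_dom B (star n)))"
      using \<alpha> homeomorphic_imp_surjective_map by blast
    then have "\<alpha> x \<in> points"
      using x weyl_dom_points by (fastforce simp: topspace_spectrum)
    then have "\<alpha> x \<in> extensional B" by (rule char_extensional)
    moreover have "x (star n o\<^sub>L b o\<^sub>L n) = \<alpha> x b * x (star n o\<^sub>L n)" if "b \<in> B" for b
      using \<alpha> x that by blast
    ultimately have "\<alpha> x = weyl_point n x"
      using x weyl_dom_iff[OF n] by (intro extensionalityI[of _ B]) (simp_all add: weyl_point_def)
    then show "\<alpha> x = restrict (weyl_point n) (weyl_dom B n) x" using x by simp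
  qed (use \<alpha> in auto)
qed

context
  fixes n x
  assumes n: "n \<in> N" and x: "x \<in> weyl_dom B n"
begin

lemma weyl_map_apply: "b \<in> B \<Longrightarrow> weyl_map B n x b = x (star n o\<^sub>L b o\<^sub>L n) / x (star n o\<^sub>L n)"
  using n x by (simp add: weyl_map_eq weyl_point_def)

lemma weyl_map_dom: "weyl_map B n x \<in> weyl_dom B (star n)"
  using n x by (simp add: weyl_map_eq weyl_point_dom)

lemma weyl_map_point: "weyl_map B n x \<in> points"
  using weyl_map_dom by (rule weyl_dom_points)

lemma weyl_map_star: "weyl_map B (star n) (weyl_map B n x) = x"
  using weyl_map_dom n x by (simp add: weyl_map_eq normalizer_star weyl_point_star)

end

lemma weyl_map_eqI:
  assumes "n \<in> N" "x \<in> weyl_dom B n" "y \<in> points"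
    and "\<And>b. b \<in> B \<Longrightarrow> x (star n o\<^sub>L b o\<^sub>L n) = y b * x (star n o\<^sub>L n)"
  shows "weyl_map B n x = y"
proof (rule extensionalityI[where A = B])
  show "weyl_map B n x b = y b" if "b \<in> B" for b
    using assms that weyl_dom_iff[of n x] by (simp add: weyl_map_apply)
qed (use assms weyl_map_point char_extensional in auto)

lemma
  assumes n: "n \<in> N" and m: "m \<in> N" and x: "x \<in> weyl_dom B m" and y: "weyl_map B m x \<in> weyl_dom B n"
  shows weyl_dom_compose: "x \<in> weyl_dom B (n o\<^sub>L m)"
    and weyl_map_compose: "weyl_map B (n o\<^sub>L m) x = weyl_map B n (weyl_map B m x)"
proof -
  let ?y = "weyl_map B m x"
  have st: "star (n o\<^sub>L m) = star m o\<^sub>L star n"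
    by (intro A.star_compose normalizer_in n m)
  have nz: "x (star m o\<^sub>L m) \<noteq> 0" "?y (star n o\<^sub>L n) \<noteq> 0"
    using weyl_dom_iff n m x y by auto
  have eq: "x (star (n o\<^sub>L m) o\<^sub>L b o\<^sub>L (n o\<^sub>L m)) = ?y (star n o\<^sub>L b o\<^sub>L n) * x (star m o\<^sub>L m)"
    if "b \<in> B" for b
  proof -
    have "star (n o\<^sub>L m) o\<^sub>L b o\<^sub>L (n o\<^sub>L m) = star m o\<^sub>L (star n o\<^sub>L b o\<^sub>L n) o\<^sub>L m"
      by (simp add: st blinfun_compose_assoc)
    then show ?thesis
      using weyl_map_apply[OF m x normalizer_conj[OF n that]] nz by simp
  qed
  \<comment> \<open>The case where \<open>b\<close> is the unit: the value at the product is a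
    product of two nonzero values, which gives membership in the domain and the denominator
    below.\<close>
  have eq1: "x (star (n o\<^sub>L m) o\<^sub>L (n o\<^sub>L m)) = ?y (star n o\<^sub>L n) * x (star m o\<^sub>L m)"
    using eq[OF unit_mem] n m
    by (simp add: unit_right A.star_mem normalizer_in A.compose_mem)
  show dom: "x \<in> weyl_dom B (n o\<^sub>L m)"
    using eq1 nz weyl_dom_points[OF x] by (simp add: weyl_dom_iff[OF normalizer_compose[OF n m]])
  show "weyl_map B (n o\<^sub>L m) x = weyl_map B n ?y"
  proof (rule weyl_map_eqI[OF normalizer_compose[OF n m] dom weyl_map_point[OF n y]])
    fix b assume b: "b \<in> B"
    show "x (star (n o\<^sub>L m) o\<^sub>L b o\<^sub>L (n o\<^sub>L m)) = weyl_map B n ?y b * x (star (n o\<^sub>L m) o\<^sub>L (n o\<^sub>L m))"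
      unfolding eq[OF b] eq1 weyl_map_apply[OF n y b] using nz by simp
  qed
qed

lemma openin_weyl_preimage:
  assumes n: "n \<in> N" and V: "openin (spectrum B) V"
  shows "openin (spectrum B) {x \<in> weyl_dom B n. weyl_map B n x \<in> V}"
proof -
  let ?D = "weyl_dom B n"
  have "continuous_map (subtopology (spectrum B) ?D) (spectrum B) (weyl_point n)"
    using continuous_map_weyl_point[OF n] by (simp add: continuous_map_in_subtopology)
  then have "openin (subtopology (spectrum B) ?D) {x \<in> topspace (subtopology (spectrum B) ?D). weyl_point n x \<in> V}"
    using V by (rule openin_continuous_map_preimage)
  then have "openin (spectrum B) {x \<in> topspace (subtopology (spectrum B) ?D). weyl_point n x \<in> V}"
    using openin_weyl_dom[OF n] by (simp add: openin_open_subtopology)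
  also have "{x \<in> topspace (subtopology (spectrum B) ?D). weyl_point n x \<in> V}
      = {x \<in> ?D. weyl_map B n x \<in> V}"
    using weyl_dom_points by (auto simp: weyl_map_eq[OF n] topspace_spectrum)
  finally show ?thesis .
qed

text \<open>A scalar of modulus one cancels against its conjugate in both conjugations. This absorbs
  the cocycle values produced by products and adjoints of the \<open>delta G c g\<close>.\<close>

lemma
  assumes n: "n \<in> N" and u: "cmod u = 1"
  shows normalizer_scaleC: "scaleC u n \<in> N"
    and weyl_dom_scaleC: "weyl_dom B (scaleC u n) = weyl_dom B n"
    and weyl_map_scaleC: "weyl_map B (scaleC u n) = weyl_map B n"
proof -
  have uu: "u * cnj u = 1" "cnj u * u = 1" using u by (simp_all add: complex_norm_square[symmetric] mult.commute)
  have st: "star (scaleC u n) = scaleC (cnj u) (star n)"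
    by (intro star_eqI is_adjoint_scaleC A.is_adjoint_star normalizer_in n)
  have 1: "star (scaleC u n) o\<^sub>L R o\<^sub>L scaleC u n = star n o\<^sub>L R o\<^sub>L n" if "R \<in> A" for R
    unfolding st scaleC_compose_left
    by (subst A.compose_scaleC_right[OF A.compose_mem[OF A.star_mem[OF normalizer_in[OF n]] that]])
      (simp add: scaleC_scaleC uu)
  have 2: "scaleC u n o\<^sub>L R o\<^sub>L star (scaleC u n) = n o\<^sub>L R o\<^sub>L star n" if "R \<in> A" for R
    unfolding st scaleC_compose_left
    by (subst A.compose_scaleC_right[OF A.compose_mem[OF normalizer_in[OF n] that]])
      (simp add: scaleC_scaleC uu)
  have 3: "star (scaleC u n) o\<^sub>L scaleC u n = star n o\<^sub>L n"
    unfolding st scaleC_compose_left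
    by (subst A.compose_scaleC_right[OF A.star_mem[OF normalizer_in[OF n]]])
      (simp add: scaleC_scaleC uu)
  show N: "scaleC u n \<in> N"
    using n 1 2 algebra_mem by (auto simp: normalizer_def A.scaleC_mem)
  show dom: "weyl_dom B (scaleC u n) = weyl_dom B n"
    by (simp add: weyl_dom_def 3)
  have "weyl_point (scaleC u n) = weyl_point n"
    unfolding weyl_point_def using 1 3 algebra_mem by (intro ext restrict_ext) simp
  then show "weyl_map B (scaleC u n) = weyl_map B n"
    by (simp add: weyl_map_eq n N dom)
qed

section \<open>Germs\<close>

text \<open>The local condition inside \<open>weyl_rel\<close>, freed from the triples; the
  equivalence of germs is argued on this form.\<close>

definition germ_eq :: "'a operator \<Rightarrow> 'a operator \<Rightarrow> ('a operator \<Rightarrow> complex) \<Rightarrow> bool" where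
  "germ_eq n m x \<longleftrightarrow> (\<exists>U. openin (spectrum B) U \<and> x \<in> U \<and> U \<subseteq> weyl_dom B n \<inter> weyl_dom B m \<and>
     (\<forall>u\<in>U. weyl_map B n u = weyl_map B m u))"

lemma germ_eq_dom:
  assumes "germ_eq n m x"
  shows "x \<in> weyl_dom B n" "x \<in> weyl_dom B m" "weyl_map B n x = weyl_map B m x"
  using assms unfolding germ_eq_def by auto

lemma germ_eq_refl: "n \<in> N \<Longrightarrow> x \<in> weyl_dom B n \<Longrightarrow> germ_eq n n x"
  unfolding germ_eq_def using openin_weyl_dom by blast

lemma germ_eq_sym: "germ_eq n m x \<Longrightarrow> germ_eq m n x"
  unfolding germ_eq_def by (metis inf_commute)

lemma germ_eq_trans:
  assumes "germ_eq n m x" "germ_eq m k x"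
  shows "germ_eq n k x"
proof -
  obtain U where U: "openin (spectrum B) U" "x \<in> U" "U \<subseteq> weyl_dom B n" "U \<subseteq> weyl_dom B m"
    "\<And>u. u \<in> U \<Longrightarrow> weyl_map B n u = weyl_map B m u" using assms(1) unfolding germ_eq_def by blast
  obtain V where V: "openin (spectrum B) V" "x \<in> V" "V \<subseteq> weyl_dom B m" "V \<subseteq> weyl_dom B k"
    "\<And>u. u \<in> V \<Longrightarrow> weyl_map B m u = weyl_map B k u" using assms(2) unfolding germ_eq_def by blast
  show ?thesis unfolding germ_eq_def
    by (rule exI[of _ "U \<inter> V"]) (use U V in auto)
qed

lemma germ_eq_compose:
  assumes N: "n \<in> N" "n' \<in> N" "m \<in> N" "m' \<in> N"
    and nn: "germ_eq n n' (weyl_map B m x)" and mm: "germ_eq m m' x"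
  shows "germ_eq (n o\<^sub>L m) (n' o\<^sub>L m') x"
proof -
  obtain U where U: "openin (spectrum B) U" "weyl_map B m x \<in> U" "U \<subseteq> weyl_dom B n" "U \<subseteq> weyl_dom B n'"
    "\<And>u. u \<in> U \<Longrightarrow> weyl_map B n u = weyl_map B n' u" using nn unfolding germ_eq_def by blast
  obtain V where V: "openin (spectrum B) V" "x \<in> V" "V \<subseteq> weyl_dom B m" "V \<subseteq> weyl_dom B m'"
    "\<And>u. u \<in> V \<Longrightarrow> weyl_map B m u = weyl_map B m' u" using mm unfolding germ_eq_def by blast
  \<comment> \<open>The neighbourhood of agreement for the right factors is shrunk so that its image
    stays where the left factors agree.\<close>
  let ?W = "V \<inter> {u \<in> weyl_dom B m. weyl_map B m u \<in> U}"
  have "openin (spectrum B) ?W" by (intro openin_Int V(1) openin_weyl_preimage N U(1))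
  moreover have "u \<in> weyl_dom B (n o\<^sub>L m) \<and> u \<in> weyl_dom B (n' o\<^sub>L m') \<and>
      weyl_map B (n o\<^sub>L m) u = weyl_map B (n' o\<^sub>L m') u" if "u \<in> ?W" for u
  proof -
    have uV: "u \<in> V" and uU: "weyl_map B m u \<in> U" using that by auto
    note mm' = V(5)[OF uV]
    have u: "u \<in> weyl_dom B m" "weyl_map B m u \<in> weyl_dom B n"
      using uV uU U(3) V(3) by blast+
    have u': "u \<in> weyl_dom B m'" "weyl_map B m' u \<in> weyl_dom B n'"
      using uV uU U(4) V(4) unfolding mm' by blast+
    show ?thesis
      using U(5)[OF uU] mm'  weyl_dom_compose[OF N(1,3) u] weyl_dom_compose[OF N(2,4) u']
        weyl_map_compose[OF N(1,3) u] weyl_map_compose[OF N(2,4) u'] by simp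
  qed
  moreover have "x \<in> ?W" using U V by auto
  ultimately show ?thesis unfolding germ_eq_def by (intro exI[of _ ?W]) blast
qed

lemma germ_eq_star:
  assumes N: "n \<in> N" "m \<in> N" and g: "germ_eq n m x"
  shows "germ_eq (star n) (star m) (weyl_map B n x)"
proof -
  obtain U where U: "openin (spectrum B) U" "x \<in> U" "U \<subseteq> weyl_dom B n" "U \<subseteq> weyl_dom B m"
    "\<And>u. u \<in> U \<Longrightarrow> weyl_map B n u = weyl_map B m u" using g unfolding germ_eq_def by blast
  \<comment> \<open>This is the image of \<open>U\<close> under the map of \<open>n\<close>, written
    as a preimage under its inverse so that openness is immediate.\<close>
  let ?W = "{v \<in> weyl_dom B (star n). weyl_map B (star n) v \<in> U}"
  have ss: "star (star n) = n" by (simp add: A.star_star normalizer_in N)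
  have "openin (spectrum B) ?W" using U openin_weyl_preimage normalizer_star N by blast
  moreover have "weyl_map B n x \<in> ?W"
    using U(2,3) weyl_map_dom[OF N(1)] weyl_map_star[OF N(1)] by auto
  moreover have "v \<in> weyl_dom B (star m) \<and> weyl_map B (star n) v = weyl_map B (star m) v"
    if "v \<in> ?W" for v
  proof -
    let ?u = "weyl_map B (star n) v"
    have v: "v = weyl_map B n ?u"
      using weyl_map_star[OF normalizer_star[OF N(1)], of v] that by (simp add: ss)
    have u: "?u \<in> weyl_dom B m" "weyl_map B n ?u = weyl_map B m ?u" using that U by auto
    show ?thesis
      using weyl_map_dom[OF N(2) u(1)] weyl_map_star[OF N(2) u(1)] u v by simp
  qed
  ultimately show ?thesis unfolding germ_eq_def by (intro exI[of _ ?W]) blast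
qed

text \<open>A neighbourhood witnessing equality of germs at one point witnesses it at each of its
  points. Continuity of the coset map rests on this.\<close>

lemma openin_germ_eq: "openin (spectrum B) {x. germ_eq n m x}"
proof (subst openin_subopen, intro ballI)
  fix x assume "x \<in> {x. germ_eq n m x}"
  then obtain U where "openin (spectrum B) U" "x \<in> U" "U \<subseteq> weyl_dom B n \<inter> weyl_dom B m"
    "\<forall>u\<in>U. weyl_map B n u = weyl_map B m u" unfolding germ_eq_def by blast
  then show "\<exists>T. openin (spectrum B) T \<and> x \<in> T \<and> T \<subseteq> {x. germ_eq n m x}"
    unfolding germ_eq_def by blast
qed

section \<open>Germ classes: topology and operations of the Weyl groupoid\<close>

lemma weyl_class_eq_Collect:
  assumes "n \<in> N" "x \<in> weyl_dom B n"
  shows "weyl_class A B n x = {(weyl_map B m x, m, x) | m. m \<in> N \<and> germ_eq n m x}"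
  using assms unfolding weyl_class_def weyl_rel_def weyl_triples_def germ_eq_def by auto

lemma weyl_class_eq_iff:
  assumes N: "n \<in> N" "x \<in> weyl_dom B n" "m \<in> N" "y \<in> weyl_dom B m"
  shows "weyl_class A B n x = weyl_class A B m y \<longleftrightarrow> x = y \<and> germ_eq n m x"
proof
  assume eq: "weyl_class A B n x = weyl_class A B m y"
  have "(weyl_map B m y, m, y) \<in> weyl_class A B m y"
    unfolding weyl_class_eq_Collect[OF N(3,4)] using germ_eq_refl[OF N(3,4)] N(3) by auto
  then show "x = y \<and> germ_eq n m x"
    unfolding eq[symmetric] weyl_class_eq_Collect[OF N(1,2)] by auto
next
  assume xy: "x = y \<and> germ_eq n m x"
  then have "germ_eq n k x \<longleftrightarrow> germ_eq m k x" for k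
    by (metis germ_eq_trans germ_eq_sym)
  then show "weyl_class A B n x = weyl_class A B m y"
    using xy weyl_class_eq_Collect[OF N(1,2)] weyl_class_eq_Collect[OF N(3,4)] by auto
qed

lemma weyl_class_eqI: "n \<in> N \<Longrightarrow> m \<in> N \<Longrightarrow> germ_eq n m x \<Longrightarrow> weyl_class A B n x = weyl_class A B m x"
  using germ_eq_dom by (subst weyl_class_eq_iff) auto

lemma weyl_class_scaleC:
  assumes n: "n \<in> N" and u: "cmod u = 1" and x: "x \<in> weyl_dom B n"
  shows "weyl_class A B (scaleC u n) x = weyl_class A B n x"
proof (rule weyl_class_eqI[OF normalizer_scaleC[OF n u] n])
  show "germ_eq (scaleC u n) n x"
    unfolding germ_eq_def weyl_dom_scaleC[OF n u] weyl_map_scaleC[OF n u]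
    using x openin_weyl_dom[OF n] by blast
qed

lemma quotient_weyl_rel:
  "weyl_triples A B // weyl_rel A B = {weyl_class A B n x | n x. n \<in> N \<and> x \<in> weyl_dom B n}"
  unfolding quotient_def weyl_class_def weyl_triples_def by auto

definition weyl_basic where
  "weyl_basic n U V = {weyl_class A B n x | x. x \<in> weyl_dom B n \<and> weyl_map B n x \<in> V \<and> x \<in> U}"

lemma weyl_topology_eq:
  "weyl_topology A B = topology_generated_by
     {weyl_basic n U V | n U V. n \<in> N \<and> openin (spectrum B) U \<and> openin (spectrum B) V}"
  unfolding weyl_topology_def weyl_basic_def ..

text \<open>Taking the whole spectrum as \<open>V\<close> removes the range condition; these basic
  sets suffice for openness of the coset map.\<close>

lemma weyl_basic_topspace:
  assumes n: "n \<in> N"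
  shows "weyl_basic n U (topspace (spectrum B)) = weyl_class A B n ` (weyl_dom B n \<inter> U)"
  using weyl_map_point[OF n] unfolding weyl_basic_def topspace_spectrum by blast

lemma topspace_weyl_topology:
  "topspace (weyl_topology A B) = {weyl_class A B n x | n x. n \<in> N \<and> x \<in> weyl_dom B n}"
proof (intro subset_antisym subsetI)
  fix P assume "P \<in> topspace (weyl_topology A B)"
  then obtain n U V where "n \<in> N" "P \<in> weyl_basic n U V"
    unfolding weyl_topology_eq topology_generated_by_topspace by blast
  then show "P \<in> {weyl_class A B n x | n x. n \<in> N \<and> x \<in> weyl_dom B n}"
    unfolding weyl_basic_def by blast
next
  fix P assume "P \<in> {weyl_class A B n x | n x. n \<in> N \<and> x \<in> weyl_dom B n}"
  then obtain n x where n: "n \<in> N" and x: "x \<in> weyl_dom B n" and P: "P = weyl_class A B n x" by blast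
  let ?T = "topspace (spectrum B)"
  have "x \<in> ?T" using x weyl_dom_points by (simp add: topspace_spectrum)
  then have "P \<in> weyl_basic n ?T ?T"
    unfolding P weyl_basic_topspace[OF n] using x by blast
  then show "P \<in> topspace (weyl_topology A B)"
    unfolding weyl_topology_eq topology_generated_by_topspace using n openin_topspace by blast
qed

text \<open>The product is a union over all representatives. Each contributes the same class by
  \<open>germ_eq_compose\<close>, and since the two classes are nonempty the union is that
  class.\<close>

lemma gcomp_weyl_groupoid:
  assumes N: "n \<in> N" "m \<in> N" and x: "x \<in> weyl_dom B m" and y: "weyl_map B m x \<in> weyl_dom B n"
  shows "gcomp (weyl_groupoid A B) (weyl_class A B n (weyl_map B m x)) (weyl_class A B m x)
    = weyl_class A B (n o\<^sub>L m) x"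
proof -
  let ?P = "weyl_class A B n (weyl_map B m x)" and ?Q = "weyl_class A B m x"
  have eq: "weyl_class A B (n' o\<^sub>L m') x' = weyl_class A B (n o\<^sub>L m) x"
    if "(z, n', y') \<in> ?P" "(y'', m', x') \<in> ?Q" for z n' y' y'' m' x'
  proof -
    have *: "n' \<in> N" "germ_eq n n' (weyl_map B m x)" "m' \<in> N" "germ_eq m m' x" "x' = x"
      using that x y by (auto simp: weyl_class_eq_Collect N)
    then have "germ_eq (n' o\<^sub>L m') (n o\<^sub>L m) x"
      by (intro germ_eq_sym[OF germ_eq_compose] N)
    then show ?thesis using * N by (simp add: weyl_class_eqI normalizer_compose)
  qed
  have "?P \<noteq> {}" "?Q \<noteq> {}"
    using N x y germ_eq_refl by (auto simp: weyl_class_eq_Collect)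
  then show ?thesis
    unfolding weyl_groupoid_def groupoid.simps using eq by (intro subset_antisym UN_least) (auto, blast)
qed

lemma ginv_weyl_groupoid:
  assumes n: "n \<in> N" and x: "x \<in> weyl_dom B n"
  shows "ginv (weyl_groupoid A B) (weyl_class A B n x) = weyl_class A B (star n) (weyl_map B n x)"
proof -
  let ?P = "weyl_class A B n x"
  have eq: "weyl_class A B (star n') y = weyl_class A B (star n) (weyl_map B n x)"
    if "(y, n', x') \<in> ?P" for y n' x'
  proof -
    have *: "n' \<in> N" "germ_eq n n' x" "y = weyl_map B n x"
      using that x germ_eq_dom(3) by (auto simp: weyl_class_eq_Collect n)
    then show ?thesis
      using n by (simp add: weyl_class_eqI normalizer_star germ_eq_star germ_eq_sym)
  qed
  have "?P \<noteq> {}"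
    using n x germ_eq_refl by (auto simp: weyl_class_eq_Collect)
  then show ?thesis
    unfolding weyl_groupoid_def groupoid.simps using eq by (intro subset_antisym UN_least) auto
qed

text \<open>All representatives of a class have the same source and the same range, so composability
  can be read off any of them.\<close>

lemma composable_weyl_groupoid:
  assumes N: "n \<in> N" "m \<in> N" and x: "x \<in> weyl_dom B m" and y: "y \<in> weyl_dom B n"
  shows "(weyl_class A B n y, weyl_class A B m x) \<in> composable (weyl_groupoid A B)
    \<longleftrightarrow> y = weyl_map B m x"
proof -
  have "(\<exists>z n' y' m' x'. (z, n', y') \<in> weyl_class A B n y \<and> (y', m', x') \<in> weyl_class A B m x)
      \<longleftrightarrow> y = weyl_map B m x"
  proof
    assume "\<exists>z n' y' m' x'. (z, n', y') \<in> weyl_class A B n y \<and> (y', m', x') \<in> weyl_class A B m x"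
    then obtain z n' y' m' x'
      where P: "(z, n', y') \<in> weyl_class A B n y" and Q: "(y', m', x') \<in> weyl_class A B m x" by blast
    from P have "y' = y" unfolding weyl_class_eq_Collect[OF N(1) y] by blast
    moreover from Q have "y' = weyl_map B m' x" "germ_eq m m' x"
      unfolding weyl_class_eq_Collect[OF N(2) x] by blast+
    ultimately show "y = weyl_map B m x" using germ_eq_dom(3) by metis
  next
    assume "y = weyl_map B m x"
    moreover have "(weyl_map B n y, n, y) \<in> weyl_class A B n y"
      "(weyl_map B m x, m, x) \<in> weyl_class A B m x"
      unfolding weyl_class_eq_Collect[OF N(1) y] weyl_class_eq_Collect[OF N(2) x]
      using N germ_eq_refl x y by blast+
    ultimately show "\<exists>z n' y' m' x'. (z, n', y') \<in> weyl_class A B n y \<and> (y', m', x') \<in> weyl_class A B m x"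
      by blast
  qed
  moreover have "weyl_class A B n y \<in> weyl_triples A B // weyl_rel A B"
    "weyl_class A B m x \<in> weyl_triples A B // weyl_rel A B"
    using N x y unfolding quotient_weyl_rel by blast+
  ultimately show ?thesis by (simp add: weyl_groupoid_def)
qed

end

section \<open>The twisted group algebras\<close>

lemma subspace_closure:
  fixes W :: "'b :: real_normed_vector set"
  assumes W: "subspace W"
  shows "subspace (closure W)"
  unfolding subspace_def
proof (intro conjI allI ballI)
  show "0 \<in> closure W"
    using subspace_0[OF W] closure_subset by blast
  fix x assume x: "x \<in> closure W"
  then obtain X where X: "\<And>n. X n \<in> W" "X \<longlonglongrightarrow> x" by (auto simp: closure_sequential)
  show "r *\<^sub>R x \<in> closure W" for r
    unfolding closure_sequential
    using subspace_scale[OF W X(1), of r] tendsto_scaleR[OF tendsto_const X(2), of r]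
    by (intro exI[of _ "\<lambda>n. r *\<^sub>R X n"]) simp
  fix y assume "y \<in> closure W"
  then obtain Y where Y: "\<And>n. Y n \<in> W" "Y \<longlonglongrightarrow> y" by (auto simp: closure_sequential)
  show "x + y \<in> closure W"
    unfolding closure_sequential
    using subspace_add[OF W X(1) Y(1)] tendsto_add[OF X(2) Y(2)]
    by (intro exI[of _ "\<lambda>n. X n + Y n"]) simp
qed

text \<open>Rewriting the finite sums as a real span opens the way to \<open>span_minimal\<close>
  and \<open>closure_minimal\<close>. The generators carry a complex scalar because
  \<open>span\<close> uses real coefficients.\<close>

lemma reduced_alg_eq_closure_span:
  "reduced_alg G c X = closure (span {scaleC z (delta G c g) | z g. g \<in> X})"
proof -
  let ?P = "{\<Sum>g\<in>F. scaleC (a g) (delta G c g) | F a. finite F \<and> F \<subseteq> X}"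
  let ?S = "{scaleC z (delta G c g) | z g. g \<in> X}"
  have "span ?S \<subseteq> ?P"
  proof
    fix T assume "T \<in> span ?S"
    then show "T \<in> ?P"
    proof (induction rule: span_induct_alt)
      case base
      show ?case by (rule CollectI, rule exI[of _ "{}"]) auto
    next
      case (step r x y)
      from step(1) obtain z g where x: "x = scaleC z (delta G c g)" "g \<in> X" by blast
      from step(2) obtain F a where F: "finite F" "F \<subseteq> X" and y: "y = (\<Sum>g\<in>F. scaleC (a g) (delta G c g))"
        by blast
      \<comment> \<open>Outside \<open>F\<close> the function \<open>a\<close> is arbitrary, so the
        old coefficient at \<open>g\<close> must be read as 0 there.\<close>
      let ?a = "a(g := (if g \<in> F then a g else 0) + of_real r * z)"
      have split: "(\<Sum>h\<in>insert g F. scaleC (b h) (delta G c h))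
          = scaleC (b g) (delta G c g) + (\<Sum>h\<in>F - {g}. scaleC (b h) (delta G c h))" for b
        using F by (simp add: sum.insert_remove)
      have zero: "scaleC 0 T = 0" for T :: "'a operator"
        using scaleC_of_real[of 0 T] by simp
      have "y = scaleC (if g \<in> F then a g else 0) (delta G c g) + (\<Sum>h\<in>F - {g}. scaleC (a h) (delta G c h))"
        unfolding y using F by (simp add: zero sum.remove)
      moreover have "(\<Sum>h\<in>F - {g}. scaleC (?a h) (delta G c h)) = (\<Sum>h\<in>F - {g}. scaleC (a h) (delta G c h))"
        by (intro sum.cong) auto
      ultimately have "r *\<^sub>R x + y = (\<Sum>h\<in>insert g F. scaleC (?a h) (delta G c h))"
        unfolding split x by (simp add: scaleC_add_left scaleR_scaleC algebra_simps)
      then show ?case using F x(2) by blast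
    qed
  qed
  moreover have "?P \<subseteq> span ?S"
    by (auto intro!: span_sum intro: span_base)
  ultimately show ?thesis by (simp add: reduced_alg_def subset_antisym)
qed

lemma reduced_alg_subset:
  assumes "closed W" "subspace W" and "\<And>z g. g \<in> X \<Longrightarrow> scaleC z (delta G c g) \<in> W"
  shows "reduced_alg G c X \<subseteq> W"
  unfolding reduced_alg_eq_closure_span
  by (intro closure_minimal span_minimal assms(1,2)) (use assms(3) in auto)

lemma scaleC_delta_mem: "g \<in> X \<Longrightarrow> scaleC z (delta G c g) \<in> reduced_alg G c X"
  unfolding reduced_alg_eq_closure_span by (intro subsetD[OF closure_subset] span_base) blast

lemma delta_mem: "g \<in> X \<Longrightarrow> delta G c g \<in> reduced_alg G c X"
  using scaleC_delta_mem[of g X 1] by simp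

lemma closed_reduced_alg: "closed (reduced_alg G c X)"
  by (simp add: reduced_alg_def)

lemma subspace_reduced_alg: "subspace (reduced_alg G c X)"
  unfolding reduced_alg_eq_closure_span by (intro subspace_closure subspace_span)

lemma reduced_alg_mono: "X \<subseteq> Y \<Longrightarrow> reduced_alg G c X \<subseteq> reduced_alg G c Y"
  by (intro reduced_alg_subset closed_reduced_alg subspace_reduced_alg scaleC_delta_mem) auto

text \<open>The density principle of this development, together with \<open>reduced_alg_eqI\<close>.
  Since \<Phi> is merely real linear, it is tested on all complex multiples of the generators;
  statements in two operators use it once per variable.\<close>

lemma reduced_alg_image_subset:
  assumes "bounded_linear \<Phi>" "closed W" "subspace W"
    and "\<And>z g. g \<in> X \<Longrightarrow> \<Phi> (scaleC z (delta G c g)) \<in> W" and "T \<in> reduced_alg G c X"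
  shows "\<Phi> T \<in> W"
proof -
  have "reduced_alg G c X \<subseteq> \<Phi> -` W"
  proof (rule reduced_alg_subset)
    show "closed (\<Phi> -` W)"
      using assms(1,2) by (intro closed_vimage linear_continuous_on)
    show "subspace (\<Phi> -` W)"
      by (rule linear_subspace_vimage[OF bounded_linear.linear[OF assms(1)] assms(3)])
  qed (use assms(4) in auto)
  then show ?thesis using assms(5) by auto
qed

lemma reduced_alg_eqI:
  assumes "bounded_linear \<Phi>" "bounded_linear \<Psi>"
    and "\<And>z g. g \<in> X \<Longrightarrow> \<Phi> (scaleC z (delta G c g)) = \<Psi> (scaleC z (delta G c g))"
    and "T \<in> reduced_alg G c X"
  shows "\<Phi> T = \<Psi> T"
  using reduced_alg_image_subset[OF bounded_linear_sub[OF assms(1,2)], of "{0}", OF _ subspace_single_0 _ assms(4)]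
    assms(3) by simp

section \<open>Cocycle relations among the generators\<close>

locale twisted_group = group G for G :: "('a, 'm) monoid_scheme" (structure) +
  fixes c :: "'a \<Rightarrow> 'a \<Rightarrow> complex"
  assumes two_cocycle: "two_cocycle G c"
begin

lemma
  shows norm_cocycle: "g \<in> carrier G \<Longrightarrow> h \<in> carrier G \<Longrightarrow> cmod (c g h) = 1"
    and cocycle_one: "g \<in> carrier G \<Longrightarrow> c g \<one> = 1" "g \<in> carrier G \<Longrightarrow> c \<one> g = 1"
    and cocycle: "g \<in> carrier G \<Longrightarrow> h \<in> carrier G \<Longrightarrow> k \<in> carrier G \<Longrightarrow>
      c g (h \<otimes> k) * c h k = c (g \<otimes> h) k * c g h"
  using two_cocycle by (auto simp: two_cocycle_def)

lemmas coord_delta_apply = coord_delta[OF is_group two_cocycle]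

lemma delta_compose:
  assumes g: "g \<in> carrier G" and h: "h \<in> carrier G"
  shows "delta G c g o\<^sub>L delta G c h = scaleC (c g h) (delta G c (g \<otimes> h))"
proof (rule blinfun_eqI, rule ell2_eqI)
  fix f k
  show "coord (blinfun_apply (delta G c g o\<^sub>L delta G c h) f) k
    = coord (blinfun_apply (scaleC (c g h) (delta G c (g \<otimes> h))) f) k"
  proof (cases "k \<in> carrier G")
    case True
    let ?l = "inv (g \<otimes> h) \<otimes> k"
    have l: "?l = inv h \<otimes> (inv g \<otimes> k)" "h \<otimes> ?l = inv g \<otimes> k"
      using g h True by (simp_all add: inv_mult_group m_assoc) (simp flip: m_assoc)
    \<comment> \<open>The cocycle identity at \<open>g\<close>, \<open>h\<close> and the point where
      the vector is evaluated is the whole content of the product formula.\<close>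
    have "c g (h \<otimes> ?l) * c h ?l = c (g \<otimes> h) ?l * c g h"
      using g h True by (intro cocycle) auto
    then have "c g (inv g \<otimes> k) * c h ?l = c g h * c (g \<otimes> h) ?l"
      unfolding l(2) by (simp add: mult.commute)
    then show ?thesis
      using g h True by (simp add: coord_delta_apply scaleC_apply coord_cmult l(1)[symmetric] flip: mult.assoc)
  qed (use g h in \<open>simp add: coord_delta_apply scaleC_apply coord_cmult\<close>)
qed

lemma is_adjoint_delta:
  assumes g: "g \<in> carrier G"
  shows "is_adjoint (scaleC (cnj (c g (inv g))) (delta G c (inv g))) (delta G c g)"
  unfolding is_adjoint_def
proof (intro allI)
  fix f h
  let ?R = "scaleC (cnj (c g (inv g))) (delta G c (inv g))"
  \<comment> \<open>The phases agree by the cocycle identity for \<open>inv g\<close>,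
    \<open>g\<close>, \<open>k\<close>, combined with the equality of \<open>c (inv g) g\<close> and
    \<open>c g (inv g)\<close>.\<close>
  have cc: "c g (inv g) * cnj (c (inv g) (g \<otimes> k)) = c g k" if k: "k \<in> carrier G" for k
  proof -
    have "c (inv g) (g \<otimes> k) * c g k = c (inv g) g"
      using cocycle[of "inv g" g k] g k by (simp add: cocycle_one)
    moreover have "c (inv g) g = c g (inv g)"
      using cocycle[of g "inv g" g] g by (simp add: cocycle_one)
    moreover have "c (inv g) (g \<otimes> k) * cnj (c (inv g) (g \<otimes> k)) = 1"
      using norm_cocycle[of "inv g" "g \<otimes> k"] g k by (simp add: complex_norm_square[symmetric])
    ultimately show ?thesis by (metis mult.assoc mult.commute mult_1)
  qed
  \<comment> \<open>Vectors in the range of \<open>delta\<close> vanish outside the carrier, so the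
    sums may be restricted to the carrier, where left translation by \<open>g\<close> is a
    bijection.\<close>
  have "cinner (blinfun_apply ?R f) h
      = (\<Sum>\<^sub>\<infinity>k\<in>carrier G. cnj (coord (blinfun_apply ?R f) k) * coord h k)"
    unfolding cinner_def using g
    by (intro infsum_cong_neutral) (auto simp: scaleC_apply coord_cmult coord_delta_apply)
  also have "\<dots> = (\<Sum>\<^sub>\<infinity>k\<in>carrier G. cnj (coord f (g \<otimes> k)) * coord (blinfun_apply (delta G c g) h) (g \<otimes> k))"
  proof (rule infsum_cong)
    fix k assume k: "k \<in> carrier G"
    have "inv g \<otimes> (g \<otimes> k) = k" using g k by (simp flip: m_assoc)
    then show "cnj (coord (blinfun_apply ?R f) k) * coord h k
        = cnj (coord f (g \<otimes> k)) * coord (blinfun_apply (delta G c g) h) (g \<otimes> k)"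
      using g k by (simp add: scaleC_apply coord_cmult coord_delta_apply mult_ac flip: cc[OF k])
  qed
  also have "\<dots> = (\<Sum>\<^sub>\<infinity>k\<in>carrier G. cnj (coord f k) * coord (blinfun_apply (delta G c g) h) k)"
  proof (rule infsum_reindex_bij_betw[where g = "\<lambda>k. g \<otimes> k"])
    show "bij_betw (\<lambda>k. g \<otimes> k) (carrier G) (carrier G)"
      by (rule bij_betw_byWitness[where f' = "\<lambda>k. inv g \<otimes> k"]) (use g in \<open>auto simp flip: m_assoc\<close>)
  qed
  also have "\<dots> = cinner f (blinfun_apply (delta G c g) h)"
    unfolding cinner_def using g
    by (intro infsum_cong_neutral) (auto simp: coord_delta_apply)
  finally show "cinner (blinfun_apply ?R f) h = cinner f (blinfun_apply (delta G c g) h)" .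
qed

lemma star_delta: "g \<in> carrier G \<Longrightarrow> star (delta G c g) = scaleC (cnj (c g (inv g))) (delta G c (inv g))"
  by (rule star_eqI) (rule is_adjoint_delta)

lemma delta_compose_scaleC: "g \<in> carrier G \<Longrightarrow> delta G c g o\<^sub>L scaleC z T = scaleC z (delta G c g o\<^sub>L T)"
  by (rule compose_scaleC) (rule is_adjoint_delta)

lemma star_algebra_reduced_alg:
  assumes X: "subgroup X G"
  shows "star_algebra (reduced_alg G c X)"
proof
  let ?A = "reduced_alg G c X"
  have sub: "g \<in> X \<Longrightarrow> g \<in> carrier G" for g using subgroup.mem_carrier[OF X] .
  note bl = bounded_linear_scaleC bounded_linear_compose_left bounded_linear_compose_right
  note alg = closed_reduced_alg[of G c X] subspace_reduced_alg[of G c X]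
  show "closed ?A" "subspace ?A" by fact+
  show "scaleC z T \<in> ?A" if "T \<in> ?A" for z T
    by (rule reduced_alg_image_subset[OF bl(1) alg _ that]) (simp add: scaleC_scaleC scaleC_delta_mem)
  \<comment> \<open>Density is used in the right factor with a generator on the left; the left
    factor is freed afterwards.\<close>
  have gen: "scaleC z (delta G c g) o\<^sub>L R \<in> ?A" if g: "g \<in> X" and R: "R \<in> ?A" for z g R
  proof (rule reduced_alg_image_subset[OF bl(2) alg _ R])
    fix w h assume h: "h \<in> X"
    show "scaleC z (delta G c g) o\<^sub>L scaleC w (delta G c h) \<in> ?A"
      using g h subgroup.m_closed[OF X]
      by (simp add: sub scaleC_compose_left delta_compose_scaleC delta_compose scaleC_scaleC scaleC_delta_mem)
  qed
  show "T o\<^sub>L R \<in> ?A" if "T \<in> ?A" "R \<in> ?A" for T R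
    by (rule reduced_alg_image_subset[OF bl(3) alg _ that(1)]) (rule gen[OF _ that(2)])
  have "?A \<subseteq> {T. \<exists>R\<in>?A. is_adjoint R T}"
  proof (rule reduced_alg_subset)
    show "closed {T. \<exists>R\<in>?A. is_adjoint R T}" by (rule closed_is_adjoint) fact
    show "subspace {T. \<exists>R\<in>?A. is_adjoint R T}"
      by (rule subspace_is_adjoint) fact
    fix z g assume g: "g \<in> X"
    have "is_adjoint (scaleC (cnj z) (scaleC (cnj (c g (inv g))) (delta G c (inv g)))) (scaleC z (delta G c g))"
      by (intro is_adjoint_scaleC is_adjoint_delta sub g)
    then show "scaleC z (delta G c g) \<in> {T. \<exists>R\<in>?A. is_adjoint R T}"
      using g subgroup.m_inv_closed[OF X] unfolding scaleC_scaleC by (blast intro: scaleC_delta_mem)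
  qed
  then show "\<exists>R\<in>?A. is_adjoint R T" if "T \<in> ?A" for T using that by blast
qed

end

section \<open>The conditional expectation\<close>

definition cut :: "'a set \<Rightarrow> 'a ell2 \<Rightarrow> 'a ell2" where
  "cut C f = Abs_ell2 (\<lambda>x. if x \<in> C then coord f x else 0)"

lemma sum_cut_le:
  assumes "finite F"
  shows "(\<Sum>x\<in>F. (cmod (if x \<in> C then coord f x else 0))\<^sup>2) \<le> (norm f)\<^sup>2"
proof -
  have "(\<Sum>x\<in>F. (cmod (if x \<in> C then coord f x else 0))\<^sup>2) \<le> (\<Sum>x\<in>F. (cmod (coord f x))\<^sup>2)"
    by (intro sum_mono) auto
  also have "\<dots> \<le> (norm f)\<^sup>2" by (rule sum_coord_le[OF assms])
  finally show ?thesis .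
qed

lemma coord_cut: "coord (cut C f) = (\<lambda>x. if x \<in> C then coord f x else 0)"
  unfolding cut_def by (intro coord_Abs sq_summable_bdd[OF sum_cut_le])

lemma norm_cut_le: "norm (cut C f) \<le> norm f"
  by (rule norm_ell2_leI) (simp_all add: coord_cut sum_cut_le)

lemma inner_cut_self: "cut C f \<bullet> f = (norm (cut C f))\<^sup>2"
proof -
  have "cinner (cut C f) f = cinner (cut C f) (cut C f)"
    unfolding cinner_def by (rule infsum_cong) (simp add: coord_cut)
  then show ?thesis by (simp add: inner_ell2_def power2_norm_eq_inner)
qed

lemma sum_cut:
  assumes "finite bs"
  shows "(\<Sum>b\<in>bs. cut (\<pi> -` {b}) f) = cut (\<pi> -` bs) f"
  using assms
proof (induction bs rule: finite_induct)
  case empty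
  show ?case by (rule ell2_eqI) (simp add: coord_cut coord_zero)
next
  case (insert b bs)
  then show ?case by (simp, intro ell2_eqI) (auto simp: coord_cut coord_add)
qed

text \<open>Bessel's inequality for the fibres of \<open>\<pi>\<close>: the pieces add up to a
  single cut, whose inner product with \<open>f\<close> is its own squared norm.\<close>

lemma sum_norm_cut_le:
  assumes "finite bs"
  shows "(\<Sum>b\<in>bs. (norm (cut (\<pi> -` {b}) f))\<^sup>2) \<le> (norm f)\<^sup>2"
proof -
  have "(\<Sum>b\<in>bs. (norm (cut (\<pi> -` {b}) f))\<^sup>2) = (\<Sum>b\<in>bs. cut (\<pi> -` {b}) f) \<bullet> f"
    by (simp add: inner_sum_left inner_cut_self)
  also have "\<dots> = (norm (cut (\<pi> -` bs) f))\<^sup>2"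
    by (simp add: sum_cut[OF assms] inner_cut_self)
  also have "\<dots> \<le> (norm f)\<^sup>2" by (intro power_mono norm_cut_le) simp
  finally show ?thesis .
qed

text \<open>Compression to the diagonal blocks cut out by the fibres of \<open>\<pi>\<close>. The
  coordinate formula avoids an infinite, only strongly convergent sum of compressed
  operators.\<close>

definition block_diag :: "('a \<Rightarrow> 'b) \<Rightarrow> 'a operator \<Rightarrow> 'a operator" where
  "block_diag \<pi> T = Blinfun (\<lambda>f. Abs_ell2 (\<lambda>k. coord (blinfun_apply T (cut (\<pi> -` {\<pi> k}) f)) k))"

text \<open>Within one fibre all coordinates belong to the image of one and the same cut, so the
  operator norm applies fibre by fibre and \<open>sum_norm_cut_le\<close> adds the bounds.
  Compression is thus contractive.\<close>

lemma sum_block_diag_le: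
  assumes F: "finite F"
  shows "(\<Sum>k\<in>F. (cmod (coord (blinfun_apply T (cut (\<pi> -` {\<pi> k}) f)) k))\<^sup>2) \<le> (norm T * norm f)\<^sup>2"
proof -
  have "(\<Sum>k\<in>F. (cmod (coord (blinfun_apply T (cut (\<pi> -` {\<pi> k}) f)) k))\<^sup>2)
      = (\<Sum>b\<in>\<pi> ` F. \<Sum>k | k \<in> F \<and> \<pi> k = b. (cmod (coord (blinfun_apply T (cut (\<pi> -` {\<pi> k}) f)) k))\<^sup>2)"
    by (rule sum.image_gen[OF F])
  also have "\<dots> \<le> (\<Sum>b\<in>\<pi> ` F. (norm T)\<^sup>2 * (norm (cut (\<pi> -` {b}) f))\<^sup>2)"
  proof (rule sum_mono)
    fix b
    have "(\<Sum>k | k \<in> F \<and> \<pi> k = b. (cmod (coord (blinfun_apply T (cut (\<pi> -` {\<pi> k}) f)) k))\<^sup>2)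
        = (\<Sum>k | k \<in> F \<and> \<pi> k = b. (cmod (coord (blinfun_apply T (cut (\<pi> -` {b}) f)) k))\<^sup>2)"
      by (rule sum.cong) auto
    also have "\<dots> \<le> (norm (blinfun_apply T (cut (\<pi> -` {b}) f)))\<^sup>2"
      using F by (intro sum_coord_le) auto
    also have "\<dots> \<le> (norm T * norm (cut (\<pi> -` {b}) f))\<^sup>2"
      by (intro power_mono norm_blinfun) auto
    finally show "(\<Sum>k | k \<in> F \<and> \<pi> k = b. (cmod (coord (blinfun_apply T (cut (\<pi> -` {\<pi> k}) f)) k))\<^sup>2)
        \<le> (norm T)\<^sup>2 * (norm (cut (\<pi> -` {b}) f))\<^sup>2"
      by (simp add: power_mult_distrib)
  qed
  also have "\<dots> = (norm T)\<^sup>2 * (\<Sum>b\<in>\<pi> ` F. (norm (cut (\<pi> -` {b}) f))\<^sup>2)"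
    by (simp add: sum_distrib_left)
  also have "\<dots> \<le> (norm T)\<^sup>2 * (norm f)\<^sup>2"
    using F by (intro mult_left_mono sum_norm_cut_le) auto
  finally show ?thesis by (simp add: power_mult_distrib)
qed

lemma cut_add: "cut C (f + g) = cut C f + cut C g"
  by (rule ell2_eqI) (simp add: coord_cut coord_add)

lemma cut_scaleR: "cut C (r *\<^sub>R f) = r *\<^sub>R cut C f"
  by (rule ell2_eqI) (simp add: coord_cut coord_scaleR)

lemma
  shows coord_block_diag: "coord (blinfun_apply (block_diag \<pi> T) f) k
      = coord (blinfun_apply T (cut (\<pi> -` {\<pi> k}) f)) k"
    and norm_block_diag_le: "norm (block_diag \<pi> T) \<le> norm T"
proof -
  define D where "D f = Abs_ell2 (\<lambda>k. coord (blinfun_apply T (cut (\<pi> -` {\<pi> k}) f)) k)" for f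
  have coord_D: "coord (D f) = (\<lambda>k. coord (blinfun_apply T (cut (\<pi> -` {\<pi> k}) f)) k)" for f
    unfolding D_def by (intro coord_Abs sq_summable_bdd[OF sum_block_diag_le])
  have bound: "norm (D f) \<le> norm T * norm f" for f
    by (rule norm_ell2_leI) (simp_all add: coord_D sum_block_diag_le)
  have "bounded_linear D"
  proof (rule bounded_linear_intro[where K = "norm T"])
    show "D (f + h) = D f + D h" for f h
      by (rule ell2_eqI) (simp add: coord_D coord_add cut_add blinfun.bilinear_simps)
    show "D (r *\<^sub>R f) = r *\<^sub>R D f" for r f
      by (rule ell2_eqI) (simp add: coord_D coord_scaleR cut_scaleR blinfun.bilinear_simps)
    show "norm (D f) \<le> norm f * norm T" for f
      using bound[of f] by (simp add: mult.commute)
  qed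
  then have D: "blinfun_apply (block_diag \<pi> T) = D"
    unfolding block_diag_def D_def[abs_def] by (rule bounded_linear_Blinfun_apply)
  show "coord (blinfun_apply (block_diag \<pi> T) f) k = coord (blinfun_apply T (cut (\<pi> -` {\<pi> k}) f)) k"
    by (simp add: D coord_D)
  show "norm (block_diag \<pi> T) \<le> norm T"
    by (rule norm_blinfun_bound) (simp_all add: D bound)
qed

lemma bounded_linear_block_diag: "bounded_linear (block_diag \<pi>)"
proof (rule bounded_linear_intro[where K = 1])
  show "block_diag \<pi> (T + R) = block_diag \<pi> T + block_diag \<pi> R" for T R :: "'a operator"
    by (rule blinfun_eqI, rule ell2_eqI) (simp add: coord_block_diag blinfun.bilinear_simps coord_add)
  show "block_diag \<pi> (r *\<^sub>R T) = r *\<^sub>R block_diag \<pi> T" for r and T :: "'a operator"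
    by (rule blinfun_eqI, rule ell2_eqI) (simp add: coord_block_diag blinfun.bilinear_simps coord_scaleR)
qed (simp add: norm_block_diag_le)

lemma block_diag_scaleC: "block_diag \<pi> (scaleC z T) = scaleC z (block_diag \<pi> T)"
  by (rule blinfun_eqI, rule ell2_eqI) (simp add: coord_block_diag scaleC_apply coord_cmult)

section \<open>The expectation onto the algebra of the subgroup\<close>

locale twisted_pair = twisted_group +
  fixes S :: "'a set"
  assumes abelian_symmetric: "abelian_symmetric G c S"
    and normal: "S \<lhd> G"
begin

abbreviation (input) A where "A \<equiv> reduced_alg G c (carrier G)"
abbreviation (input) B where "B \<equiv> reduced_alg G c S"
abbreviation (input) \<delta> where "\<delta> \<equiv> delta G c"

lemma subgroup: "subgroup S G"
  by (rule normal_imp_subgroup[OF normal])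

lemma mem_carrier: "s \<in> S \<Longrightarrow> s \<in> carrier G"
  by (rule subgroup.mem_carrier[OF subgroup])

sublocale unital_commutative_pair A B "\<delta> \<one>"
proof (intro unital_commutative_pair.intro unital_commutative_pair_axioms.intro)
  note bl = bounded_linear_scaleC bounded_linear_compose_left bounded_linear_compose_right bounded_linear_ident
  show "star_algebra A" by (rule star_algebra_reduced_alg[OF subgroup_self])
  show "star_algebra B" by (rule star_algebra_reduced_alg[OF subgroup])
  show "B \<subseteq> A" using mem_carrier by (intro reduced_alg_mono) auto
  show "\<delta> \<one> \<in> B" by (intro delta_mem subgroup.one_closed[OF subgroup])
  have gen: "scaleC z (\<delta> s) o\<^sub>L b = b o\<^sub>L scaleC z (\<delta> s)" if s: "s \<in> S" and b: "b \<in> B" for z s b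
  proof (rule reduced_alg_eqI[OF bl(2,3) _ b])
    fix w t assume t: "t \<in> S"
    have "s \<otimes> t = t \<otimes> s" "c s t = c t s"
      using abelian_symmetric s t by (auto simp: abelian_symmetric_def)
    then show "scaleC z (\<delta> s) o\<^sub>L scaleC w (\<delta> t) = scaleC w (\<delta> t) o\<^sub>L scaleC z (\<delta> s)"
      using s t by (simp add: scaleC_compose_left delta_compose_scaleC delta_compose mem_carrier scaleC_scaleC mult_ac)
  qed
  show "a o\<^sub>L b = b o\<^sub>L a" if "a \<in> B" "b \<in> B" for a b
    by (rule reduced_alg_eqI[OF bl(3,2) gen[OF _ that(2)] that(1)])
  show "\<delta> \<one> o\<^sub>L T = T" if "T \<in> A" for T
    by (rule reduced_alg_eqI[OF bl(2,4) _ that])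
      (simp add: delta_compose_scaleC delta_compose cocycle_one)
  show "T o\<^sub>L \<delta> \<one> = T" if "T \<in> A" for T
    by (rule reduced_alg_eqI[OF bl(3,4) _ that])
      (simp add: scaleC_compose_left delta_compose cocycle_one)
qed

text \<open>The blocks are the right cosets of \<open>S\<close>: left translation by an element of
  \<open>S\<close> preserves each of them, and by any other group element moves each off itself.
  Compression therefore keeps exactly the generators from \<open>S\<close>.\<close>

definition expectation :: "'a operator \<Rightarrow> 'a operator" where
  "expectation = block_diag (\<lambda>k. S #> k)"

lemma bounded_linear_expectation: "bounded_linear expectation"
  unfolding expectation_def by (rule bounded_linear_block_diag)

lemma expectation_scaleC: "expectation (scaleC z T) = scaleC z (expectation T)"
  unfolding expectation_def by (rule block_diag_scaleC)

lemma coset_inv_mult_iff: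
  assumes g: "g \<in> carrier G" and k: "k \<in> carrier G"
  shows "S #> (inv g \<otimes> k) = S #> k \<longleftrightarrow> g \<in> S"
proof -
  have "S #> (inv g \<otimes> k) = S #> k \<longleftrightarrow> inv g \<in> S"
  proof
    assume "S #> (inv g \<otimes> k) = S #> k"
    then have "inv g \<otimes> k \<in> S #> k"
      using rcos_self[OF _ subgroup, of "inv g \<otimes> k"] g k by simp
    then obtain s where s: "s \<in> S" "inv g \<otimes> k = s \<otimes> k" by (auto simp: r_coset_def)
    then have "inv g = s" using g k mem_carrier by simp
    then show "inv g \<in> S" using s by simp
  next
    assume "inv g \<in> S"
    then have "S #> inv g = S" using g subgroup by (intro coset_join2) auto
    then show "S #> (inv g \<otimes> k) = S #> k"
      using coset_mult_assoc[OF subgroup.subset[OF subgroup], of "inv g" k] g k by simp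
  qed
  also have "\<dots> \<longleftrightarrow> g \<in> S"
    using g subgroup.m_inv_closed[OF subgroup] by (metis inv_inv)
  finally show ?thesis .
qed

lemma expectation_delta:
  assumes g: "g \<in> carrier G"
  shows "expectation (\<delta> g) = (if g \<in> S then \<delta> g else 0)"
  by (rule blinfun_eqI, rule ell2_eqI)
    (use g in \<open>auto simp: expectation_def coord_block_diag coord_delta_apply coord_cut coord_zero coset_inv_mult_iff\<close>)

lemma expectation_mem: "T \<in> A \<Longrightarrow> expectation T \<in> B"
  by (rule reduced_alg_image_subset[OF bounded_linear_expectation closed_reduced_alg subspace_reduced_alg])
    (simp_all add: expectation_scaleC expectation_delta scaleC_delta_mem B.scaleC_mem subspace_0 subspace_reduced_alg)

lemma expectation_id: "T \<in> B \<Longrightarrow> expectation T = T"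
  by (rule reduced_alg_eqI[OF bounded_linear_expectation bounded_linear_ident])
    (simp_all add: expectation_scaleC expectation_delta mem_carrier)

lemma mult_mem_iff:
  assumes s: "s \<in> S" and g: "g \<in> carrier G"
  shows "s \<otimes> g \<in> S \<longleftrightarrow> g \<in> S" "g \<otimes> s \<in> S \<longleftrightarrow> g \<in> S"
proof -
  have "inv s \<in> S" "s \<in> carrier G" "inv s \<in> carrier G"
    using s subgroup.m_inv_closed[OF subgroup] mem_carrier by auto
  moreover have "inv s \<otimes> (s \<otimes> g) = g" "(g \<otimes> s) \<otimes> inv s = g"
    using calculation g by (simp_all add: m_assoc) (simp flip: m_assoc)
  ultimately show "s \<otimes> g \<in> S \<longleftrightarrow> g \<in> S" "g \<otimes> s \<in> S \<longleftrightarrow> g \<in> S"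
    using s subgroup.m_closed[OF subgroup] by metis+
qed

text \<open>On generators this says that multiplication by an element of \<open>S\<close> does not
  change membership in \<open>S\<close>. Density then extends it to \<open>T\<close> and after that
  to \<open>b\<close>.\<close>

lemma expectation_bimodule:
  assumes b: "b \<in> B" and T: "T \<in> A"
  shows "expectation (b o\<^sub>L T) = b o\<^sub>L expectation T" "expectation (T o\<^sub>L b) = expectation T o\<^sub>L b"
proof -
  note E = bounded_linear_expectation
  note bl = bounded_linear_compose_left bounded_linear_compose_right
  note cE = bounded_linear_compose[OF E] and Ec = bounded_linear_compose[OF _ E]
  have zero: "scaleC z (0 :: 'a operator) = 0" for z
    by (rule linear_0[OF bounded_linear.linear[OF bounded_linear_scaleC]])
  have gen: "expectation (scaleC z (\<delta> s) o\<^sub>L scaleC w (\<delta> g)) = scaleC z (\<delta> s) o\<^sub>L expectation (scaleC w (\<delta> g))"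
    "expectation (scaleC w (\<delta> g) o\<^sub>L scaleC z (\<delta> s)) = expectation (scaleC w (\<delta> g)) o\<^sub>L scaleC z (\<delta> s)"
    if "s \<in> S" "g \<in> carrier G" for z s w g
    using that mem_carrier[OF that(1)]
    by (simp_all add: scaleC_compose_left delta_compose_scaleC delta_compose expectation_scaleC
      expectation_delta mult_mem_iff zero bounded_bilinear.zero_left[OF bounded_bilinear_blinfun_compose]
      bounded_bilinear.zero_right[OF bounded_bilinear_blinfun_compose])
  have "expectation (scaleC z (\<delta> s) o\<^sub>L T) = scaleC z (\<delta> s) o\<^sub>L expectation T" if "s \<in> S" for z s
    by (rule reduced_alg_eqI[OF cE[OF bl(1)] Ec[OF bl(1)] gen(1)[OF that] T])
  then show "expectation (b o\<^sub>L T) = b o\<^sub>L expectation T"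
    by (intro reduced_alg_eqI[OF cE[OF bl(2)] bl(2) _ b])
  have "expectation (T o\<^sub>L scaleC z (\<delta> s)) = expectation T o\<^sub>L scaleC z (\<delta> s)" if "s \<in> S" for z s
    by (rule reduced_alg_eqI[OF cE[OF bl(2)] Ec[OF bl(2)] gen(2)[OF that] T])
  then show "expectation (T o\<^sub>L b) = expectation T o\<^sub>L b"
    by (intro reduced_alg_eqI[OF cE[OF bl(1)] bl(1) _ b])
qed

section \<open>The action of the group on the spectrum\<close>

lemma cocycle_inv: "g \<in> carrier G \<Longrightarrow> c (inv g) g = c g (inv g)"
  using cocycle[of g "inv g" g] by (simp add: cocycle_one)

lemma star_delta_compose: "g \<in> carrier G \<Longrightarrow> star (\<delta> g) o\<^sub>L \<delta> g = \<delta> \<one>"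
  using norm_cocycle[of g "inv g"]
  by (simp add: star_delta scaleC_compose_left delta_compose scaleC_scaleC cocycle_inv mult.commute
    complex_norm_square[symmetric])

lemma delta_conj_mem:
  assumes g: "g \<in> carrier G" and b: "b \<in> B"
  shows "\<delta> g o\<^sub>L b o\<^sub>L \<delta> (inv g) \<in> B"
proof (rule reduced_alg_image_subset[OF bounded_linear_compose[OF bounded_linear_compose_right bounded_linear_compose_left]
      closed_reduced_alg subspace_reduced_alg _ b])
  fix z s assume s: "s \<in> S"
  have "g \<otimes> s \<otimes> inv g \<in> S" by (rule normal.inv_op_closed2[OF normal g s])
  then show "\<delta> g o\<^sub>L scaleC z (\<delta> s) o\<^sub>L \<delta> (inv g) \<in> B"
    using g mem_carrier[OF s]
    by (simp add: delta_compose_scaleC scaleC_compose_left delta_compose scaleC_scaleC scaleC_delta_mem)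
qed

lemma delta_normalizer:
  assumes g: "g \<in> carrier G"
  shows "\<delta> g \<in> normalizer A B"
proof -
  have "\<delta> g o\<^sub>L b o\<^sub>L star (\<delta> g) \<in> B" if b: "b \<in> B" for b
  proof -
    have "\<delta> g o\<^sub>L b o\<^sub>L star (\<delta> g) = scaleC (cnj (c g (inv g))) (\<delta> g o\<^sub>L b o\<^sub>L \<delta> (inv g))"
      unfolding star_delta[OF g]
      by (rule A.compose_scaleC_right[OF A.compose_mem[OF delta_mem[OF g] algebra_mem[OF b]]])
    then show ?thesis using delta_conj_mem[OF g b] by (simp add: B.scaleC_mem)
  qed
  moreover have "star (\<delta> g) o\<^sub>L b o\<^sub>L \<delta> g \<in> B" if b: "b \<in> B" for b
    using delta_conj_mem[OF inv_closed[OF g] b] g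
    by (simp add: star_delta scaleC_compose_left B.scaleC_mem)
  ultimately show ?thesis
    using delta_mem[OF g] by (simp add: normalizer_def)
qed

lemma weyl_dom_delta: "g \<in> carrier G \<Longrightarrow> weyl_dom B (\<delta> g) = points"
  using weyl_dom_iff[OF delta_normalizer] by (auto simp: star_delta_compose char_unit)

lemma weyl_map_delta_point: "g \<in> carrier G \<Longrightarrow> x \<in> points \<Longrightarrow> weyl_map B (\<delta> g) x \<in> points"
  by (simp add: weyl_map_point delta_normalizer weyl_dom_delta)

lemma weyl_map_delta_mult:
  assumes g: "g \<in> carrier G" and h: "h \<in> carrier G" and x: "x \<in> points"
  shows "weyl_map B (\<delta> (g \<otimes> h)) x = weyl_map B (\<delta> g) (weyl_map B (\<delta> h) x)"
proof -
  have "weyl_map B (\<delta> g o\<^sub>L \<delta> h) x = weyl_map B (\<delta> g) (weyl_map B (\<delta> h) x)"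
    by (rule weyl_map_compose) (use g h x in \<open>simp_all add: delta_normalizer weyl_dom_delta weyl_map_delta_point\<close>)
  then show ?thesis
    using g h by (simp add: delta_compose weyl_map_scaleC delta_normalizer norm_cocycle)
qed

text \<open>Here the normalizer itself lies in \<open>B\<close>, so \<open>x\<close> is
  multiplicative on each factor of the conjugate and the factors can be reordered.\<close>

lemma weyl_map_delta_subgroup:
  assumes s: "s \<in> S" and x: "x \<in> points"
  shows "weyl_map B (\<delta> s) x = x"
proof (rule weyl_map_eqI[OF delta_normalizer[OF mem_carrier[OF s]] _ x])
  show "x \<in> weyl_dom B (\<delta> s)" using x by (simp add: weyl_dom_delta mem_carrier s)
  have \<delta>s: "\<delta> s \<in> B" by (rule delta_mem[OF s])
  note mem = \<delta>s B.star_mem[OF \<delta>s]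
  show "x (star (\<delta> s) o\<^sub>L b o\<^sub>L \<delta> s) = x b * x (star (\<delta> s) o\<^sub>L \<delta> s)" if "b \<in> B" for b
    using that mem by (simp add: char_compose[OF x] B.compose_mem)
qed

text \<open>\<open>coset_action\<close> compares whole functions, so agreement on the spectrum is
  upgraded to equality by the restriction of both maps to it.\<close>

lemma weyl_map_delta_coset:
  assumes g: "g \<in> carrier G" and h: "h \<in> S #> g"
  shows "weyl_map B (\<delta> h) = weyl_map B (\<delta> g)"
proof -
  obtain s where s: "s \<in> S" "h = s \<otimes> g" using h by (auto simp: r_coset_def)
  have hG: "h \<in> carrier G" using s g mem_carrier by simp
  have "weyl_map B (\<delta> h) x = weyl_map B (\<delta> g) x" if "x \<in> points" for x
    using that g s mem_carrier
    by (simp add: weyl_map_delta_mult weyl_map_delta_subgroup weyl_map_delta_point)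
  then have "weyl_point (\<delta> h) x = weyl_point (\<delta> g) x" if "x \<in> points" for x
    using that g hG by (simp add: weyl_map_eq delta_normalizer weyl_dom_delta)
  then show ?thesis
    unfolding weyl_map_eq[OF delta_normalizer[OF g]] weyl_map_eq[OF delta_normalizer[OF hG]]
      weyl_dom_delta[OF g] weyl_dom_delta[OF hG] by (rule restrict_ext)
qed

lemma coset_action_eq:
  assumes g: "g \<in> carrier G"
  shows "coset_action G c S (S #> g) = weyl_map B (\<delta> g)"
  unfolding coset_action_def
proof (rule the_equality)
  show "\<forall>h\<in>S #> g. weyl_map B (\<delta> g) = weyl_map B (\<delta> h)"
    using weyl_map_delta_coset[OF g] by simp
  show "\<alpha> = weyl_map B (\<delta> g)" if "\<forall>h\<in>S #> g. \<alpha> = weyl_map B (\<delta> h)" for \<alpha>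
    using that rcos_self[OF g subgroup] by blast
qed

lemma continuous_map_weyl_delta:
  assumes g: "g \<in> carrier G"
  shows "continuous_map (spectrum B) (spectrum B) (weyl_map B (\<delta> g))"
  unfolding continuous_map_def
proof (intro conjI allI impI)
  show "weyl_map B (\<delta> g) \<in> topspace (spectrum B) \<rightarrow> topspace (spectrum B)"
    using weyl_map_delta_point[OF g] by (simp add: topspace_spectrum)
  show "openin (spectrum B) {x \<in> topspace (spectrum B). weyl_map B (\<delta> g) x \<in> U}"
    if "openin (spectrum B) U" for U
    using openin_weyl_preimage[OF delta_normalizer[OF g] that] g
    by (simp add: weyl_dom_delta topspace_spectrum)
qed

text \<open>Otherwise the functional sending \<open>T\<close> to the value of \<open>x\<close> at
  the expectation of \<open>star n o\<^sub>L T\<close> kills every generator, hence all of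
  \<open>A\<close>. At \<open>T = n\<close> the argument is already in \<open>B\<close>, which
  contradicts \<open>x\<close> being in the domain.\<close>

lemma fourier_coefficient_nonzero:
  assumes n: "n \<in> normalizer A B" and x: "x \<in> weyl_dom B n"
  shows "\<exists>g\<in>carrier G. x (expectation (star n o\<^sub>L \<delta> g)) \<noteq> 0"
proof (rule ccontr)
  assume "\<not> ?thesis"
  then have zero: "\<And>g. g \<in> carrier G \<Longrightarrow> x (expectation (star n o\<^sub>L \<delta> g)) = 0" by blast
  have xp: "x \<in> points" and nz: "x (star n o\<^sub>L n) \<noteq> 0" using x weyl_dom_iff[OF n] by auto
  have nA: "n \<in> A" by (rule normalizer_in[OF n])
  define \<Phi> where "\<Phi> T = expectation (star n o\<^sub>L T)" for T
  have bl: "bounded_linear \<Phi>"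
    unfolding \<Phi>_def by (rule bounded_linear_compose[OF bounded_linear_expectation bounded_linear_compose_left])
  have \<Phi>B: "\<Phi> T \<in> B" if "T \<in> A" for T
    unfolding \<Phi>_def by (intro expectation_mem A.compose_mem A.star_mem nA that)
  have x0: "x 0 = 0"
    using char_scaleR[OF xp unit_mem, of 0] by simp
  \<comment> \<open>Characters obey their rules on \<open>B\<close> only, so the kernel is formed
    inside \<open>A\<close>, and its closedness follows from sequences and
    \<open>char_norm_le\<close>.\<close>
  have "A \<subseteq> {T \<in> A. x (\<Phi> T) = 0}"
  proof (rule reduced_alg_subset)
    show "closed {T \<in> A. x (\<Phi> T) = 0}"
      unfolding closed_sequential_limits
    proof (intro allI impI, elim conjE)
      fix X T
      assume "\<forall>k. X k \<in> {T \<in> A. x (\<Phi> T) = 0}" and lim: "X \<longlonglongrightarrow> T"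
      then have X: "\<And>k. X k \<in> A" "\<And>k. x (\<Phi> (X k)) = 0" by auto
      have T: "T \<in> A" by (rule closed_sequentially[OF A.closed_algebra X(1) lim])
      have "cmod (x (\<Phi> T)) \<le> norm (\<Phi> T - \<Phi> (X k))" for k
        using char_norm_le[OF xp, of "\<Phi> T - \<Phi> (X k)"] X T
        by (simp add: char_diff[OF xp] \<Phi>B subspace_diff[OF B.subspace_algebra])
      moreover have "(\<lambda>k. norm (\<Phi> T - \<Phi> (X k))) \<longlonglongrightarrow> norm (\<Phi> T - \<Phi> T)"
        by (intro tendsto_intros bounded_linear.tendsto[OF bl] lim)
      ultimately have "cmod (x (\<Phi> T)) \<le> norm (\<Phi> T - \<Phi> T)"
        by (intro LIMSEQ_le_const) auto
      then show "T \<in> {T \<in> A. x (\<Phi> T) = 0}" using T by simp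
    qed
    show "subspace {T \<in> A. x (\<Phi> T) = 0}"
      unfolding subspace_def
      by (auto simp: subspace_0[OF A.subspace_algebra] subspace_add[OF A.subspace_algebra]
        subspace_scale[OF A.subspace_algebra] linear_0[OF bounded_linear.linear[OF bl]] x0
        linear_add[OF bounded_linear.linear[OF bl]] linear_scale[OF bounded_linear.linear[OF bl]]
        char_add[OF xp] char_scaleR[OF xp] \<Phi>B)
    show "scaleC z (\<delta> g) \<in> {T \<in> A. x (\<Phi> T) = 0}" if g: "g \<in> carrier G" for z g
    proof -
      have "\<Phi> (scaleC z (\<delta> g)) = scaleC z (\<Phi> (\<delta> g))"
        unfolding \<Phi>_def A.compose_scaleC_right[OF A.star_mem[OF nA]] by (rule expectation_scaleC)
      then show ?thesis
        using zero[OF g] by (simp add: char_scaleC[OF xp] \<Phi>B delta_mem g scaleC_delta_mem) (simp add: \<Phi>_def)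
    qed
  qed
  then have "x (expectation (star n o\<^sub>L n)) = 0" using nA by (auto simp: \<Phi>_def)
  then show False
    using nz by (simp add: expectation_id normalizer_star_self[OF n])
qed

lemma germ_eq_delta:
  assumes n: "n \<in> normalizer A B" and x: "x \<in> weyl_dom B n"
  shows "\<exists>g\<in>carrier G. germ_eq n (\<delta> g) x"
proof -
  obtain g where g: "g \<in> carrier G" and nz: "x (expectation (star n o\<^sub>L \<delta> g)) \<noteq> 0"
    using fourier_coefficient_nonzero[OF n x] by blast
  let ?a = "expectation (star n o\<^sub>L \<delta> g)"
  let ?d = "\<lambda>b. star (\<delta> g) o\<^sub>L b o\<^sub>L \<delta> g"
  have nA: "n \<in> A" "star n \<in> A" using normalizer_in[OF n] A.star_mem by auto
  have ngA: "star n o\<^sub>L \<delta> g \<in> A" by (intro A.compose_mem nA delta_mem g)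
  have aB: "?a \<in> B" by (rule expectation_mem[OF ngA])
  have dB: "?d b \<in> B" if "b \<in> B" for b by (rule normalizer_conj[OF delta_normalizer[OF g] that])
  have dd: "\<delta> g o\<^sub>L ?d b = b o\<^sub>L \<delta> g" if b: "b \<in> B" for b
  proof -
    have "\<delta> g o\<^sub>L star (\<delta> g) = \<delta> \<one>"
      using norm_cocycle[of g "inv g"] g
      by (simp add: star_delta delta_compose_scaleC delta_compose scaleC_scaleC mult.commute
        complex_norm_square[symmetric])
    then have "\<delta> g o\<^sub>L ?d b = \<delta> \<one> o\<^sub>L (b o\<^sub>L \<delta> g)"
      by (metis blinfun_compose_assoc)
    then show ?thesis
      using unit_left[OF A.compose_mem[OF algebra_mem[OF b] delta_mem[OF g]]] by simp
  qed
  have key: "(star n o\<^sub>L b o\<^sub>L n) o\<^sub>L ?a = (star n o\<^sub>L n) o\<^sub>L ?a o\<^sub>L ?d b" if b: "b \<in> B" for b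
  proof -
    \<comment> \<open>\<open>b\<close> is commuted past \<open>n o\<^sub>L star n\<close>, and then
      \<open>dd\<close> trades it for its conjugate on the far right, where the expectation can
      release it.\<close>
    have "(star n o\<^sub>L b o\<^sub>L n) o\<^sub>L (star n o\<^sub>L \<delta> g) = star n o\<^sub>L (b o\<^sub>L (n o\<^sub>L star n)) o\<^sub>L \<delta> g"
      by (simp add: blinfun_compose_assoc)
    also have "\<dots> = (star n o\<^sub>L n) o\<^sub>L (star n o\<^sub>L (b o\<^sub>L \<delta> g))"
      unfolding commute[OF b normalizer_self_star[OF n]] by (simp add: blinfun_compose_assoc)
    also have "\<dots> = (star n o\<^sub>L n) o\<^sub>L ((star n o\<^sub>L \<delta> g) o\<^sub>L ?d b)"
      unfolding dd[OF b, symmetric] by (simp add: blinfun_compose_assoc)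
    finally have "expectation ((star n o\<^sub>L b o\<^sub>L n) o\<^sub>L (star n o\<^sub>L \<delta> g))
        = expectation ((star n o\<^sub>L n) o\<^sub>L ((star n o\<^sub>L \<delta> g) o\<^sub>L ?d b))" by (rule arg_cong)
    then show ?thesis
      unfolding expectation_bimodule(1)[OF normalizer_conj[OF n b] ngA]
        expectation_bimodule(1)[OF normalizer_star_self[OF n] A.compose_mem[OF ngA algebra_mem[OF dB[OF b]]]]
        expectation_bimodule(2)[OF dB[OF b] ngA]
      by (simp add: blinfun_compose_assoc)
  qed
  \<comment> \<open>On this set \<open>y ?a\<close> can be cancelled from the identity
    \<open>key\<close>; it is open because \<open>?a\<close> belongs to \<open>B\<close>.\<close>
  let ?U = "weyl_dom B n \<inter> {y \<in> points. y ?a \<noteq> 0}"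
  have "weyl_map B n y = weyl_map B (\<delta> g) y" if y: "y \<in> ?U" for y
  proof (rule weyl_map_eqI[OF n])
    show "y \<in> weyl_dom B n" using y by simp
    have yp: "y \<in> points" and ya: "y ?a \<noteq> 0" using y by auto
    show "weyl_map B (\<delta> g) y \<in> points" by (rule weyl_map_delta_point[OF g yp])
    fix b assume b: "b \<in> B"
    have "y (star n o\<^sub>L b o\<^sub>L n) * y ?a = y (star n o\<^sub>L n) * y ?a * y (?d b)"
      using arg_cong[OF key[OF b], of y]
      by (simp add: char_compose[OF yp] B.compose_mem normalizer_conj[OF n b] normalizer_star_self[OF n] aB dB b)
    then have "y (star n o\<^sub>L b o\<^sub>L n) = y (?d b) * y (star n o\<^sub>L n)" using ya by simp
    moreover have "weyl_map B (\<delta> g) y b = y (?d b)"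
      using weyl_map_apply[OF delta_normalizer[OF g] _ b, of y] yp g
      by (simp add: weyl_dom_delta star_delta_compose char_unit)
    ultimately show "y (star n o\<^sub>L b o\<^sub>L n) = weyl_map B (\<delta> g) y b * y (star n o\<^sub>L n)" by simp
  qed
  moreover have "openin (spectrum B) ?U"
    by (intro openin_Int openin_weyl_dom openin_char_ne_0 n aB)
  moreover have "?U \<subseteq> weyl_dom B (\<delta> g)" by (auto simp: weyl_dom_delta g)
  moreover have "x \<in> ?U" using x nz weyl_dom_points by auto
  ultimately show ?thesis using g unfolding germ_eq_def by blast
qed

lemma germ_eq_delta_coset:
  assumes g: "g \<in> carrier G" and h: "h \<in> S #> g" and x: "x \<in> points"
  shows "germ_eq (\<delta> h) (\<delta> g) x"
proof -
  have hG: "h \<in> carrier G" using h g r_coset_subset_G[OF subgroup.subset[OF subgroup] g] by blast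
  show ?thesis
    unfolding germ_eq_def weyl_map_delta_coset[OF g h] weyl_dom_delta[OF g] weyl_dom_delta[OF hG]
    using x openin_topspace[of "spectrum B"] by (auto simp: topspace_spectrum)
qed

lemma germ_eq_delta_imp_coset_eq:
  assumes free: "topologically_free (G Mod S) (spectrum B) (coset_action G c S)"
    and g: "g \<in> carrier G" and h: "h \<in> carrier G" and gh: "germ_eq (\<delta> g) (\<delta> h) x"
  shows "S #> g = S #> h"
proof -
  obtain U where U: "openin (spectrum B) U" "x \<in> U" and eq: "\<And>u. u \<in> U \<Longrightarrow> weyl_map B (\<delta> g) u = weyl_map B (\<delta> h) u"
    using gh unfolding germ_eq_def by blast
  have Up: "u \<in> points" if "u \<in> U" for u
    using openin_subset[OF U(1)] that by (auto simp: topspace_spectrum)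
  \<comment> \<open>Equality of the two maps on \<open>U\<close> means that this element fixes
    \<open>U\<close> pointwise.\<close>
  let ?k = "inv h \<otimes> g"
  let ?q = "S #> ?k"
  have k: "?k \<in> carrier G" using g h by simp
  have fixed: "coset_action G c S ?q u = u" if u: "u \<in> U" for u
  proof -
    have "weyl_map B (\<delta> ?k) u = weyl_map B (\<delta> (inv h)) (weyl_map B (\<delta> h) u)"
      using g h Up[OF u] eq[OF u] by (simp add: weyl_map_delta_mult)
    also have "\<dots> = weyl_map B (\<delta> (inv h \<otimes> h)) u"
      using h Up[OF u] by (simp only: weyl_map_delta_mult inv_closed)
    also have "\<dots> = u"
      using h Up[OF u] subgroup.one_closed[OF subgroup] by (simp add: weyl_map_delta_subgroup)
    finally show ?thesis by (simp add: coset_action_eq k)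
  qed
  have "?q = \<one>\<^bsub>G Mod S\<^esub>"
  proof (rule ccontr)
    assume "?q \<noteq> \<one>\<^bsub>G Mod S\<^esub>"
    then have "finite {?q} \<and> {?q} \<subseteq> carrier (G Mod S) - {\<one>\<^bsub>G Mod S\<^esub>}"
      using k by (auto simp: FactGroup_def RCOSETS_def)
    then have "spectrum B closure_of {u \<in> topspace (spectrum B). \<forall>q\<in>{?q}. coset_action G c S q u \<noteq> u}
        = topspace (spectrum B)"
      using free unfolding topologically_free_def by blast
    then have "x \<in> spectrum B closure_of {u \<in> topspace (spectrum B). coset_action G c S ?q u \<noteq> u}"
      \<comment> \<open>Freeness for the single coset \<open>?q\<close> puts \<open>x\<close> in the
        closure of the points that it moves, yet the neighbourhood \<open>U\<close> of
        \<open>x\<close> contains none.\<close>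
      using Up[OF U(2)] by (simp add: topspace_spectrum)
    then show False using U fixed unfolding in_closure_of by blast
  qed
  then have "?k \<in> S" using rcos_self[OF k subgroup] by simp
  \<comment> \<open>Equality of right cosets requires \<open>g \<otimes> inv h\<close> in
    \<open>S\<close>; normality gets it from \<open>inv h \<otimes> g\<close> by
    conjugation.\<close>
  then have "h \<otimes> ?k \<otimes> inv h \<in> S" by (rule normal.inv_op_closed2[OF normal h])
  moreover have "h \<otimes> ?k \<otimes> inv h = g \<otimes> inv h"
    using g h by (simp flip: m_assoc)
  ultimately have "g \<otimes> inv h \<in> S" by simp
  then have "S #> (g \<otimes> inv h) = S" using g h subgroup by (intro coset_join2) auto
  then show ?thesis
    using coset_mult_assoc[OF subgroup.subset[OF subgroup], of "g \<otimes> inv h" h] g h by (simp add: m_assoc)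
qed

end

section \<open>Topological groupoids\<close>

text \<open>That \<H> is a groupoid is part of the conclusion. Compatibility with inverses is
  therefore a hypothesis: it cannot be deduced from uniqueness of inverses in \<H>
  beforehand.\<close>

lemma topological_groupoid_transport:
  assumes \<G>: "topological_groupoid \<G>"
    and homeo: "homeomorphic_map (arrows \<G>) (arrows \<H>) \<phi>"
    and arr: "composable \<H> \<subseteq> topspace (arrows \<H>) \<times> topspace (arrows \<H>)"
    and composable: "\<And>a b. a \<in> topspace (arrows \<G>) \<Longrightarrow> b \<in> topspace (arrows \<G>) \<Longrightarrow>
      (\<phi> a, \<phi> b) \<in> composable \<H> \<longleftrightarrow> (a, b) \<in> composable \<G>"
    and comp: "\<And>a b. (a, b) \<in> composable \<G> \<Longrightarrow> \<phi> (gcomp \<G> a b) = gcomp \<H> (\<phi> a) (\<phi> b)"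
    and inv: "\<And>a. a \<in> topspace (arrows \<G>) \<Longrightarrow> \<phi> (ginv \<G> a) = ginv \<H> (\<phi> a)"
  shows "topological_groupoid_iso \<G> \<H> \<phi>"
proof -
  interpret topological_groupoid \<G> by (rule \<G>)
  let ?X = "topspace (arrows \<G>)" and ?Y = "topspace (arrows \<H>)"
  obtain \<psi> where "homeomorphic_maps (arrows \<G>) (arrows \<H>) \<phi> \<psi>"
    using homeo homeomorphic_map_maps by blast
  then have \<phi>: "continuous_map (arrows \<G>) (arrows \<H>) \<phi>" and \<psi>: "continuous_map (arrows \<H>) (arrows \<G>) \<psi>"
    and \<phi>\<psi>: "\<And>p. p \<in> ?Y \<Longrightarrow> \<phi> (\<psi> p) = p"
    by (auto simp: homeomorphic_maps_def)
  have \<phi>Y: "\<phi> a \<in> ?Y" if "a \<in> ?X" for a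
    using that \<phi> by (auto simp: continuous_map_def)
  have \<psi>X: "\<psi> p \<in> ?X" if "p \<in> ?Y" for p
    using that \<psi> by (auto simp: continuous_map_def)
  have arrE: thesis if "p \<in> ?Y" "\<And>a. a \<in> ?X \<Longrightarrow> p = \<phi> a \<Longrightarrow> thesis" for p thesis
    using that \<psi>X \<phi>\<psi> by metis
  \<comment> \<open>Composability is reflected as well as preserved, so every composable pair is the
    image of one and each axiom can be checked on images.\<close>
  have compE: thesis if "(p, q) \<in> composable \<H>"
      "\<And>a b. a \<in> ?X \<Longrightarrow> b \<in> ?X \<Longrightarrow> (a, b) \<in> composable \<G> \<Longrightarrow> p = \<phi> a \<Longrightarrow> q = \<phi> b \<Longrightarrow> thesis" for p q thesis
  proof -
    have pq: "p \<in> ?Y" "q \<in> ?Y" using that(1) arr by auto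
    then have "(\<psi> p, \<psi> q) \<in> composable \<G>"
      using composable[OF \<psi>X \<psi>X, of p q] that(1) \<phi>\<psi> by simp
    then show thesis using pq \<psi>X \<phi>\<psi> by (intro that(2)[of "\<psi> p" "\<psi> q"]) simp_all
  qed
  have \<H>: "topological_groupoid \<H>"
  proof
    show "composable \<H> \<subseteq> ?Y \<times> ?Y" by (rule arr)
    show "gcomp \<H> p q \<in> ?Y" if "(p, q) \<in> composable \<H>" for p q
      using that by (rule compE) (simp add: comp[symmetric] comp_arrow \<phi>Y)
    show "ginv \<H> p \<in> ?Y" if "p \<in> ?Y" for p
      using that by (rule arrE) (simp add: inv[symmetric] ginv_arrow \<phi>Y)
    show "ginv \<H> (ginv \<H> p) = p" if "p \<in> ?Y" for p
      using that by (rule arrE) (simp add: inv[symmetric] ginv_arrow ginv_ginv)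
    show "(ginv \<H> p, p) \<in> composable \<H>" "(p, ginv \<H> p) \<in> composable \<H>" if "p \<in> ?Y" for p
      using that by (rule arrE; simp add: inv[symmetric] ginv_arrow composable ginv_left ginv_right)+
    show "gcomp \<H> (ginv \<H> p) (gcomp \<H> p q) = q" if "(p, q) \<in> composable \<H>" for p q
    proof (rule compE[OF that])
      fix a b assume ab: "a \<in> ?X" "b \<in> ?X" "(a, b) \<in> composable \<G>" "p = \<phi> a" "q = \<phi> b"
      have "(ginv \<G> a, gcomp \<G> a b) \<in> composable \<G>"
        using comp_assoc[OF ginv_left[OF ab(1)] ab(3)] by simp
      then show ?thesis
        unfolding ab(4,5) comp[OF ab(3), symmetric] inv[OF ab(1), symmetric]
        by (metis comp ginv_cancel_left[OF ab(3)])
    qed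
    show "gcomp \<H> (gcomp \<H> q p) (ginv \<H> p) = q" if "(q, p) \<in> composable \<H>" for p q
    proof (rule compE[OF that])
      fix b a assume ab: "b \<in> ?X" "a \<in> ?X" "(b, a) \<in> composable \<G>" "q = \<phi> b" "p = \<phi> a"
      have "(gcomp \<G> b a, ginv \<G> a) \<in> composable \<G>"
        using comp_assoc[OF ab(3) ginv_right[OF ab(2)]] by simp
      then show ?thesis
        unfolding ab(4,5) comp[OF ab(3), symmetric] inv[OF ab(2), symmetric]
        by (metis comp ginv_cancel_right[OF ab(3)])
    qed
    show "(gcomp \<H> p q, r) \<in> composable \<H> \<and> (p, gcomp \<H> q r) \<in> composable \<H> \<and>
        gcomp \<H> (gcomp \<H> p q) r = gcomp \<H> p (gcomp \<H> q r)"
      if pq: "(p, q) \<in> composable \<H>" and qr: "(q, r) \<in> composable \<H>" for p q r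
    proof (rule compE[OF pq])
      fix a b assume ab: "a \<in> ?X" "b \<in> ?X" "(a, b) \<in> composable \<G>" "p = \<phi> a" "q = \<phi> b"
      have "r \<in> ?Y" using qr arr by auto
      then obtain d where d: "d \<in> ?X" "r = \<phi> d" by (rule arrE)
      have bd: "(b, d) \<in> composable \<G>" using qr composable[OF ab(2) d(1)] ab d by simp
      note assoc = comp_assoc[OF ab(3) bd]
      show ?thesis
        unfolding ab(4,5) d(2) comp[OF ab(3), symmetric] comp[OF bd, symmetric]
        using assoc by (simp add: comp composable comp_arrow ab(1-3) d(1) bd flip: comp)
    qed
    show "continuous_map (arrows \<H>) (arrows \<H>) (ginv \<H>)"
    proof (rule continuous_map_eq)
      show "continuous_map (arrows \<H>) (arrows \<H>) (\<phi> \<circ> (ginv \<G> \<circ> \<psi>))"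
        by (intro continuous_map_compose[OF _ \<phi>] continuous_map_compose[OF \<psi>] continuous_ginv)
      show "(\<phi> \<circ> (ginv \<G> \<circ> \<psi>)) p = ginv \<H> p" if "p \<in> ?Y" for p
        using that by (simp add: inv \<psi>X \<phi>\<psi>)
    qed
    show "continuous_map (subtopology (prod_topology (arrows \<H>) (arrows \<H>)) (composable \<H>))
        (arrows \<H>) (\<lambda>(p, q). gcomp \<H> p q)"
    proof (rule continuous_map_eq)
      let ?C = "subtopology (prod_topology (arrows \<H>) (arrows \<H>)) (composable \<H>)"
      have "continuous_map (prod_topology (arrows \<H>) (arrows \<H>)) (prod_topology (arrows \<G>) (arrows \<G>))
          (\<lambda>p. (\<psi> (fst p), \<psi> (snd p)))"
        using continuous_map_compose[OF continuous_map_fst \<psi>] continuous_map_compose[OF continuous_map_snd \<psi>]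
        by (intro continuous_map_pairedI) (simp_all add: o_def)
      moreover have "(\<psi> p, \<psi> q) \<in> composable \<G>" if "(p, q) \<in> composable \<H>" for p q
        using that arr composable[of "\<psi> p" "\<psi> q"] \<psi>X \<phi>\<psi> by fastforce
      ultimately have "continuous_map ?C (subtopology (prod_topology (arrows \<G>) (arrows \<G>)) (composable \<G>))
          (\<lambda>p. (\<psi> (fst p), \<psi> (snd p)))"
        unfolding continuous_map_in_subtopology by (auto intro: continuous_map_from_subtopology)
      from continuous_map_compose[OF continuous_map_compose[OF this continuous_comp] \<phi>]
      show "continuous_map ?C (arrows \<H>) (\<phi> \<circ> ((\<lambda>(a, b). gcomp \<G> a b) \<circ> (\<lambda>p. (\<psi> (fst p), \<psi> (snd p)))))" .
      show "(\<phi> \<circ> ((\<lambda>(a, b). gcomp \<G> a b) \<circ> (\<lambda>p. (\<psi> (fst p), \<psi> (snd p))))) p = (\<lambda>(p, q). gcomp \<H> p q) p"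
        if "p \<in> topspace ?C" for p
        using that composable[of "\<psi> (fst p)" "\<psi> (snd p)"] \<psi>X \<phi>\<psi> comp[of "\<psi> (fst p)" "\<psi> (snd p)"]
        by (auto simp: topspace_subtopology)
    qed
  qed
  show ?thesis
    unfolding topological_groupoid_iso_def
    using \<G> \<H> homeo composable comp by auto
qed

lemma topological_groupoid_transformation:
  assumes Q: "group Q"
    and cont: "\<And>q. q \<in> carrier Q \<Longrightarrow> continuous_map X X (\<alpha> q)"
    and mult: "\<And>p q x. p \<in> carrier Q \<Longrightarrow> q \<in> carrier Q \<Longrightarrow> x \<in> topspace X \<Longrightarrow>
      \<alpha> (p \<otimes>\<^bsub>Q\<^esub> q) x = \<alpha> p (\<alpha> q x)"
    and one: "\<And>x. x \<in> topspace X \<Longrightarrow> \<alpha> \<one>\<^bsub>Q\<^esub> x = x"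
  shows "topological_groupoid (transformation_groupoid Q X \<alpha>)"
proof -
  interpret group Q by (rule Q)
  let ?G = "transformation_groupoid Q X \<alpha>" and ?D = "discrete_topology (carrier Q)"
  have \<alpha>X: "\<alpha> q x \<in> topspace X" if "q \<in> carrier Q" "x \<in> topspace X" for q x
    using cont[OF that(1)] that(2) by (auto simp: continuous_map_def)
  have inv_\<alpha>: "\<alpha> (inv\<^bsub>Q\<^esub> q) (\<alpha> q x) = x" if "q \<in> carrier Q" "x \<in> topspace X" for q x
    using mult[of "inv\<^bsub>Q\<^esub> q" q x] one that by simp
  have cancel: "inv\<^bsub>Q\<^esub> p \<otimes>\<^bsub>Q\<^esub> (p \<otimes>\<^bsub>Q\<^esub> q) = q" if "p \<in> carrier Q" "q \<in> carrier Q" for p q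
    using that by (simp flip: m_assoc)
  \<comment> \<open>The group factor is discrete: near \<open>(q, x)\<close> it suffices to take the
    slice over \<open>{q}\<close>, which reduces joint continuity to that of
    \<open>\<alpha> q\<close>.\<close>
  have act: "continuous_map (prod_topology ?D X) X (\<lambda>p. \<alpha> (fst p) (snd p))"
    unfolding continuous_map_def
  proof (intro conjI allI impI)
    fix U assume U: "openin X U"
    show "openin (prod_topology ?D X) {p \<in> topspace (prod_topology ?D X). \<alpha> (fst p) (snd p) \<in> U}"
      unfolding openin_prod_topology_alt
    proof (intro allI impI)
      fix q x assume "(q, x) \<in> {p \<in> topspace (prod_topology ?D X). \<alpha> (fst p) (snd p) \<in> U}"
      then have qx: "q \<in> carrier Q" "x \<in> topspace X" "\<alpha> q x \<in> U" by auto
      have "openin X {y \<in> topspace X. \<alpha> q y \<in> U}"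
        using cont[OF qx(1)] U by (simp add: continuous_map_def)
      then show "\<exists>V W. openin ?D V \<and> openin X W \<and> q \<in> V \<and> x \<in> W \<and>
          V \<times> W \<subseteq> {p \<in> topspace (prod_topology ?D X). \<alpha> (fst p) (snd p) \<in> U}"
        using qx by (intro exI[of _ "{q}"] exI[of _ "{y \<in> topspace X. \<alpha> q y \<in> U}"]) auto
    qed
  qed (use \<alpha>X in auto)
  show ?thesis
  proof
    show "continuous_map (arrows ?G) (arrows ?G) (ginv ?G)"
    proof -
      have "continuous_map ?D ?D (\<lambda>q. inv\<^bsub>Q\<^esub> q)" by (auto simp: continuous_map_def)
      from continuous_map_compose[OF continuous_map_fst this]
      have "continuous_map (prod_topology ?D X) (prod_topology ?D X) (\<lambda>p. (inv\<^bsub>Q\<^esub> (fst p), \<alpha> (fst p) (snd p)))"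
        by (intro continuous_map_pairedI act) (simp add: o_def)
      then show ?thesis by (simp add: transformation_groupoid_def case_prod_unfold)
    qed
    show "continuous_map (subtopology (prod_topology (arrows ?G) (arrows ?G)) (composable ?G)) (arrows ?G)
        (\<lambda>(a, b). gcomp ?G a b)"
    proof -
      let ?P = "prod_topology (prod_topology ?D X) (prod_topology ?D X)"
      have "continuous_map (prod_topology ?D ?D) ?D (\<lambda>p. fst p \<otimes>\<^bsub>Q\<^esub> snd p)"
        unfolding prod_topology_discrete_topology[symmetric] by (auto simp: continuous_map_def)
      moreover have "continuous_map ?P ?D (fst \<circ> fst)" "continuous_map ?P ?D (fst \<circ> snd)"
        by (rule continuous_map_compose[OF continuous_map_fst continuous_map_fst]
          continuous_map_compose[OF continuous_map_snd continuous_map_fst])+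
      then have "continuous_map ?P (prod_topology ?D ?D) (\<lambda>p. (fst (fst p), fst (snd p)))"
        by (intro continuous_map_pairedI) (simp_all add: o_def)
      ultimately have "continuous_map ?P ?D (\<lambda>p. fst (fst p) \<otimes>\<^bsub>Q\<^esub> fst (snd p))"
        by (auto dest: continuous_map_compose simp: o_def)
      moreover have "continuous_map ?P X (snd \<circ> snd)"
        by (rule continuous_map_compose[OF continuous_map_snd continuous_map_snd])
      then have "continuous_map ?P X (\<lambda>p. snd (snd p))" by (simp add: o_def)
      ultimately have "continuous_map ?P (prod_topology ?D X) (\<lambda>p. (fst (fst p) \<otimes>\<^bsub>Q\<^esub> fst (snd p), snd (snd p)))"
        by (rule continuous_map_pairedI)
      then show ?thesis
        by (simp add: transformation_groupoid_def case_prod_unfold continuous_map_from_subtopology)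
    qed
  qed (auto simp: transformation_groupoid_def \<alpha>X inv_\<alpha> mult m_assoc cancel)
qed

section \<open>The isomorphism\<close>

context twisted_pair
begin

text \<open>The map is wanted on cosets, so a representative is chosen; \<open>coset_germ_eq\<close>
  shows that the choice does not affect the class.\<close>

definition coset_germ :: "'a set \<times> ('a operator \<Rightarrow> complex) \<Rightarrow> 'a weyl_triple set" where
  "coset_germ = (\<lambda>(q, x). weyl_class A B (\<delta> (SOME g. g \<in> carrier G \<and> q = S #> g)) x)"

lemma coset_germ_eq:
  assumes g: "g \<in> carrier G" and x: "x \<in> points"
  shows "coset_germ (S #> g, x) = weyl_class A B (\<delta> g) x"
proof -
  define h where "h = (SOME h. h \<in> carrier G \<and> S #> g = S #> h)"
  have h: "h \<in> carrier G" "S #> g = S #> h"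
    unfolding h_def using someI_ex[of "\<lambda>h. h \<in> carrier G \<and> S #> g = S #> h"] g by auto
  then have "h \<in> S #> g" using rcos_self[OF h(1) subgroup] by simp
  then have "weyl_class A B (\<delta> h) x = weyl_class A B (\<delta> g) x"
    by (intro weyl_class_eqI delta_normalizer g h germ_eq_delta_coset x)
  then show ?thesis by (simp add: coset_germ_def h_def)
qed

lemma carrier_FactGroup_eq: "carrier (G Mod S) = {S #> g | g. g \<in> carrier G}"
  by (auto simp: FactGroup_def RCOSETS_def)

lemma mult_FactGroup_coset:
  "g \<in> carrier G \<Longrightarrow> h \<in> carrier G \<Longrightarrow> (S #> g) \<otimes>\<^bsub>G Mod S\<^esub> (S #> h) = S #> (g \<otimes> h)"
  by (simp add: normal.rcos_sum[OF normal])

lemma inv_FactGroup_coset: "g \<in> carrier G \<Longrightarrow> inv\<^bsub>G Mod S\<^esub> (S #> g) = S #> inv g"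
  using normal.inv_FactGroup[OF normal, of "S #> g"] normal.rcos_inv[OF normal, of g]
  by (auto simp: carrier_FactGroup_eq)

lemma topological_groupoid_coset_action:
  "topological_groupoid (transformation_groupoid (G Mod S) (spectrum B) (coset_action G c S))"
proof (rule topological_groupoid_transformation[OF normal.factorgroup_is_group[OF normal]])
  show "continuous_map (spectrum B) (spectrum B) (coset_action G c S q)" if "q \<in> carrier (G Mod S)" for q
    using that continuous_map_weyl_delta by (auto simp: carrier_FactGroup_eq coset_action_eq)
  show "coset_action G c S (p \<otimes>\<^bsub>G Mod S\<^esub> q) x = coset_action G c S p (coset_action G c S q x)"
    if pq: "p \<in> carrier (G Mod S)" "q \<in> carrier (G Mod S)" and x: "x \<in> topspace (spectrum B)" for p q x
  proof -
    obtain g h where "g \<in> carrier G" "h \<in> carrier G" "p = S #> g" "q = S #> h"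
      using pq by (auto simp: carrier_FactGroup_eq)
    then show ?thesis
      using x by (simp add: mult_FactGroup_coset coset_action_eq weyl_map_delta_mult topspace_spectrum
        del: mult_FactGroup)
  qed
  show "coset_action G c S \<one>\<^bsub>G Mod S\<^esub> x = x" if "x \<in> topspace (spectrum B)" for x
  proof -
    have "S #> \<one> = S" using subgroup.subset[OF subgroup] by (rule coset_mult_one)
    then show ?thesis
      using coset_action_eq[OF one_closed] weyl_map_delta_subgroup[OF subgroup.one_closed[OF subgroup], of x] that
      by (simp add: topspace_spectrum)
  qed
qed

abbreviation (input) K where
  "K \<equiv> transformation_groupoid (G Mod S) (spectrum B) (coset_action G c S)"

lemma arrows_K: "arrows K = prod_topology (discrete_topology (carrier (G Mod S))) (spectrum B)"
  by (simp add: transformation_groupoid_def)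

lemma topspace_arrows_KE:
  assumes "a \<in> topspace (arrows K)"
  obtains g x where "g \<in> carrier G" "x \<in> points" "a = (S #> g, x)"
  using assms by (auto simp: arrows_K topspace_spectrum carrier_FactGroup_eq)

section \<open>Continuity, openness and bijectivity of the coset map\<close>

lemma continuous_map_coset_germ: "continuous_map (arrows K) (weyl_topology A B) coset_germ"
  unfolding weyl_topology_eq continuous_on_generated_topo_iff
proof (intro conjI allI impI)
  fix W assume "W \<in> {weyl_basic n U V | n U V. n \<in> normalizer A B \<and> openin (spectrum B) U \<and> openin (spectrum B) V}"
  then obtain n U V where W: "W = weyl_basic n U V" and n: "n \<in> normalizer A B"
    and U: "openin (spectrum B) U" and V: "openin (spectrum B) V" by blast
  show "openin (arrows K) (coset_germ -` W \<inter> topspace (arrows K))"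
    unfolding arrows_K openin_prod_topology_alt
  proof (intro allI impI)
    fix q x
    assume "(q, x) \<in> coset_germ -` W \<inter> topspace (prod_topology (discrete_topology (carrier (G Mod S))) (spectrum B))"
    then obtain g where g: "g \<in> carrier G" "q = S #> g" and x: "x \<in> points" and "coset_germ (q, x) \<in> W"
      by (auto simp: topspace_spectrum carrier_FactGroup_eq)
    then have "weyl_class A B (\<delta> g) x \<in> weyl_basic n U V" by (simp add: W coset_germ_eq)
    then obtain y where eq: "weyl_class A B (\<delta> g) x = weyl_class A B n y"
      and y: "y \<in> weyl_dom B n" "weyl_map B n y \<in> V" "y \<in> U" unfolding weyl_basic_def by blast
    have "x \<in> weyl_dom B (\<delta> g)" using x g by (simp add: weyl_dom_delta)
    from eq[unfolded weyl_class_eq_iff[OF delta_normalizer[OF g(1)] this n y(1)]]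
    have "x = y" and germ: "germ_eq (\<delta> g) n x" by blast+
    \<comment> \<open>Points near \<open>x\<close> where the germs of \<open>\<delta> g\<close> and
      \<open>n\<close> still agree and both conditions of the basic set still hold.\<close>
    let ?O = "{u. germ_eq (\<delta> g) n u} \<inter> U \<inter> {u \<in> weyl_dom B n. weyl_map B n u \<in> V}"
    have "openin (spectrum B) ?O"
      by (intro openin_Int openin_germ_eq U openin_weyl_preimage n V)
    moreover have "x \<in> ?O" using germ y \<open>x = y\<close> by simp
    moreover have "(q, u) \<in> coset_germ -` W" if u: "u \<in> ?O" for u
    proof -
      have "u \<in> points" using u weyl_dom_points by blast
      then have "coset_germ (q, u) = weyl_class A B n u"
        using u g by (simp add: coset_germ_eq weyl_class_eqI delta_normalizer n)
      then show ?thesis using u unfolding W weyl_basic_def by auto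
    qed
    moreover have "?O \<subseteq> points" using weyl_dom_points by blast
    ultimately show "\<exists>P O'. openin (discrete_topology (carrier (G Mod S))) P \<and> openin (spectrum B) O' \<and>
        q \<in> P \<and> x \<in> O' \<and> P \<times> O' \<subseteq> coset_germ -` W \<inter>
          topspace (prod_topology (discrete_topology (carrier (G Mod S))) (spectrum B))"
      using g by (intro exI[of _ "{q}"] exI[of _ ?O]) (auto simp: topspace_spectrum carrier_FactGroup_eq)
  qed
next
  show "coset_germ ` topspace (arrows K) \<subseteq>
      \<Union> {weyl_basic n U V | n U V. n \<in> normalizer A B \<and> openin (spectrum B) U \<and> openin (spectrum B) V}"
    unfolding topology_generated_by_topspace[symmetric] weyl_topology_eq[symmetric] topspace_weyl_topology
  proof (intro image_subsetI)
    fix a assume "a \<in> topspace (arrows K)"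
    then obtain g x where "g \<in> carrier G" "x \<in> points" "a = (S #> g, x)" by (rule topspace_arrows_KE)
    then show "coset_germ a \<in> {weyl_class A B n x | n x. n \<in> normalizer A B \<and> x \<in> weyl_dom B n}"
      using delta_normalizer weyl_dom_delta coset_germ_eq by blast
  qed
qed

lemma open_map_coset_germ: "open_map (arrows K) (weyl_topology A B) coset_germ"
  unfolding open_map_def
proof (intro allI impI)
  fix W assume W: "openin (arrows K) W"
  show "openin (weyl_topology A B) (coset_germ ` W)"
  proof (subst openin_subopen, intro ballI)
    fix P assume "P \<in> coset_germ ` W"
    then obtain q x where qx: "(q, x) \<in> W" and P: "P = coset_germ (q, x)" by auto
    obtain D U where D: "q \<in> D" and U: "openin (spectrum B) U" "x \<in> U" and sub: "D \<times> U \<subseteq> W"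
      using W[unfolded arrows_K openin_prod_topology_alt, rule_format, OF qx] by metis
    have "(q, x) \<in> topspace (arrows K)" using qx openin_subset[OF W] by blast
    then obtain g where g: "g \<in> carrier G" "q = S #> g" by (rule topspace_arrows_KE) auto
    have Up: "u \<in> points" if "u \<in> U" for u
      using that openin_subset[OF U(1)] by (auto simp: topspace_spectrum)
    \<comment> \<open>The slice over one coset is carried onto a basic open set, since the domain of
      \<open>\<delta> g\<close> is the whole spectrum.\<close>
    have img: "weyl_basic (\<delta> g) U (topspace (spectrum B)) = coset_germ ` ({q} \<times> U)"
      unfolding weyl_basic_topspace[OF delta_normalizer[OF g(1)]] weyl_dom_delta[OF g(1)]
      using Up g by (force simp: coset_germ_eq)
    have "openin (weyl_topology A B) (weyl_basic (\<delta> g) U (topspace (spectrum B)))"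
      unfolding weyl_topology_eq
      by (rule topology_generated_by_Basis) (use delta_normalizer[OF g(1)] U(1) in blast)
    then show "\<exists>T. openin (weyl_topology A B) T \<and> P \<in> T \<and> T \<subseteq> coset_germ ` W"
      unfolding img P using D U(2) sub by (intro exI[of _ "coset_germ ` ({q} \<times> U)"]) auto
  qed
qed

lemma coset_germ_image: "coset_germ ` topspace (arrows K) = topspace (weyl_topology A B)"
proof
  show "coset_germ ` topspace (arrows K) \<subseteq> topspace (weyl_topology A B)"
    using continuous_map_coset_germ by (rule continuous_map_image_subset_topspace)
  show "topspace (weyl_topology A B) \<subseteq> coset_germ ` topspace (arrows K)"
  proof
    fix P assume "P \<in> topspace (weyl_topology A B)"
    then obtain n x where n: "n \<in> normalizer A B" and x: "x \<in> weyl_dom B n" and P: "P = weyl_class A B n x"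
      unfolding topspace_weyl_topology by blast
    obtain g where g: "g \<in> carrier G" and "germ_eq n (\<delta> g) x" using germ_eq_delta[OF n x] by blast
    then have "P = coset_germ (S #> g, x)"
      using weyl_dom_points[OF x] by (simp add: P coset_germ_eq weyl_class_eqI n delta_normalizer)
    moreover have "(S #> g, x) \<in> topspace (arrows K)"
      using g weyl_dom_points[OF x] by (auto simp: arrows_K topspace_spectrum carrier_FactGroup_eq)
    ultimately show "P \<in> coset_germ ` topspace (arrows K)" by blast
  qed
qed

lemma inj_on_coset_germ:
  assumes free: "topologically_free (G Mod S) (spectrum B) (coset_action G c S)"
  shows "inj_on coset_germ (topspace (arrows K))"
proof (rule inj_onI)
  fix a b assume a: "a \<in> topspace (arrows K)" and b: "b \<in> topspace (arrows K)" and eq: "coset_germ a = coset_germ b"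
  obtain g x where g: "g \<in> carrier G" "x \<in> points" "a = (S #> g, x)" using a by (rule topspace_arrows_KE)
  obtain h y where h: "h \<in> carrier G" "y \<in> points" "b = (S #> h, y)" using b by (rule topspace_arrows_KE)
  have "weyl_class A B (\<delta> g) x = weyl_class A B (\<delta> h) y" using eq g h by (simp add: coset_germ_eq)
  moreover have "x \<in> weyl_dom B (\<delta> g)" "y \<in> weyl_dom B (\<delta> h)" using g h by (simp_all add: weyl_dom_delta)
  ultimately have "x = y" "germ_eq (\<delta> g) (\<delta> h) x"
    using weyl_class_eq_iff[OF delta_normalizer[OF g(1)] _ delta_normalizer[OF h(1)]] by blast+
  then show "a = b" using germ_eq_delta_imp_coset_eq[OF free g(1) h(1)] g h by simp
qed

section \<open>Compatibility with composition and inversion\<close>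

lemma topological_groupoid_iso_coset_germ:
  assumes free: "topologically_free (G Mod S) (spectrum B) (coset_action G c S)"
  shows "topological_groupoid_iso K (weyl_groupoid A B) coset_germ"
proof (rule topological_groupoid_transport[OF topological_groupoid_coset_action])
  have arrows_weyl: "arrows (weyl_groupoid A B) = weyl_topology A B" by (simp add: weyl_groupoid_def)
  show "homeomorphic_map (arrows K) (arrows (weyl_groupoid A B)) coset_germ"
    unfolding arrows_weyl
    by (intro bijective_open_imp_homeomorphic_map continuous_map_coset_germ open_map_coset_germ
      coset_germ_image inj_on_coset_germ free)
  show "composable (weyl_groupoid A B) \<subseteq>
      topspace (arrows (weyl_groupoid A B)) \<times> topspace (arrows (weyl_groupoid A B))"
    unfolding arrows_weyl topspace_weyl_topology quotient_weyl_rel[symmetric] by (auto simp: weyl_groupoid_def)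
  show "(coset_germ a, coset_germ b) \<in> composable (weyl_groupoid A B) \<longleftrightarrow> (a, b) \<in> composable K"
    if a: "a \<in> topspace (arrows K)" and b: "b \<in> topspace (arrows K)" for a b
  proof -
    obtain g x where g: "g \<in> carrier G" "x \<in> points" "a = (S #> g, x)" using a by (rule topspace_arrows_KE)
    obtain h y where h: "h \<in> carrier G" "y \<in> points" "b = (S #> h, y)" using b by (rule topspace_arrows_KE)
    have "(coset_germ a, coset_germ b) \<in> composable (weyl_groupoid A B) \<longleftrightarrow> x = weyl_map B (\<delta> h) y"
      using composable_weyl_groupoid[of "\<delta> g" "\<delta> h" y x] g h
      by (simp add: coset_germ_eq delta_normalizer weyl_dom_delta)
    also have "\<dots> \<longleftrightarrow> (a, b) \<in> composable K"
      using g h by (auto simp: transformation_groupoid_def topspace_spectrum coset_action_eq carrier_FactGroup_eq)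
    finally show ?thesis .
  qed
  show "coset_germ (gcomp K a b) = gcomp (weyl_groupoid A B) (coset_germ a) (coset_germ b)"
    if ab: "(a, b) \<in> composable K" for a b
  proof -
    obtain g x h where g: "g \<in> carrier G" "x \<in> points" and h: "h \<in> carrier G"
      and b: "b = (S #> h, x)" and a: "a = (S #> g, weyl_map B (\<delta> h) x)"
      using ab by (auto simp: transformation_groupoid_def topspace_spectrum carrier_FactGroup_eq coset_action_eq)
    have "gcomp K a b = (S #> (g \<otimes> h), x)"
      using g h by (simp add: a b transformation_groupoid_def mult_FactGroup_coset del: mult_FactGroup)
    then have "coset_germ (gcomp K a b) = weyl_class A B (\<delta> (g \<otimes> h)) x"
      using g h by (simp add: coset_germ_eq)
    \<comment> \<open>The two operators differ by the cocycle value \<open>c g h\<close>, of modulus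
      one, which germ classes do not see.\<close>
    also have "\<dots> = weyl_class A B (\<delta> g o\<^sub>L \<delta> h) x"
      using g h by (simp add: delta_compose weyl_class_scaleC delta_normalizer norm_cocycle weyl_dom_delta)
    also have "\<dots> = gcomp (weyl_groupoid A B) (coset_germ a) (coset_germ b)"
      using g h by (simp add: a b coset_germ_eq weyl_map_delta_point gcomp_weyl_groupoid delta_normalizer weyl_dom_delta)
    finally show ?thesis .
  qed
  show "coset_germ (ginv K a) = ginv (weyl_groupoid A B) (coset_germ a)" if a: "a \<in> topspace (arrows K)" for a
  proof -
    obtain g x where g: "g \<in> carrier G" "x \<in> points" "a = (S #> g, x)" using a by (rule topspace_arrows_KE)
    have "ginv K a = (S #> inv g, weyl_map B (\<delta> g) x)"
      using g by (simp add: transformation_groupoid_def inv_FactGroup_coset coset_action_eq)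
    then have "coset_germ (ginv K a) = weyl_class A B (\<delta> (inv g)) (weyl_map B (\<delta> g) x)"
      using g by (simp add: coset_germ_eq weyl_map_delta_point)
    also have "\<dots> = weyl_class A B (star (\<delta> g)) (weyl_map B (\<delta> g) x)"
      using g by (simp add: star_delta weyl_class_scaleC delta_normalizer norm_cocycle weyl_dom_delta weyl_map_delta_point)
    also have "\<dots> = ginv (weyl_groupoid A B) (coset_germ a)"
      using g by (simp add: coset_germ_eq ginv_weyl_groupoid delta_normalizer weyl_dom_delta)
    finally show ?thesis .
  qed
qed

end

theorem theorem5p2:
  fixes G :: "('a, 'm) monoid_scheme" (structure)
    and c :: "'a \<Rightarrow> 'a \<Rightarrow> complex" and S :: "'a set"
  defines "A \<equiv> reduced_alg G c (carrier G)"
    and "B \<equiv> reduced_alg G c S"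
    and "\<alpha> \<equiv> coset_action G c S"
  assumes "group G" and "countable (carrier G)"
    and "two_cocycle G c"
    and "maximal_abelian_symmetric G c S"
    and "S \<lhd> G"
    and "immediately_centralizing G S"
    and "topologically_free (G Mod S) (spectrum B) \<alpha>"
  shows "\<exists>\<phi>. (\<forall>g\<in>carrier G. \<forall>x\<in>topspace (spectrum B).
              \<phi> (S #> g, x) = weyl_class A B (delta G c g) x) \<and>
            topological_groupoid_iso
              (transformation_groupoid (G Mod S) (spectrum B) \<alpha>) (weyl_groupoid A B) \<phi>"
proof -
  interpret twisted_pair G c S
    using assms(4,6,7,8)
    by (simp add: twisted_pair_def twisted_group_def twisted_group_axioms_def twisted_pair_axioms_def
      maximal_abelian_symmetric_def)
  show ?thesis
    unfolding A_def B_def \<alpha>_def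
    using coset_germ_eq topological_groupoid_iso_coset_germ assms(10)[unfolded B_def \<alpha>_def]
    by (intro exI[of _ coset_germ]) (simp add: topspace_spectrum)
qed

end
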